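(* Let $f$ be the continuous density of the limiting QuickSort distribution and let $\gamma := \left(2-\frac{1}{\ln 2}\right)^{-1}$. As $x\to\infty$, $$\exp\left[-e^{\gamma x+\ln\ln x+O(1)}\right]\le f(-x)\le \exp\left[-e^{\gamma x+O(1)}\right],$$ $$\exp\left[-x\ln x-x\ln\ln x+O(x)\right]\le f(x)\le \exp\left[-x\ln x+O(x)\right].$$
   Context: The limiting QuickSort distribution is the unique probability law $\mathcal{L}(Z)$ on $\mathbb{R}$ such that $\mathbb{E}Z$ exists and equals $0$ and $$Z \overset{\mathcal{L}}{=} UZ+(1-U)Z^*+g(U),$$ where $U$ is uniform on $(0,1)$, $Z^*$ has the same law as $Z$, the variables $U,Z,Z^*$ are independent, and $g(u):=2u\ln u+2(1-u)\ln(1-u)+1$ for $u\in(0,1)$. (Equivalently, it is the limit in law of $(X_n-\mathbb{E}X_n)/n$, where $X_n$ is the number of comparisons used by QuickSort to sort $n$ distinct numbers: $X_0=0$ and $X_n\overset{\mathcal{L}}{=}X_{U_n-1}+X^*_{n-U_n}+n-1$ for $n\ge1$, with $U_n$ uniform on $\{1,\dots,n\}$, $X^*_k\overset{\mathcal{L}}{=}X_k$, and $U_n,X_0,\dots,X_{n-1},X_0^*,\dots,X_{n-1}^*$ independent.) It is known that this law has a unique continuous density $f$, which is everywhere positive and infinitely differentiable on $\mathbb{R}$. Each occurrence of $O(1)$ or $O(x)$ in an inequality stands for some function of $x$ (possibly different in each occurrence) whose absolute value is at most a constant, respectively a constant times $x$, for all sufficiently large $x$. *)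

theory Defs
  imports "HOL-Probability.Probability" "HOL-Library.Landau_Symbols"
begin

definition qs_toll :: "real \<Rightarrow> real" where
  "qs_toll u = 2 * u * ln u + 2 * (1 - u) * ln (1 - u) + 1"

(* Under the product measure the three coordinates (u, z, z') are independent, u is uniform on
   (0,1), and z and z' both have law \<mu>; so the push-forward is the law of
   U Z + (1 - U) Z* + g(U). *)
definition limiting_quicksort_law :: "real measure \<Rightarrow> bool" where
  "limiting_quicksort_law \<mu> \<longleftrightarrow>
     prob_space \<mu> \<and> sets \<mu> = sets borel \<and>
     integrable \<mu> (\<lambda>z. z) \<and> (\<integral>z. z \<partial>\<mu>) = 0 \<and>
     \<mu> = distr (uniform_measure lborel {0<..<1} \<Otimes>\<^sub>M (\<mu> \<Otimes>\<^sub>M \<mu>)) borel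
           (\<lambda>(u, z, z'). u * z + (1 - u) * z' + qs_toll u)"

(* Nonnegativity is required explicitly because ennreal sends negative reals to 0. *)
definition continuous_density :: "real measure \<Rightarrow> (real \<Rightarrow> real) \<Rightarrow> bool" where
  "continuous_density \<mu> f \<longleftrightarrow>
     continuous_on UNIV f \<and> (\<forall>x. 0 \<le> f x) \<and> \<mu> = density lborel (\<lambda>x. ennreal (f x))"

definition qs_gamma :: real where
  "qs_gamma = inverse (2 - 1 / ln 2)"

end

theory Submission
  imports Defs "HOL-Real_Asymp.Real_Asymp"
begin

text \<open>
  The fixed-point equation makes \<open>f(x)\<close> an integral of products \<open>f(z) f(y)\<close> over the ways to write
  \<open>x = u y + (1 - u) z + g(u)\<close>.

  Lower bounds: restricting this integral to a small box propagates a lower bound for \<open>f\<close> from one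
  interval to a shifted one.  With \<open>u\<close> near \<open>1/2\<close> the interval moves left by \<open>2 ln 2 - 1\<close> while
  the bound is squared, which gives the double exponential; with \<open>1 - u\<close> of order \<open>1/(x ln x)\<close> it
  moves right by almost \<open>1\<close> at the cost of one factor of that order.

  Upper bounds: the iterates of the fixed-point map started at the Dirac measure at \<open>0\<close> converge
  weakly to the law (comparison of characteristic functions needs only a mean), and explicit
  supersolutions of the recursion bound their moment generating functions: \<open>exp (O(e\<^sup>t))\<close> on the right
  and \<open>exp (t ln t / \<gamma> + O(t))\<close> on the left.  The density itself is bounded, since
  \<open>u \<mapsto> u y + (1 - u) z + g(u)\<close> is strictly convex and hence rarely flat; exponential tilting of the
  integral equation then transfers the Chernoff bounds from the law to \<open>f\<close>.
\<close>

section \<open>The toll function and the fixed-point map\<close>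

text \<open>The hypotheses supply a mean and the continuity of \<open>f\<close>; positivity,
  boundedness and exponential moments must all be derived. A moment generating function that might
  be infinite cannot be bounded from its own fixed-point equation. For the iterates, one induction
  yields finiteness and a bound uniform in n, and both survive the weak limit. Left tail: each shift
  by 2 ln 2 - 1 doubles -ln f, and 2^(x/(2 ln 2 - 1)) = exp(\<gamma> x). In the upper bound the same
  \<gamma> comes from the exponent t ln t / \<gamma>, minimised against t x at t of order
  exp(\<gamma> x). Right tail: a step with 1 - u of order \<delta> falls short of 1 by about
  \<delta> x and costs ln(1/\<delta>) in the exponent. For \<delta> = 1/(x ln x) the extra steps
  that this shortfall forces cost only O(x) in total. The upper bound uses the tilt t = ln x, for
  which exp t = x. Cauchy-Schwarz evaluates moment generating functions at doubled arguments. This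
  changes t ln t by O(t), harmless on the left, but would turn exp t into exp(2 t) on the right;
  hence the separate treatment of the right tail.\<close>

lemma qs_toll_measurable [measurable]: "qs_toll \<in> borel_measurable borel"
  unfolding qs_toll_def by measurable

lemma continuous_on_qs_toll: "continuous_on {0<..<1} qs_toll"
  unfolding qs_toll_def by (intro continuous_intros) auto

lemma isCont_qs_toll: "0 < u \<Longrightarrow> u < 1 \<Longrightarrow> isCont qs_toll u"
  using continuous_on_qs_toll by (simp add: continuous_on_eq_continuous_at)

lemma qs_toll_le_one:
  assumes "0 < u" "u < 1"
  shows "qs_toll u \<le> 1"
proof -
  have "u * ln u \<le> 0" "(1 - u) * ln (1 - u) \<le> 0"
    using assms by (auto intro!: mult_nonneg_nonpos)
  then show ?thesis unfolding qs_toll_def by linarith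
qed

lemma qs_toll_half: "qs_toll (1/2) = 1 - 2 * ln 2"
  by (simp add: qs_toll_def ln_div)

lemma qs_toll_gt_half:
  \<comment> \<open>Gibbs' inequality: up to an affine change g is minus the binary entropy, and ln
    x <= x - 1 is strict for x = 1/(2u) unless u = 1/2.\<close>
  assumes "0 < u" "u < 1" "u \<noteq> 1/2"
  shows "1 - 2 * ln 2 < qs_toll u"
proof -
  have "ln (1 / (2*u)) < 1 / (2*u) - 1"
    using ln_le_minus_one[of "1/(2*u)"] ln_eq_minus_one[of "1/(2*u)"] assms by (force simp: field_simps)
  then have 1: "u * ln (1 / (2*u)) < 1/2 - u"
    using assms by (auto simp: field_simps)
  have "ln (1 / (2*(1-u))) \<le> 1 / (2*(1-u)) - 1"
    using assms by (intro ln_le_minus_one) auto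
  then have 2: "(1-u) * ln (1 / (2*(1-u))) \<le> 1/2 - (1-u)"
    using assms by (auto simp: field_simps)
  have ln_eq: "ln (1 / (2*u)) = - ln 2 - ln u" "ln (1 / (2*(1-u))) = - ln 2 - ln (1-u)"
    using assms ln_mult_pos[of 2 "1-u"] ln_mult_pos[of 2 u] by (simp_all only: ln_div) (auto simp: ln_div)
  show ?thesis using 1 2 unfolding ln_eq by (simp add: qs_toll_def algebra_simps)
qed

lemma qs_toll_ge_half:
  assumes "0 < u" "u < 1"
  shows "1 - 2 * ln 2 \<le> qs_toll u"
  using qs_toll_gt_half[OF assms] qs_toll_half by (metis less_eq_real_def)

lemma abs_qs_toll_le_one:
  assumes "0 < u" "u < 1"
  shows "\<bar>qs_toll u\<bar> \<le> 1"
  using qs_toll_ge_half[OF assms] qs_toll_le_one[OF assms] ln_2_less_1 by auto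

lemma qs_toll_has_derivative:
  assumes "0 < u" "u < 1"
  shows "(qs_toll has_real_derivative 2 * (ln u - ln (1 - u))) (at u)"
proof -
  have "(qs_toll has_real_derivative
      2 * ln u + 2 * (u * (1 / u)) - 2 * ln (1 - u) - 2 * ((1 - u) * (1 / (1 - u)))) (at u)"
    unfolding qs_toll_def using assms
    by (auto intro!: derivative_eq_intros simp: divide_simps) (simp_all add: algebra_simps)
  moreover have "u * (1 / u) = 1" "(1 - u) * (1 / (1 - u)) = 1" using assms by auto
  ultimately show ?thesis by (simp add: algebra_simps)
qed

lemma qs_toll_half_lipschitz:
  assumes "1/2 \<le> u" "u \<le> 3/4"
  shows "\<bar>qs_toll u - qs_toll (1/2)\<bar> \<le> 4 * (u - 1/2)"
proof (cases "1/2 < u")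
  case lt: True
  have "\<exists>z. 1/2 < z \<and> z < u \<and> qs_toll u - qs_toll (1/2) = (u - 1/2) * (2 * (ln z - ln (1 - z)))"
    using lt assms by (intro MVT2 qs_toll_has_derivative) auto
  then obtain z where z: "1/2 < z" "z < u"
    "qs_toll u - qs_toll (1/2) = (u - 1/2) * (2 * (ln z - ln (1 - z)))" by blast
  have "ln z - ln (1 - z) = ln (z / (1 - z))" using z assms by (simp add: ln_div)
  also have "\<dots> \<le> z / (1 - z) - 1" using z assms by (intro ln_le_minus_one) auto
  also have "\<dots> \<le> 2" using z assms by (auto simp: field_simps)
  finally have "ln z - ln (1 - z) \<le> 2" .
  moreover have "0 \<le> ln z - ln (1 - z)" using z assms by simp
  ultimately have "\<bar>2 * (ln z - ln (1 - z))\<bar> \<le> 4" by simp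
  then have "\<bar>(u - 1/2) * (2 * (ln z - ln (1 - z)))\<bar> \<le> (u - 1/2) * 4"
    using lt unfolding abs_mult by (intro mult_mono) auto
  then show ?thesis using z by simp
next
  case False
  then have "u = 1/2" using assms by linarith
  then show ?thesis unfolding \<open>u = 1/2\<close> by simp
qed

text \<open>Measures how far a shift by g(u) falls short of 1 when 1 - u = v is small; the term (1 -
  v) ln (1 - v) costs at most v by ln x <= x - 1.\<close>

lemma one_minus_qs_toll_bounds:
  assumes "0 < v" "v < 1"
  shows "0 \<le> 1 - qs_toll (1 - v)" "1 - qs_toll (1 - v) \<le> 2 * v - 2 * v * ln v"
proof -
  show "0 \<le> 1 - qs_toll (1 - v)" using qs_toll_le_one[of "1-v"] assms by simp
  have "ln (1 / (1-v)) \<le> 1/(1-v) - 1" using assms by (intro ln_le_minus_one) auto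
  then have "- ((1-v) * ln (1-v)) \<le> v" using assms by (auto simp: field_simps ln_div)
  then show "1 - qs_toll (1 - v) \<le> 2 * v - 2 * v * ln v"
    by (simp add: qs_toll_def algebra_simps)
qed

lemma qs_gamma_eq: "qs_gamma = ln 2 / (2 * ln 2 - 1)"
  using ln2_ge_two_thirds by (simp add: qs_gamma_def field_simps)

lemma qs_gamma_pos: "0 < qs_gamma"
  using ln2_ge_two_thirds by (simp add: qs_gamma_eq)

section \<open>The fixed-point map and its integrals\<close>

definition qs_map :: "real measure \<Rightarrow> real measure" where
  "qs_map \<nu> = distr (uniform_measure lborel {0<..<1} \<Otimes>\<^sub>M (\<nu> \<Otimes>\<^sub>M \<nu>)) borel
     (\<lambda>(u, z, z'). u * z + (1 - u) * z' + qs_toll u)"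

lemma prob_space_uniform_01: "prob_space (uniform_measure lborel {0<..<1::real})"
  by (intro prob_space_uniform_measure) auto

lemma sets_qs_map [simp]: "sets (qs_map \<nu>) = sets borel"
  by (simp add: qs_map_def)

context
  fixes \<nu> :: "real measure"
  assumes prob: "prob_space \<nu>" and sets [measurable_cong]: "sets \<nu> = sets borel"
begin

lemma real_distribution_of_prob: "real_distribution \<nu>"
  using prob sets sets_eq_imp_space_eq[OF sets]
  by (simp add: real_distribution_def real_distribution_axioms_def)

lemma prob_space_qs_map: "prob_space (qs_map \<nu>)"
proof -
  interpret N: prob_space \<nu> by fact
  interpret U: prob_space "uniform_measure lborel {0<..<1::real}" by (rule prob_space_uniform_01)
  interpret NN: pair_prob_space \<nu> \<nu> ..
  interpret P: pair_prob_space "uniform_measure lborel {0<..<1::real}" "\<nu> \<Otimes>\<^sub>M \<nu>" ..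
  have [measurable_cong]: "sets (uniform_measure lborel {0<..<1::real}) = sets borel" by simp
  show ?thesis unfolding qs_map_def by (intro P.prob_space_distr) measurable
qed

lemma nn_integral_qs_map:
  assumes [measurable]: "\<phi> \<in> borel_measurable borel"
  shows "(\<integral>\<^sup>+x. \<phi> x \<partial>qs_map \<nu>) =
    (\<integral>\<^sup>+u. indicator {0<..<1} u * (\<integral>\<^sup>+y. \<integral>\<^sup>+z. \<phi> (u * y + (1 - u) * z + qs_toll u) \<partial>\<nu> \<partial>\<nu>) \<partial>lborel)"
proof -
  interpret N: prob_space \<nu> by fact
  interpret U: prob_space "uniform_measure lborel {0<..<1::real}" by (rule prob_space_uniform_01)
  interpret NN: pair_prob_space \<nu> \<nu> ..
  have [measurable_cong]: "sets (uniform_measure lborel {0<..<1::real}) = sets borel" by simp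
  have "(\<integral>\<^sup>+x. \<phi> x \<partial>qs_map \<nu>) =
    (\<integral>\<^sup>+w. \<phi> (case w of (u, z, z') \<Rightarrow> u * z + (1 - u) * z' + qs_toll u)
      \<partial>(uniform_measure lborel {0<..<1} \<Otimes>\<^sub>M (\<nu> \<Otimes>\<^sub>M \<nu>)))"
    unfolding qs_map_def by (intro nn_integral_distr) measurable
  also have "\<dots> = (\<integral>\<^sup>+u. \<integral>\<^sup>+w. \<phi> (case w of (z, z') \<Rightarrow> u * z + (1 - u) * z' + qs_toll u) \<partial>(\<nu> \<Otimes>\<^sub>M \<nu>)
      \<partial>uniform_measure lborel {0<..<1})"
    by (subst NN.P.nn_integral_fst[symmetric]) auto
  also have "\<dots> = (\<integral>\<^sup>+u. \<integral>\<^sup>+y. \<integral>\<^sup>+z. \<phi> (u * y + (1 - u) * z + qs_toll u) \<partial>\<nu> \<partial>\<nu>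
      \<partial>uniform_measure lborel {0<..<1})"
    by (subst N.nn_integral_fst[symmetric]) auto
  also have "\<dots> = (\<integral>\<^sup>+u. indicator {0<..<1} u * (\<integral>\<^sup>+y. \<integral>\<^sup>+z. \<phi> (u * y + (1 - u) * z + qs_toll u) \<partial>\<nu> \<partial>\<nu>) \<partial>lborel)"
    by (subst nn_integral_uniform_measure) (auto simp: mult.commute[of _ "indicator _ _"] divide_ennreal_def)
  finally show ?thesis .
qed

end

lemma limiting_quicksort_law_iff:
  "limiting_quicksort_law \<mu> \<longleftrightarrow> prob_space \<mu> \<and> sets \<mu> = sets borel \<and>
     integrable \<mu> (\<lambda>z. z) \<and> (\<integral>z. z \<partial>\<mu>) = 0 \<and> \<mu> = qs_map \<mu>"
  by (simp add: limiting_quicksort_law_def qs_map_def)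

text \<open>The part of \<open>S\<close> where \<open>p\<close> exceeds \<open>q\<close> is open and
  null, hence empty. This turns the integral equation, valid only almost everywhere, into pointwise
  bounds on \<open>f\<close>.\<close>

lemma AE_le_imp_le_on_open:
  fixes p q :: "real \<Rightarrow> real"
  assumes "AE x in lborel. x \<in> S \<longrightarrow> p x \<le> q x" "open S" "continuous_on S p" "continuous_on S q"
    and "x \<in> S"
  shows "p x \<le> q x"
proof (rule ccontr)
  assume "\<not> p x \<le> q x"
  define V where "V = S \<inter> (\<lambda>x. p x - q x) -` {0<..}"
  have "open V" unfolding V_def using assms
    by (intro continuous_open_preimage continuous_intros) auto
  moreover have "x \<in> V" using assms \<open>\<not> p x \<le> q x\<close> by (auto simp: V_def)
  moreover have "emeasure lborel V = 0"
  proof -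
    have "AE x in lborel. x \<notin> V" using assms(1) by eventually_elim (auto simp: V_def)
    then show ?thesis using \<open>open V\<close> by (simp add: AE_iff_measurable[of V lborel "\<lambda>x. x \<notin> V"])
  qed
  ultimately show False
    using open_not_negligible[of V] null_sets_completionI[of V lborel]
    by (auto simp: negligible_iff_null_sets null_sets_def)
qed

section \<open>The integral equation for the density\<close>

locale quicksort_density =
  fixes \<mu> :: "real measure" and f :: "real \<Rightarrow> real"
  assumes law: "limiting_quicksort_law \<mu>"
    and dens: "continuous_density \<mu> f"
begin

lemma prob_mu: "prob_space \<mu>" and sets_mu [measurable_cong]: "sets \<mu> = sets borel"
  and integrable_mu: "integrable \<mu> (\<lambda>z. z)" and mean_mu: "(\<integral>z. z \<partial>\<mu>) = 0"
  and qs_map_mu: "qs_map \<mu> = \<mu>"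
  using law by (simp_all add: limiting_quicksort_law_iff)

lemma continuous_f: "continuous_on S f" and f_nonneg: "0 \<le> f x"
  and mu_density: "\<mu> = density lborel (\<lambda>x. ennreal (f x))"
  using dens continuous_on_subset[of UNIV f S] by (auto simp: continuous_density_def)

lemma f_measurable [measurable]: "f \<in> borel_measurable borel"
  by (intro borel_measurable_continuous_onI continuous_f)

sublocale prob_space \<mu> by (rule prob_mu)

lemma nn_integral_mu:
  assumes [measurable]: "\<phi> \<in> borel_measurable borel"
  shows "(\<integral>\<^sup>+x. \<phi> x \<partial>\<mu>) = (\<integral>\<^sup>+x. ennreal (f x) * \<phi> x \<partial>lborel)"
  unfolding mu_density by (intro nn_integral_density) auto

lemma nn_integral_mu_FPE:
  assumes [measurable]: "\<phi> \<in> borel_measurable borel"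
  shows "(\<integral>\<^sup>+x. \<phi> x \<partial>\<mu>) = (\<integral>\<^sup>+u. indicator {0<..<1} u *
      (\<integral>\<^sup>+z. \<integral>\<^sup>+y. \<phi> (u * y + (1 - u) * z + qs_toll u) \<partial>\<mu> \<partial>\<mu>) \<partial>lborel)"
proof -
  interpret P: pair_prob_space \<mu> \<mu> ..
  have "(\<integral>\<^sup>+x. \<phi> x \<partial>\<mu>) = (\<integral>\<^sup>+x. \<phi> x \<partial>qs_map \<mu>)"
    by (simp add: qs_map_mu)
  also have "\<dots> = (\<integral>\<^sup>+u. indicator {0<..<1} u *
      (\<integral>\<^sup>+y. \<integral>\<^sup>+z. \<phi> (u * y + (1 - u) * z + qs_toll u) \<partial>\<mu> \<partial>\<mu>) \<partial>lborel)"
    by (intro nn_integral_qs_map prob_mu sets_mu assms)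
  also have "\<dots> = (\<integral>\<^sup>+u. indicator {0<..<1} u *
      (\<integral>\<^sup>+z. \<integral>\<^sup>+y. \<phi> (u * y + (1 - u) * z + qs_toll u) \<partial>\<mu> \<partial>\<mu>) \<partial>lborel)"
    by (intro nn_integral_cong arg_cong2[where f="(*)"] refl P.Fubini') measurable
  finally show ?thesis .
qed

text \<open>The density at x of u Y + (1 - u) Z + g(u) for a fixed split point u, with Y and Z
  independent copies; the argument of the second \<open>f\<close> is the value of Y determined by x
  and z.\<close>

definition split_density :: "real \<Rightarrow> real \<Rightarrow> ennreal" where
  "split_density u x = (\<integral>\<^sup>+z. ennreal (f z) * ennreal (f ((x - qs_toll u - (1 - u) * z) / u) / u) \<partial>lborel)"

lemma split_density_measurable [measurable]: "case_prod split_density \<in> borel_measurable (borel \<Otimes>\<^sub>M borel)"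
  unfolding split_density_def by measurable

text \<open>Both sides give the same mass to every Borel set, by the fixed-point equation and
  Tonelli, and densities are unique almost everywhere.\<close>

lemma AE_density_eq:
  "AE x in lborel. ennreal (f x) = (\<integral>\<^sup>+u. indicator {0<..<1} u * split_density u x \<partial>lborel)"
    (is "AE x in lborel. _ = ?F x")
proof -
  have [measurable]: "?F \<in> borel_measurable borel" by measurable
  have "\<mu> = density lborel ?F"
  proof (rule measure_eqI)
    fix A assume "A \<in> sets \<mu>"
    then have [measurable]: "A \<in> sets borel" by (simp add: sets_mu)
    have inner: "(\<integral>\<^sup>+z. \<integral>\<^sup>+y. indicator A (u * y + (1 - u) * z + qs_toll u) \<partial>\<mu> \<partial>\<mu>) =
        (\<integral>\<^sup>+x. split_density u x * indicator A x \<partial>lborel)" if u: "0 < u" "u < 1" for u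
    proof -
      have "(\<integral>\<^sup>+y. indicator A (u * y + (1 - u) * z + qs_toll u) \<partial>\<mu>) =
          (\<integral>\<^sup>+x. ennreal (f ((x - qs_toll u - (1 - u) * z) / u) / u) * indicator A x \<partial>lborel)" for z
      proof -
        let ?c = "(1 - u) * z + qs_toll u"
        have "(\<integral>\<^sup>+y. indicator A (u * y + (1 - u) * z + qs_toll u) \<partial>\<mu>) =
          (\<integral>\<^sup>+y. ennreal (f y) * indicator A (u * y + (1 - u) * z + qs_toll u) \<partial>lborel)"
          by (intro nn_integral_mu) measurable
        \<comment> \<open>Substitution making x = u y + c the integration variable; the Jacobian 1/u
          later joins the density.\<close>
        also have "\<dots> = ennreal (1 / u) * (\<integral>\<^sup>+x. ennreal (f (- ?c / u + 1 / u * x)) *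
            indicator A (u * (- ?c / u + 1 / u * x) + (1 - u) * z + qs_toll u) \<partial>lborel)"
          using u by (subst nn_integral_real_affine[where c="1/u" and t="- ?c / u"]) auto
        also have "\<dots> = (\<integral>\<^sup>+x. ennreal (1 / u) * (ennreal (f (- ?c / u + 1 / u * x)) *
            indicator A (u * (- ?c / u + 1 / u * x) + (1 - u) * z + qs_toll u)) \<partial>lborel)"
          by (rule nn_integral_cmult[symmetric]) measurable
        also have "\<dots> = (\<integral>\<^sup>+x. ennreal (f ((x - qs_toll u - (1 - u) * z) / u) / u) * indicator A x \<partial>lborel)"
        proof (intro nn_integral_cong)
          fix x
          have 1: "- ?c / u + 1 / u * x = (x - qs_toll u - (1 - u) * z) / u"
            using u by (simp add: field_simps)
          have 2: "u * (- ?c / u + 1 / u * x) + (1 - u) * z + qs_toll u = x"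
            using u by (simp add: field_simps)
          show "ennreal (1 / u) * (ennreal (f (- ?c / u + 1 / u * x)) *
              indicator A (u * (- ?c / u + 1 / u * x) + (1 - u) * z + qs_toll u)) =
            ennreal (f ((x - qs_toll u - (1 - u) * z) / u) / u) * indicator A x"
            unfolding 2 unfolding 1 using u
            by (simp add: ennreal_mult'[symmetric] mult.assoc[symmetric] f_nonneg)
        qed
        finally show ?thesis .
      qed
      then have "(\<integral>\<^sup>+z. \<integral>\<^sup>+y. indicator A (u * y + (1 - u) * z + qs_toll u) \<partial>\<mu> \<partial>\<mu>) =
        (\<integral>\<^sup>+z. \<integral>\<^sup>+x. ennreal (f ((x - qs_toll u - (1 - u) * z) / u) / u) * indicator A x \<partial>lborel \<partial>\<mu>)"
        by simp
      also have "\<dots> = (\<integral>\<^sup>+z. ennreal (f z) *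
          (\<integral>\<^sup>+x. ennreal (f ((x - qs_toll u - (1 - u) * z) / u) / u) * indicator A x \<partial>lborel) \<partial>lborel)"
        by (intro nn_integral_mu) measurable
      also have "\<dots> = (\<integral>\<^sup>+z. \<integral>\<^sup>+x. ennreal (f z) *
          (ennreal (f ((x - qs_toll u - (1 - u) * z) / u) / u) * indicator A x) \<partial>lborel \<partial>lborel)"
        by (intro nn_integral_cong nn_integral_cmult[symmetric]) measurable
      also have "\<dots> = (\<integral>\<^sup>+x. \<integral>\<^sup>+z. ennreal (f z) *
          (ennreal (f ((x - qs_toll u - (1 - u) * z) / u) / u) * indicator A x) \<partial>lborel \<partial>lborel)"
        by (intro lborel_pair.Fubini') measurable
      also have "\<dots> = (\<integral>\<^sup>+x. split_density u x * indicator A x \<partial>lborel)"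
        unfolding split_density_def
        by (subst nn_integral_multc[symmetric]) (auto simp: mult.assoc)
      finally show ?thesis .
    qed
    have "emeasure \<mu> A = (\<integral>\<^sup>+x. indicator A x \<partial>\<mu>)" by simp
    also have "\<dots> = (\<integral>\<^sup>+u. indicator {0<..<1} u *
      (\<integral>\<^sup>+z. \<integral>\<^sup>+y. indicator A (u * y + (1 - u) * z + qs_toll u) \<partial>\<mu> \<partial>\<mu>) \<partial>lborel)"
      by (intro nn_integral_mu_FPE) measurable
    also have "\<dots> = (\<integral>\<^sup>+u. indicator {0<..<1} u * (\<integral>\<^sup>+x. split_density u x * indicator A x \<partial>lborel) \<partial>lborel)"
      by (intro nn_integral_cong) (auto simp: inner split: split_indicator)
    also have "\<dots> = (\<integral>\<^sup>+u. \<integral>\<^sup>+x. indicator {0<..<1} u * (split_density u x * indicator A x) \<partial>lborel \<partial>lborel)"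
      by (intro nn_integral_cong nn_integral_cmult[symmetric]) measurable
    also have "\<dots> = (\<integral>\<^sup>+x. \<integral>\<^sup>+u. indicator {0<..<1} u * (split_density u x * indicator A x) \<partial>lborel \<partial>lborel)"
      by (intro lborel_pair.Fubini') measurable
    also have "\<dots> = (\<integral>\<^sup>+x. ?F x * indicator A x \<partial>lborel)"
      by (subst nn_integral_multc[symmetric]) (auto simp: mult.assoc)
    also have "\<dots> = emeasure (density lborel ?F) A"
      by (simp add: emeasure_density)
    finally show "emeasure \<mu> A = emeasure (density lborel ?F) A" .
  qed (simp add: sets_mu)
  then show ?thesis
    using sigma_finite_density_unique[of "\<lambda>x. ennreal (f x)" lborel ?F] sigma_finite_measure_axioms
    by (simp add: mu_density)
qed

lemma density_ge_on_open:
  assumes "open S" "continuous_on S c" "x \<in> S"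
    and "\<And>x. x \<in> S \<Longrightarrow> ennreal (c x) \<le> (\<integral>\<^sup>+u. indicator {0<..<1} u * split_density u x \<partial>lborel)"
  shows "c x \<le> f x"
proof (rule AE_le_imp_le_on_open[OF _ assms(1,2) continuous_f assms(3)])
  show "AE x in lborel. x \<in> S \<longrightarrow> c x \<le> f x"
    using AE_density_eq
  proof eventually_elim
    case (elim x)
    show ?case
    proof
      assume "x \<in> S"
      from assms(4)[OF this] have "ennreal (c x) \<le> ennreal (f x)" by (simp only: elim)
      then show "c x \<le> f x" by (simp add: f_nonneg)
    qed
  qed
qed

lemma density_le:
  assumes "continuous_on UNIV c" "\<And>x. 0 \<le> c x"
    and "\<And>x. (\<integral>\<^sup>+u. indicator {0<..<1} u * split_density u x \<partial>lborel) \<le> ennreal (c x)"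
  shows "f x \<le> c x"
proof (rule AE_le_imp_le_on_open[OF _ open_UNIV continuous_f assms(1) UNIV_I])
  show "AE x in lborel. x \<in> UNIV \<longrightarrow> f x \<le> c x"
    using AE_density_eq
  proof eventually_elim
    case (elim x)
    then have "ennreal (f x) \<le> ennreal (c x)" using assms(3) by simp
    then show ?case using assms(2) by simp
  qed
qed

text \<open>Restricts the double integral over u and z to a box, on which both factors are bounded
  below. The z-window may move with x, which lets the box follow the point. The weight 1/u is at
  least 1 and is dropped.\<close>

lemma density_ge_of_box:
  assumes D: "0 \<le> d1" "d1 \<le> d2" "d2 \<le> 1" and "0 \<le> l"
    and c: "0 \<le> c1" "0 \<le> c2" and "open S"
    and f1: "\<And>x z. x \<in> S \<Longrightarrow> k1 x < z \<Longrightarrow> z < k1 x + l \<Longrightarrow> c1 \<le> f z"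
    and f2: "\<And>x u z. x \<in> S \<Longrightarrow> d1 < u \<Longrightarrow> u < d2 \<Longrightarrow> k1 x < z \<Longrightarrow> z < k1 x + l \<Longrightarrow>
       c2 \<le> f ((x - qs_toll u - (1 - u) * z) / u)"
    and x: "x \<in> S"
  shows "(d2 - d1) * l * c1 * c2 \<le> f x"
proof (rule density_ge_on_open[OF \<open>open S\<close> _ x])
  fix x assume x: "x \<in> S"
  let ?K = "{k1 x<..<k1 x + l}" and ?D = "{d1<..<d2}"
  have sd: "ennreal (l * c1 * c2) \<le> split_density u x" if u: "u \<in> ?D" for u
  proof -
    have "ennreal (l * c1 * c2) = (\<integral>\<^sup>+z. ennreal (c1 * c2) * indicator ?K z \<partial>lborel)"
      using c \<open>0 \<le> l\<close> by (simp add: nn_integral_cmult ennreal_mult'[symmetric] mult_ac)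
    also have "\<dots> \<le> split_density u x"
      unfolding split_density_def
    proof (intro nn_integral_mono)
      fix z
      show "ennreal (c1 * c2) * indicator ?K z \<le>
          ennreal (f z) * ennreal (f ((x - qs_toll u - (1 - u) * z) / u) / u)"
      proof (cases "z \<in> ?K")
        case True
        have "c2 \<le> f ((x - qs_toll u - (1 - u) * z) / u)" using f2[OF x] u True by auto
        also have "\<dots> \<le> f ((x - qs_toll u - (1 - u) * z) / u) / u"
          using u D f_nonneg by (subst pos_le_divide_eq) (auto intro!: mult_left_le)
        finally have "c1 * c2 \<le> f z * (f ((x - qs_toll u - (1 - u) * z) / u) / u)"
          using f1[OF x] True c f_nonneg by (intro mult_mono) auto
        then show ?thesis using True u D f_nonneg by (simp add: ennreal_mult'[symmetric] ennreal_leI)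
      qed auto
    qed
    finally show ?thesis .
  qed
  have "ennreal ((d2 - d1) * l * c1 * c2) = (\<integral>\<^sup>+u. ennreal (l * c1 * c2) * indicator ?D u \<partial>lborel)"
    using c D \<open>0 \<le> l\<close>
    by (subst nn_integral_cmult_indicator) (auto simp: ennreal_mult'[symmetric] mult_ac)
  also have "\<dots> \<le> (\<integral>\<^sup>+u. indicator {0<..<1} u * split_density u x \<partial>lborel)"
    using D sd by (intro nn_integral_mono) (auto split: split_indicator)
  finally show "ennreal ((d2 - d1) * l * c1 * c2) \<le> (\<integral>\<^sup>+u. indicator {0<..<1} u * split_density u x \<partial>lborel)" .
qed auto

end

section \<open>Lower bounds\<close>

context quicksort_density
begin

text \<open>Take z within \<eta>/4 of x - g0. Then y - (x - g0) = ((1 - u)(x - g0 - z) + (g0 -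
  g(u)))/u is at most (\<eta>/8 + \<eta>/4)/(1/2) < \<eta> in absolute value, so y and z both lie in
  (a, b) and the bound \<open>c\<close> applies twice.\<close>

lemma density_ge_shift:
  assumes D: "1/2 \<le> d1" "d1 \<le> d2" "d2 \<le> 1" and "0 < \<eta>" "0 \<le> c"
    and g: "\<And>u. d1 < u \<Longrightarrow> u < d2 \<Longrightarrow> \<bar>qs_toll u - g0\<bar> \<le> \<eta> / 4"
    and f: "\<And>x. a < x \<Longrightarrow> x < b \<Longrightarrow> c \<le> f x"
    and x: "a + \<eta> + g0 < x" "x < b - \<eta> + g0"
  shows "(d2 - d1) * (\<eta> / 2) * c * c \<le> f x"
proof (rule density_ge_of_box[where S="{a + \<eta> + g0<..<b - \<eta> + g0}" and ?k1.0="\<lambda>x. x - g0 - \<eta> / 4"])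
  fix x z :: real
  assume x: "x \<in> {a + \<eta> + g0<..<b - \<eta> + g0}" and z: "x - g0 - \<eta>/4 < z" "z < x - g0 - \<eta>/4 + \<eta>/2"
  show "c \<le> f z" using x z \<open>0 < \<eta>\<close> by (intro f) auto
  fix u assume u: "d1 < u" "u < d2"
  then have u': "1/2 < u" "u < 1" using D by auto
  define y where "y = (x - qs_toll u - (1 - u) * z) / u"
  have "\<bar>(1 - u) * (x - g0 - z) + (g0 - qs_toll u)\<bar> \<le> \<bar>(1 - u) * (x - g0 - z)\<bar> + \<bar>g0 - qs_toll u\<bar>"
    by (rule abs_triangle_ineq)
  also have "\<bar>(1 - u) * (x - g0 - z)\<bar> \<le> (1/2) * (\<eta>/4)"
  proof -
    have "\<bar>x - g0 - z\<bar> \<le> \<eta>/4" using z by linarith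
    then show ?thesis unfolding abs_mult using u' by (intro mult_mono) auto
  qed
  also have "\<bar>g0 - qs_toll u\<bar> \<le> \<eta>/4" using g[OF u] by (simp add: abs_minus_commute)
  finally have 1: "\<bar>(1 - u) * (x - g0 - z) + (g0 - qs_toll u)\<bar> \<le> 3/8 * \<eta>" by simp
  have "y - (x - g0) = ((1 - u) * (x - g0 - z) + (g0 - qs_toll u)) / u"
    unfolding y_def using u' by (simp add: field_simps)
  then have "\<bar>y - (x - g0)\<bar> = \<bar>(1 - u) * (x - g0 - z) + (g0 - qs_toll u)\<bar> / u"
    using u' by (simp add: abs_divide)
  also have "\<dots> \<le> (3/8 * \<eta>) / (1/2)"
    using 1 u' \<open>0 < \<eta>\<close> by (intro frac_le) auto
  also have "\<dots> < \<eta>" using \<open>0 < \<eta>\<close> by simp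
  finally have "\<bar>y - (x - g0)\<bar> < \<eta>" .
  then show "c \<le> f ((x - qs_toll u - (1 - u) * z) / u)"
    unfolding y_def[symmetric] using x by (intro f) auto
qed (use assms in auto)

lemma density_pos_shift:
  assumes "0 < f x0" "1/2 \<le> u0" "u0 < 1"
  shows "0 < f (x0 + qs_toll u0)"
proof -
  have "isCont f x0" using continuous_f[of UNIV] by (simp add: continuous_on_eq_continuous_at)
  then obtain r where r: "0 < r" "\<And>x. \<bar>x - x0\<bar> < r \<Longrightarrow> \<bar>f x - f x0\<bar> < f x0 / 2"
    using assms(1) unfolding continuous_at_eps_delta dist_real_def by (metis half_gt_zero)
  have fr: "f x0 / 2 \<le> f x" if "x0 - r < x" "x < x0 + r" for x
  proof -
    have "\<bar>x - x0\<bar> < r" using that by linarith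
    from r(2)[OF this] show ?thesis by linarith
  qed
  have "isCont qs_toll u0" using assms by (intro isCont_qs_toll) auto
  then obtain d where d: "0 < d" "\<And>u. \<bar>u - u0\<bar> < d \<Longrightarrow> \<bar>qs_toll u - qs_toll u0\<bar> < r/2/4"
    using r(1) unfolding continuous_at_eps_delta dist_real_def by (metis half_gt_zero zero_less_divide_iff zero_less_numeral)
  define d' where "d' = min d (1 - u0)"
  have "0 < d'" using d assms by (simp add: d'_def)
  have "0 < (u0 + d' - u0) * (r/2 / 2) * (f x0 / 2) * (f x0 / 2)"
    using \<open>0 < d'\<close> r assms by simp
  also have "\<dots> \<le> f (x0 + qs_toll u0)"
    by (rule density_ge_shift[where a="x0 - r" and b="x0 + r" and ?g0.0="qs_toll u0"])
       (use assms d(1) \<open>0 < d'\<close> r(1) fr in \<open>auto simp: d'_def intro!: less_imp_le[OF d(2)[simplified]]\<close>)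
  finally show ?thesis .
qed

lemma qs_toll_15_16: "3/8 \<le> qs_toll (15/16)"
proof -
  have "1 - qs_toll (1 - 1/16) \<le> 2 * (1/16) - 2 * (1/16) * ln (1/16)"
    by (rule one_minus_qs_toll_bounds) auto
  moreover have "ln (1/16::real) = - (4 * ln 2)"
    using ln_realpow[of "2::real" 4] by (simp add: ln_div)
  ultimately show ?thesis using ln_2_less_1 by simp
qed

text \<open>On [1/2, 15/16] the toll function passes from 1 - 2 ln 2 <= -1/4 to at least 3/8, so by
  the intermediate value theorem it takes the value t, and positivity can move in either
  direction.\<close>

lemma density_pos_near:
  assumes "0 < f x0" "\<bar>t\<bar> \<le> 1/4"
  shows "0 < f (x0 + t)"
proof -
  have "qs_toll (1/2) \<le> - 1/4" using ln2_ge_two_thirds by (simp add: qs_toll_half)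
  then have "\<exists>u. 1/2 \<le> u \<and> u \<le> 15/16 \<and> qs_toll u = t"
    using assms(2) qs_toll_15_16
    by (intro IVT' continuous_on_subset[OF continuous_on_qs_toll]) auto
  then show ?thesis using density_pos_shift[OF assms(1)] by fastforce
qed

lemma density_pos: "0 < f x"
proof -
  have "\<exists>x0. 0 < f x0"
  proof (rule ccontr)
    assume "\<not> ?thesis"
    then have "f x = 0" for x using f_nonneg[of x] by (metis less_eq_real_def)
    then have "\<mu> = density lborel (\<lambda>x. 0)" using mu_density by simp
    then have "emeasure \<mu> UNIV = emeasure (density lborel (\<lambda>x. 0)) (UNIV :: real set)" by simp
    then have "emeasure \<mu> UNIV = 0" by (simp add: emeasure_density)
    moreover have "space \<mu> = UNIV" using sets_eq_imp_space_eq[OF sets_mu] by simp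
    ultimately show False using emeasure_space_1 by simp
  qed
  then obtain x0 where x0: "0 < f x0" ..
  \<comment> \<open>Cuts x - x0 into \<open>N\<close> equal steps of length at most 1/4; the summand
    1 keeps \<open>N\<close> positive when x = x0.\<close>
  define N where "N = nat \<lceil>4 * \<bar>x - x0\<bar>\<rceil> + 1"
  have N: "4 * \<bar>x - x0\<bar> \<le> real N" "0 < real N" unfolding N_def by linarith+
  define t where "t = (x - x0) / real N"
  have "\<bar>t\<bar> \<le> 1/4" using N by (simp add: t_def abs_divide field_simps)
  have "0 < f (x0 + real k * t)" for k
  proof (induction k)
    case (Suc k)
    from density_pos_near[OF this \<open>\<bar>t\<bar> \<le> 1/4\<close>] show ?case by (simp add: algebra_simps)
  qed (use x0 in simp)
  from this[of N] show ?thesis using N by (simp add: t_def)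
qed

lemma density_ge_on_compact_interval:
  obtains c where "0 < c" "c \<le> 1" "\<And>x. a \<le> x \<Longrightarrow> x \<le> b \<Longrightarrow> c \<le> f x"
proof (cases "a \<le> b")
  case True
  then obtain x0 where x0: "\<forall>x\<in>{a..b}. f x0 \<le> f x"
    using continuous_attains_inf[of "{a..b}" f] continuous_f by force
  show ?thesis using that[of "min 1 (f x0)"] density_pos[of x0] x0 by (simp add: min.coboundedI2)
next
  case False
  then show ?thesis using that[of 1] by auto
qed

text \<open>Shifting by the minimum \<open>1 - 2 ln 2\<close> of the toll function squares the lower bound; the
  loss \<open>(1/2)^n\<close> at the ends of the interval is summable.\<close>

lemma density_ge_left_iterate:
  assumes c: "0 < c" "\<And>x. -2 \<le> x \<Longrightarrow> x \<le> 2 \<Longrightarrow> c \<le> f x"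
    and x: "-1 - (1/2)^n + real n * (1 - 2 * ln 2) < x" "x < 1 + (1/2)^n + real n * (1 - 2 * ln 2)"
  shows "2^(2*n+9) * (c / 2^9)^(2^n) \<le> f x"
  using x
proof (induction n arbitrary: x)
  case 0
  then show ?case using c by (intro order_trans[OF _ c(2)]) auto
next
  case (Suc n)
  \<comment> \<open>The closed form solves C' = (\<eta>^2/32) C^2 with \<eta> = 2^-(n+1) and start
    value \<open>c\<close>; 2n + 9 is the linear exponent that this recursion reproduces.\<close>
  define C :: real where "C = 2^(2*n+9) * (c / 2^9)^(2^n)"
  define \<eta> :: real where "\<eta> = (1/2)^(Suc n)"
  have \<eta>: "0 < \<eta>" "\<eta> \<le> 1" "2 * \<eta> = (1/2)^n"
    using power_le_one[of "1/2::real" "Suc n"] by (auto simp: \<eta>_def)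
  \<comment> \<open>On (1/2, 1/2 + \<eta>/16) the Lipschitz constant 4 keeps the toll function
    within \<eta>/4 of its minimum.\<close>
  have "(1/2 + \<eta>/16 - 1/2) * (\<eta>/2) * C * C \<le> f x"
  proof (rule density_ge_shift)
    fix u :: real assume "1/2 < u" "u < 1/2 + \<eta>/16"
    then show "\<bar>qs_toll u - (1 - 2 * ln 2)\<bar> \<le> \<eta>/4"
      using qs_toll_half_lipschitz[of u] \<eta> unfolding qs_toll_half by auto
  next
    fix x
    assume "-1 - (1/2)^n + real n * (1 - 2 * ln 2) < x" "x < 1 + (1/2)^n + real n * (1 - 2 * ln 2)"
    then show "C \<le> f x" unfolding C_def by (rule Suc.IH)
  next
    show "-1 - (1/2)^n + real n * (1 - 2 * ln 2) + \<eta> + (1 - 2 * ln 2) < x"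
      "x < 1 + (1/2)^n + real n * (1 - 2 * ln 2) - \<eta> + (1 - 2 * ln 2)"
      using Suc.prems unfolding \<eta>(3)[symmetric] \<eta>_def[symmetric] by (auto simp: algebra_simps)
  qed (use \<eta> c in \<open>auto simp: C_def\<close>)
  also have "(1/2 + \<eta>/16 - 1/2) * (\<eta>/2) * C * C = 2^(2 * Suc n + 9) * (c / 2^9)^(2^Suc n)"
  proof -
    have "(1/2 + \<eta>/16 - 1/2) * (\<eta>/2) * C * C = \<eta>^2 / 32 * C^2"
      by (simp add: power2_eq_square)
    also have "C^2 = 2^(4*n+18) * (c / 2^9)^(2^Suc n)"
      by (simp add: C_def power_mult_distrib power_mult[symmetric] mult.commute add.commute)
    also have "\<eta>^2 / 32 * (2^(4*n+18) * (c / 2^9)^(2^Suc n)) = \<eta>^2 * 2^(4*n+13) * (c / 2^9)^(2^Suc n)"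
      by (simp add: power_add)
    also have "\<eta>^2 * 2^(4*n+13) = 2^(2 * Suc n + 9)"
    proof -
      have "(2^n)^4 = (16::real)^n"
        using power_mult[of "2::real" n 4] power_mult[of "2::real" 4 n] by (simp add: mult.commute)
      then show ?thesis
        by (simp add: \<eta>_def power_add power_mult power_divide power2_eq_square field_simps flip: power_mult_distrib)
    qed
    finally show ?thesis .
  qed
  finally show ?case .
qed

text \<open>With \<beta> = 2 ln 2 - 1 the point -x is reached after n = ceiling(x/\<beta>)
  squarings, and 2^(x/\<beta>) = exp(\<open>qs_gamma\<close> x) because \<open>qs_gamma\<close> = ln
  2/\<beta>. Rounding adds at most one squaring, hence the inner 2 in the constant ln (2 ln
  (1/q)).\<close>

lemma left_tail_lower_bound:
  obtains K where "\<And>x. 0 \<le> x \<Longrightarrow> exp (- exp (qs_gamma * x + K)) \<le> f (- x)"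
proof -
  obtain c where c: "0 < c" "c \<le> 1" "\<And>x. -2 \<le> x \<Longrightarrow> x \<le> 2 \<Longrightarrow> c \<le> f x"
    using density_ge_on_compact_interval by blast
  define q where "q = c / 2^9"
  have q: "0 < q" "q < 1" using c by (auto simp: q_def)
  define \<beta> :: real where "\<beta> = 2 * ln 2 - 1"
  have \<beta>: "0 < \<beta>" "\<beta> < 1" using ln2_ge_two_thirds ln_2_less_1 by (auto simp: \<beta>_def)
  show ?thesis
  proof (rule that)
    fix x :: real assume "0 \<le> x"
    define n where "n = nat \<lceil>x / \<beta>\<rceil>"
    have n: "x / \<beta> \<le> real n" "real n < x / \<beta> + 1"
      using \<open>0 \<le> x\<close> \<beta> divide_nonneg_pos[of x \<beta>] unfolding n_def by linarith+
    then have n': "x \<le> real n * \<beta>" "real n * \<beta> < x + \<beta>"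
      using \<beta> by (auto simp: field_simps)
    have "exp (- exp (qs_gamma * x + ln (2 * ln (1/q)))) \<le> exp (ln q * 2^n)"
    proof -
      have "2^n = (2::real) powr real n" by (simp add: powr_realpow)
      also have "\<dots> \<le> 2 powr (x / \<beta> + 1)" using n by (intro powr_mono) auto
      also have "\<dots> = 2 * exp (qs_gamma * x)"
        by (simp add: powr_add) (simp add: powr_def qs_gamma_eq \<beta>_def mult_ac)
      finally have "ln (1/q) * 2^n \<le> ln (1/q) * (2 * exp (qs_gamma * x))"
        using q by (intro mult_left_mono) auto
      also have "\<dots> = exp (qs_gamma * x + ln (2 * ln (1/q)))"
        using q by (simp add: exp_add ln_div)
      finally show ?thesis using q by (simp add: ln_div)
    qed
    also have "\<dots> = q^(2^n)"
      using q powr_realpow[of q "2^n"] by (simp add: powr_def mult.commute)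
    also have "\<dots> \<le> 2^(2*n+9) * q^(2^n)"
      using q by simp
    also have "\<dots> \<le> f (- x)"
      unfolding q_def
    proof (rule density_ge_left_iterate[OF c(1,3)])
      have "0 < (1/2::real)^n" by simp
      moreover have "real n * (1 - 2 * ln 2) = - (real n * \<beta>)" by (simp add: \<beta>_def algebra_simps)
      ultimately show "-1 - (1/2)^n + real n * (1 - 2 * ln 2) < - x"
        "- x < 1 + (1/2)^n + real n * (1 - 2 * ln 2)" using n' \<beta> by linarith+
    qed
    finally show "exp (- exp (qs_gamma * x + ln (2 * ln (1/q)))) \<le> f (- x)" .
  qed
qed

section \<open>Right-tail lower bound\<close>

text \<open>With v = 1 - u in (\<delta>/2, \<delta>) and z in (0, 1) one has y = x - 1 + e/(1 - v),
  where e consists of the deficit 1 - g(u), of -v z and of the drift v (x - 1). The upper bound on e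
  gives y < t, with a factor 2 for 1/(1 - v); e > -2v gives y > -2. The cost \<delta>/2 is the
  length of the u-range.\<close>

lemma density_ge_right_step:
  assumes \<delta>: "0 < \<delta>" "\<delta> \<le> 1/4" and "0 \<le> c0" "0 \<le> c"
    and f0: "\<And>z. 0 < z \<Longrightarrow> z < 1 \<Longrightarrow> c0 \<le> f z"
    and f: "\<And>y. -2 < y \<Longrightarrow> y < t \<Longrightarrow> c \<le> f y"
    and x: "0 < x" "x < X" "x < t + 1 - 2 * (2 * \<delta> + 2 * \<delta> * ln (2 / \<delta>) + \<delta> * X)"
  shows "\<delta> / 2 * c0 * c \<le> f x"
proof -
  let ?\<tau> = "2 * (2 * \<delta> + 2 * \<delta> * ln (2 / \<delta>) + \<delta> * X)"
  have "(1 - \<delta>/2 - (1 - \<delta>)) * 1 * c0 * c \<le> f x"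
  proof (rule density_ge_of_box[where S="{0<..<min X (t + 1 - ?\<tau>)}" and ?k1.0="\<lambda>_. 0"])
    fix x z u :: real
    assume x: "x \<in> {0<..<min X (t + 1 - ?\<tau>)}" and z: "0 < z" "z < 0 + 1"
      and u: "1 - \<delta> < u" "u < 1 - \<delta>/2"
    define v where "v = 1 - u"
    have v: "\<delta>/2 < v" "v < \<delta>" "0 < v" "v < 1" "u = 1 - v" using u \<delta> by (auto simp: v_def)
    define y where "y = (x - qs_toll u - (1 - u) * z) / u"
    define e where "e = (1 - qs_toll u) - v * z + v * (x - 1)"
    have y: "y - (x - 1) = e / (1 - v)"
      unfolding y_def e_def v(5)[symmetric] using v by (simp add: divide_simps) (simp add: v(5) algebra_simps)
    have "- ln v \<le> ln (2 / \<delta>)"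
    proof -
      have "ln (\<delta>/2) \<le> ln v" using v \<delta> by simp
      then show ?thesis using \<delta> by (simp add: ln_div)
    qed
    moreover have "0 \<le> ln (2 / \<delta>)" using \<delta> by simp
    ultimately have "v * - ln v \<le> \<delta> * ln (2 / \<delta>)"
      using v by (intro mult_mono') (auto intro: mult_left_mono)
    then have t1: "1 - qs_toll u \<le> 2 * \<delta> + 2 * \<delta> * ln (2 / \<delta>)"
      using one_minus_qs_toll_bounds(2)[of v] v by auto
    have t0: "0 \<le> 1 - qs_toll u" using one_minus_qs_toll_bounds(1)[of v] v by auto
    have "v * x \<le> \<delta> * X" using v x by (intro mult_mono) auto
    then have e1: "e < 2 * \<delta> + 2 * \<delta> * ln (2 / \<delta>) + \<delta> * X"
      using t1 v(3) mult_pos_pos[OF v(3) z(1)] unfolding e_def by (simp add: algebra_simps)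
    have vz: "v * z \<le> v" using v z by (simp add: mult_left_le)
    have e0: "- 2 * v < e"
    proof -
      have "0 < v * x" using v(3) x by (intro mult_pos_pos) auto
      then show ?thesis using t0 vz unfolding e_def by (simp add: right_diff_distrib)
    qed
    have "e / (1 - v) < ?\<tau>"
    proof (cases "0 \<le> e")
      case True
      have "e / (1 - v) \<le> e / (1/2)" using True v \<delta> by (intro divide_left_mono) auto
      also have "\<dots> < ?\<tau>" using e1 by simp
      finally show ?thesis .
    next
      case False
      then have "e / (1 - v) < 0" using v by (simp add: divide_neg_pos)
      also have "0 \<le> ?\<tau>" using \<delta> x \<open>0 \<le> ln (2/\<delta>)\<close> by (intro mult_nonneg_nonneg add_nonneg_nonneg) auto
      finally show ?thesis .
    qed
    then have "y < t" using y x by auto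
    have "- 1 \<le> e / (1 - v)"
      using e0 v \<delta> by (simp add: pos_le_divide_eq)
    then have "-2 < y" using y x by auto
    then show "c \<le> f ((x - qs_toll u - (1 - u) * z) / u)"
      using f \<open>y < t\<close> unfolding y_def by blast
  qed (use assms in auto)
  then show ?thesis by simp
qed

text \<open>\<open>X\<close> caps every point visited, so one \<open>\<delta>\<close> and one
  shortfall \<open>\<tau>\<close> serve all steps. For x <= 0 the initial bound already suffices,
  since the accumulated factors are at most 1.\<close>

lemma density_ge_right_iterate:
  assumes \<delta>: "0 < \<delta>" "\<delta> \<le> 1/4" and c0: "0 < c0" "c0 \<le> 1"
    and f0: "\<And>z. -2 < z \<Longrightarrow> z < 1 \<Longrightarrow> c0 \<le> f z"
    and \<tau>: "\<tau> = 2 * (2 * \<delta> + 2 * \<delta> * ln (2 / \<delta>) + \<delta> * X)" "\<tau> \<le> 1"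
    and x: "-2 < x" "x < X" "x < real n * (1 - \<tau>)"
  shows "c0 * (\<delta> / 2 * c0) ^ n \<le> f x"
  using x
proof (induction n arbitrary: x)
  case 0
  then show ?case using f0 by simp
next
  case (Suc n)
  have le1: "\<delta> / 2 * c0 \<le> 1" using mult_mono[of "\<delta>/2" 1 c0 1] \<delta> c0 by simp
  show ?case
  proof (cases "0 < x")
    case True
    have "\<delta> / 2 * c0 * (c0 * (\<delta> / 2 * c0) ^ n) \<le> f x"
    proof (rule density_ge_right_step[OF \<delta>, where X=X and t="min X (real n * (1 - \<tau>))"])
      show "c0 * (\<delta> / 2 * c0) ^ n \<le> f y" if "- 2 < y" "y < min X (real n * (1 - \<tau>))" for y
        using that by (intro Suc.IH) auto
      show "x < min X (real n * (1 - \<tau>)) + 1 - 2 * (2 * \<delta> + 2 * \<delta> * ln (2 / \<delta>) + \<delta> * X)"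
        unfolding \<tau>(1)[symmetric] using Suc.prems \<tau>(2) by (auto simp: min_def algebra_simps)
    qed (use Suc.prems True c0 \<delta> f0 in auto)
    then show ?thesis by (simp add: mult_ac)
  next
    case False
    have "c0 * (\<delta> / 2 * c0) ^ Suc n \<le> c0 * 1"
      using le1 c0 \<delta> by (intro mult_left_mono power_le_one) auto
    also have "\<dots> \<le> f x" using f0 False Suc.prems by simp
    finally show ?thesis .
  qed
qed

text \<open>With \<delta> = 1/(x ln x) the shortfall per step is O(1/ln x), so x + O(x/ln x) steps
  reach x. Each costs ln x + ln ln x + O(1) in the exponent, and the surplus O(x/ln x) steps cost
  O(x).\<close>

lemma right_tail_lower_bound:
  obtains h where "h \<in> O[at_top](\<lambda>x. x)"
    "\<forall>\<^sub>F x in at_top. exp (- x * ln x - x * ln (ln x) + h x) \<le> f x"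
proof -
  obtain c where c: "0 < c" "c \<le> 1" "\<And>x. -2 \<le> x \<Longrightarrow> x \<le> 1 \<Longrightarrow> c \<le> f x"
    using density_ge_on_compact_interval by blast
  define \<delta> \<tau> :: "real \<Rightarrow> real" where "\<delta> x = 1 / (x * ln x)"
    and "\<tau> x = 2 * (2 * \<delta> x + 2 * \<delta> x * ln (2 / \<delta> x) + \<delta> x * (2 * x))" for x
  \<comment> \<open>The exponent obtained with x + 10 x/ln x + 2 as bound on the number of steps,
    after adding back the two main terms.\<close>
  define h where "h x = x * ln x + x * ln (ln x) + ln c -
      (x + 10 * x / ln x + 2) * (ln x + ln (ln x) + ln (2 / c))" for x :: real
  have "h \<in> O[at_top](\<lambda>x. x)" unfolding h_def by real_asymp
  moreover have "\<forall>\<^sub>F x in at_top. exp (- x * ln x - x * ln (ln x) + h x) \<le> f x"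
  proof -
    \<comment> \<open>With X = 2x the summand 2 \<delta> X equals 4/ln x and the other two are of
      order at most 1/x.\<close>
    have "\<forall>\<^sub>F x in at_top. \<tau> x \<le> 5 / ln x" unfolding \<tau>_def \<delta>_def by real_asymp
    moreover have "\<forall>\<^sub>F x in at_top. 5 / ln x \<le> (1/2::real)" by real_asymp
    moreover have "\<forall>\<^sub>F x in at_top. 0 < \<tau> x" unfolding \<tau>_def \<delta>_def by real_asymp
    moreover have "\<forall>\<^sub>F x in at_top. \<delta> x \<le> 1/4" unfolding \<delta>_def by real_asymp
    moreover have "\<forall>\<^sub>F x in at_top. 0 < \<delta> x" unfolding \<delta>_def by real_asymp
    moreover have "\<forall>\<^sub>F x in at_top. 0 < x + 10 * x / ln x + (2::real)" by real_asymp
    moreover have "\<forall>\<^sub>F x in at_top. 1 < ln (x::real)" by real_asymp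
    moreover have "\<forall>\<^sub>F x in at_top. (1::real) < x" by (rule eventually_gt_at_top)
    ultimately show ?thesis
    proof eventually_elim
      case (elim x)
      define n where "n = nat \<lceil>x / (1 - \<tau> x)\<rceil> + 1"
      have "0 < x / (1 - \<tau> x)" using elim by (intro divide_pos_pos) linarith+
      then have n: "x / (1 - \<tau> x) < real n" "real n < x / (1 - \<tau> x) + 2"
        unfolding n_def by linarith+
      have "1 / (1 - \<tau> x) \<le> 1 + 2 * \<tau> x"
      proof -
        have "\<tau> x * (2 * \<tau> x) \<le> \<tau> x * 1" using elim by (intro mult_left_mono) linarith+
        then have "1 \<le> (1 + 2 * \<tau> x) * (1 - \<tau> x)" by (simp add: algebra_simps)
        moreover have "0 < 1 - \<tau> x" using elim by linarith
        ultimately show ?thesis by (simp add: pos_divide_le_eq)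
      qed
      also have "\<dots> \<le> 1 + 2 * (5 / ln x)" using elim by simp
      finally have "x * (1 / (1 - \<tau> x)) \<le> x * (1 + 2 * (5 / ln x))"
        using elim by (intro mult_left_mono) auto
      then have n2: "real n \<le> x + 10 * x / ln x + 2" using n(2) by (simp add: algebra_simps)
      have "0 < 1 - \<tau> x" using elim by linarith
      then have n1: "x < real n * (1 - \<tau> x)" using n(1) by (simp add: pos_divide_less_eq)
      have "\<tau> x \<le> 1" using elim by linarith
      have "c * (\<delta> x / 2 * c) ^ n \<le> f x"
        by (rule density_ge_right_iterate[where \<tau>="\<tau> x" and X="2 * x"])
          (use elim n1 c \<open>\<tau> x \<le> 1\<close> in \<open>auto simp: \<tau>_def[symmetric] simp del: mult_2\<close>, simp add: \<tau>_def)
      moreover have "exp (- x * ln x - x * ln (ln x) + h x) \<le> c * (\<delta> x / 2 * c) ^ n"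
      proof -
        have l: "ln (\<delta> x / 2 * c) = - (ln x + ln (ln x) + ln (2 / c))"
          using elim c by (simp add: \<delta>_def ln_div ln_mult)
        have "0 \<le> ln x + ln (ln x) + ln (2 / c)" using elim c by auto
        then have "real n * (ln x + ln (ln x) + ln (2 / c)) \<le>
            (x + 10 * x / ln x + 2) * (ln x + ln (ln x) + ln (2 / c))"
          using n2 by (rule mult_right_mono[rotated])
        then have "- x * ln x - x * ln (ln x) + h x \<le> ln c + real n * ln (\<delta> x / 2 * c)"
          unfolding l h_def by (simp only: mult_minus_right)
        then have "exp (- x * ln x - x * ln (ln x) + h x) \<le> exp (ln c + real n * ln (\<delta> x / 2 * c))"
          by simp
        also have "\<dots> = c * (\<delta> x / 2 * c) ^ n"
          using c elim by (simp add: exp_add exp_of_nat_mult)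
        finally show ?thesis .
      qed
      ultimately show ?case by linarith
    qed
  qed
  ultimately show ?thesis by (rule that)
qed

end

section \<open>Moment generating functions of the iterates\<close>

text \<open>Says E g(U) = 0, which later removes the linear term in \<theta>. The antiderivative is
  continuous up to the end points because u^2 ln u tends to 0, so differentiability in the interior
  is enough.\<close>

lemma has_integral_qs_toll: "(qs_toll has_integral 0) {0<..<1}"
proof -
  define G where "G u = u\<^sup>2 * ln u - u\<^sup>2 / 2 - ((1 - u)\<^sup>2 * ln (1 - u) - (1 - u)\<^sup>2 / 2) + u" for u :: real
  have xlnx: "continuous_on {0..1} (\<lambda>x::real. x\<^sup>2 * ln x)"
    unfolding continuous_on_eq_continuous_within
  proof
    fix x :: real
    assume x: "x \<in> {0..1}"
    show "continuous (at x within {0..1}) (\<lambda>x. x\<^sup>2 * ln x)"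
    proof (cases "x = 0")
      case True
      have "((\<lambda>x::real. x\<^sup>2 * ln x) \<longlongrightarrow> 0) (at_right 0)" by real_asymp
      then show ?thesis using True by (simp add: continuous_within at_within_Icc_at_right)
    next
      case False
      then have "isCont (\<lambda>x. x\<^sup>2 * ln x) x" by (intro continuous_intros) auto
      then show ?thesis by (rule continuous_at_imp_continuous_at_within)
    qed
  qed
  have "continuous_on {0..1} ((\<lambda>x::real. x\<^sup>2 * ln x) \<circ> (\<lambda>u. 1 - u))"
    by (intro continuous_on_compose continuous_intros continuous_on_subset[OF xlnx]) auto
  then have "continuous_on {0..1} G" unfolding G_def comp_def
    by (intro continuous_on_add continuous_on_diff xlnx) (auto intro!: continuous_intros)
  moreover have "(G has_vector_derivative qs_toll u) (at u)" if "u \<in> {0<..<1}" for u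
  proof -
    have "(G has_real_derivative (2 * u * ln u + u\<^sup>2 * (1 / u) - u
       + 2 * (1 - u) * ln (1 - u) + (1 - u)\<^sup>2 * (1 / (1 - u)) - (1 - u)) + 1) (at u)"
      unfolding G_def using that
      by (auto intro!: derivative_eq_intros simp: divide_simps) (simp_all add: algebra_simps power2_eq_square)
    moreover have "u\<^sup>2 * (1 / u) = u" "(1 - u)\<^sup>2 * (1 / (1 - u)) = 1 - u"
      using that by (simp_all add: power2_eq_square)
    ultimately show ?thesis
      by (simp add: qs_toll_def has_real_derivative_iff_has_vector_derivative add.assoc)
  qed
  ultimately have "(qs_toll has_integral (G 1 - G 0)) {0..1}"
    by (intro fundamental_theorem_of_calculus_interior) auto
  then show ?thesis by (simp add: G_def has_integral_Icc_iff_Ioo)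
qed

lemma exp_le_quadratic:
  fixes x :: real
  assumes "x \<le> 1"
  shows "exp x \<le> 1 + x + x\<^sup>2"
proof (cases "0 \<le> x")
  case False
  have "(1 + x + x\<^sup>2) * (1 - x) = 1 - x^3" by (simp add: power2_eq_square power3_eq_cube algebra_simps)
  moreover have "x^3 < 0" using False by simp
  ultimately have "1 \<le> (1 + x + x\<^sup>2) * (1 - x)" by simp
  also have "\<dots> \<le> (1 + x + x\<^sup>2) * exp (- x)"
    using exp_ge_add_one_self[of "-x"] zero_le_power2[of "x + 1/2"]
    by (intro mult_left_mono) (auto simp: power2_eq_square algebra_simps)
  finally show ?thesis by (simp add: exp_minus field_simps)
qed (use assms exp_bound in auto)

text \<open>For small \<theta> the second order decides: the term \<theta> g(u) integrates to 0, the
  square adds at most \<theta>^2, and the product removes at least 12 \<theta>^2 u (1 - u), whose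
  integral is 2 \<theta>^2. What remains is 1 - \<theta>^2.\<close>

lemma mgf_supersolution_small:
  fixes \<theta> :: real
  assumes "\<bar>\<theta>\<bar> \<le> 2/5"
  shows "(\<integral>\<^sup>+u. indicator {0<..<1} u * ennreal (exp (\<theta> * qs_toll u
    - 100 * ((exp (u * \<bar>\<theta>\<bar>) - 1) * (exp ((1 - u) * \<bar>\<theta>\<bar>) - 1)))) \<partial>lborel) \<le> 1"
proof -
  define R where "R u = 1 + \<theta> * qs_toll u + \<theta>\<^sup>2 - 12 * \<theta>\<^sup>2 * (u * (1 - u))" for u
  have le: "exp (\<theta> * qs_toll u - 100 * ((exp (u * \<bar>\<theta>\<bar>) - 1) * (exp ((1 - u) * \<bar>\<theta>\<bar>) - 1))) \<le> R u"
    if u: "0 < u" "u < 1" for u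
  proof -
    have g: "\<bar>\<theta> * qs_toll u\<bar> \<le> \<bar>\<theta>\<bar>"
      unfolding abs_mult using abs_qs_toll_le_one[OF u] by (simp add: mult_left_le)
    \<comment> \<open>A lower bound for the subtracted product. For |\<theta>| <= 2/5 it is at most
      4, the range in which exp (-y) <= 1 - y/5 is used; with exp (\<theta> g) >= 3/5 the factor 100
      becomes 100 * 3/25 = 12.\<close>
    define y where "y = 100 * (\<theta>\<^sup>2 * (u * (1 - u)))"
    have q: "0 \<le> u * (1 - u)" "u * (1 - u) \<le> 1/4"
      using u sum_power2_ge_zero[of "u - 1/2" 0] by (auto simp: power2_eq_square algebra_simps)
    have l2: "\<theta>\<^sup>2 \<le> (2/5)\<^sup>2" using power_mono[OF assms, of 2] by simp
    have y: "0 \<le> y" "y \<le> 4"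
      using q l2 mult_mono[OF l2 q(2)] by (auto simp: y_def power2_eq_square)
    have "(u * \<bar>\<theta>\<bar>) * ((1 - u) * \<bar>\<theta>\<bar>) \<le> (exp (u * \<bar>\<theta>\<bar>) - 1) * (exp ((1 - u) * \<bar>\<theta>\<bar>) - 1)"
    proof (intro mult_mono)
      show "u * \<bar>\<theta>\<bar> \<le> exp (u * \<bar>\<theta>\<bar>) - 1" "(1 - u) * \<bar>\<theta>\<bar> \<le> exp ((1 - u) * \<bar>\<theta>\<bar>) - 1"
        using exp_ge_add_one_self[of "u * \<bar>\<theta>\<bar>"] exp_ge_add_one_self[of "(1 - u) * \<bar>\<theta>\<bar>"] by linarith+
    qed (use u in auto)
    then have "exp (\<theta> * qs_toll u - 100 * ((exp (u * \<bar>\<theta>\<bar>) - 1) * (exp ((1 - u) * \<bar>\<theta>\<bar>) - 1))) \<le>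
        exp (\<theta> * qs_toll u) * exp (- y)"
      by (simp add: exp_add[symmetric] y_def power2_eq_square algebra_simps abs_mult[symmetric])
    also have "\<dots> \<le> exp (\<theta> * qs_toll u) * (1 - y / 5)"
    proof (intro mult_left_mono)
      have "y * y \<le> 4 * y" using y by (intro mult_right_mono) auto
      then have "1 \<le> (1 - y / 5) * (1 + y)" by (simp add: algebra_simps)
      also have "\<dots> \<le> (1 - y / 5) * exp y"
        using y exp_ge_add_one_self[of y] by (intro mult_left_mono) auto
      finally show "exp (- y) \<le> 1 - y / 5" by (simp add: exp_minus field_simps)
    qed auto
    also have "\<dots> = exp (\<theta> * qs_toll u) - (y / 5) * exp (\<theta> * qs_toll u)" by (simp add: algebra_simps)
    also have "\<dots> \<le> (1 + \<theta> * qs_toll u + (\<theta> * qs_toll u)\<^sup>2) - (y / 5) * (3 / 5)"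
    proof (intro diff_mono mult_left_mono)
      show "exp (\<theta> * qs_toll u) \<le> 1 + \<theta> * qs_toll u + (\<theta> * qs_toll u)\<^sup>2"
        using g assms by (intro exp_le_quadratic) auto
      show "3 / 5 \<le> exp (\<theta> * qs_toll u)"
        using g assms exp_ge_add_one_self[of "\<theta> * qs_toll u"] by linarith
    qed (use y in auto)
    also have "\<dots> \<le> R u"
    proof -
      have "(\<theta> * qs_toll u)\<^sup>2 \<le> \<theta>\<^sup>2"
        using g by (simp add: abs_le_square_iff)
      then show ?thesis by (simp add: R_def y_def)
    qed
    finally show ?thesis .
  qed
  have R0: "0 \<le> R u" if "u \<in> {0<..<1}" for u
    using that by (intro less_imp_le[OF order_less_le_trans[OF exp_gt_zero le]]) auto
  have "(R has_integral (1 - \<theta>\<^sup>2)) {0<..<1}"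
  proof -
    define Q where "Q u = u + \<theta>\<^sup>2 * u - 12 * \<theta>\<^sup>2 * (u\<^sup>2 / 2 - u^3 / 3)" for u
    have "((\<lambda>u. 1 + \<theta>\<^sup>2 - 12 * \<theta>\<^sup>2 * (u * (1 - u))) has_integral (Q 1 - Q 0)) {0..1}"
      unfolding Q_def
      by (intro fundamental_theorem_of_calculus)
        (auto simp: has_real_derivative_iff_has_vector_derivative[symmetric] power2_eq_square power3_eq_cube field_simps
          intro!: derivative_eq_intros)
    then have "((\<lambda>u. 1 + \<theta>\<^sup>2 - 12 * \<theta>\<^sup>2 * (u * (1 - u))) has_integral (1 - \<theta>\<^sup>2)) {0<..<1}"
      by (simp add: has_integral_Icc_iff_Ioo Q_def field_simps)
    from has_integral_add[OF this has_integral_mult_right[OF has_integral_qs_toll, of \<theta>]]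
    show ?thesis by (simp add: R_def[abs_def] algebra_simps)
  qed
  then have R: "(\<integral>\<^sup>+u. indicator {0<..<1} u * ennreal (R u) \<partial>lborel) = ennreal (1 - \<theta>\<^sup>2)"
    using nn_integral_has_integral_lebesgue'[of "{0<..<1}" R "1 - \<theta>\<^sup>2"] R0
    by (simp add: mult.commute)
  have "(\<integral>\<^sup>+u. indicator {0<..<1} u * ennreal (exp (\<theta> * qs_toll u
    - 100 * ((exp (u * \<bar>\<theta>\<bar>) - 1) * (exp ((1 - u) * \<bar>\<theta>\<bar>) - 1)))) \<partial>lborel) \<le>
    (\<integral>\<^sup>+u. indicator {0<..<1} u * ennreal (R u) \<partial>lborel)"
    by (intro nn_integral_mono) (auto split: split_indicator intro!: ennreal_leI le)
  also have "\<dots> \<le> 1" unfolding R using ennreal_leI[of "1 - \<theta>\<^sup>2" 1] by simp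
  finally show ?thesis .
qed

lemma nn_integral_exp_decay_le:
  assumes "0 < a"
  shows "(\<integral>\<^sup>+u. indicator {0<..<1} u * ennreal (exp (- a * u)) \<partial>lborel) \<le> ennreal (1 / a)"
    and "(\<integral>\<^sup>+u. indicator {0<..<1} u * ennreal (exp (- a * (1 - u))) \<partial>lborel) \<le> ennreal (1 / a)"
proof -
  have "(\<integral>\<^sup>+u. ennreal (exp (- a * u)) * indicator {0..1} u \<partial>lborel) = ennreal (- exp (- a * 1) / a - (- exp (- a * 0) / a))"
    using assms by (intro nn_integral_FTC_Icc) (auto intro!: derivative_eq_intros)
  also have "\<dots> \<le> ennreal (1 / a)" using assms by (intro ennreal_leI) (simp add: field_simps)
  finally show "(\<integral>\<^sup>+u. indicator {0<..<1} u * ennreal (exp (- a * u)) \<partial>lborel) \<le> ennreal (1 / a)"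
    by (rule order_trans[rotated]) (auto intro!: nn_integral_mono split: split_indicator)
  have "(\<integral>\<^sup>+u. ennreal (exp (- a * (1 - u))) * indicator {0..1} u \<partial>lborel) = ennreal (exp (- a * (1 - 1)) / a - exp (- a * (1 - 0)) / a)"
    using assms by (intro nn_integral_FTC_Icc) (auto intro!: derivative_eq_intros)
  also have "\<dots> \<le> ennreal (1 / a)" using assms by (intro ennreal_leI) (simp add: field_simps)
  finally show "(\<integral>\<^sup>+u. indicator {0<..<1} u * ennreal (exp (- a * (1 - u))) \<partial>lborel) \<le> ennreal (1 / a)"
    by (rule order_trans[rotated]) (auto intro!: nn_integral_mono split: split_indicator)
qed

text \<open>The product is a concave function of \<open>u\<close> that vanishes at the end points.\<close>

lemma exp_split_product_ge:
  fixes s u :: real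
  assumes "0 \<le> u" "u \<le> 1/2"
  shows "2 * u * (exp (s/2) - 1)\<^sup>2 \<le> (exp (u * s) - 1) * (exp ((1 - u) * s) - 1)"
proof -
  have conv: "convex_on UNIV (exp :: real \<Rightarrow> real)" by (rule convex_on_exp[of 1, simplified])
  have "exp ((1 - 2 * u) *\<^sub>R 0 + (2 * u) *\<^sub>R (s/2)) \<le> (1 - 2 * u) * exp 0 + 2 * u * exp (s/2)"
    using assms by (intro convex_onD[OF conv]) auto
  then have 1: "exp (u * s) \<le> (1 - 2 * u) + 2 * u * exp (s/2)" by simp
  have "exp ((1 - 2 * u) *\<^sub>R s + (2 * u) *\<^sub>R (s/2)) \<le> (1 - 2 * u) * exp s + 2 * u * exp (s/2)"
    using assms by (intro convex_onD[OF conv]) auto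
  also have "(1 - 2 * u) *\<^sub>R s + (2 * u) *\<^sub>R (s/2) = (1 - u) * s" by (simp add: algebra_simps)
  finally have 2: "exp ((1 - u) * s) \<le> (1 - 2 * u) * exp s + 2 * u * exp (s/2)" .
  have 3: "exp (u * s) * exp ((1 - u) * s) = exp s" by (simp add: exp_add[symmetric] algebra_simps)
  have 4: "exp (s/2) * exp (s/2) = exp s" by (simp add: exp_add[symmetric])
  have "(exp (u * s) - 1) * (exp ((1 - u) * s) - 1) = exp s + 1 - exp (u * s) - exp ((1 - u) * s)"
    using 3 by (simp add: algebra_simps)
  moreover have "2 * u * (exp (s/2) - 1)\<^sup>2 = 2 * u * (exp s + 1) - 4 * u * exp (s/2)"
    using 4 by (simp add: power2_eq_square algebra_simps)
  ultimately show ?thesis using 1 2 by (simp add: algebra_simps)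
qed

text \<open>Here |g| <= 1 is enough. The product grows at least linearly from each end point, so the
  integrand is at most exp s (exp (-a u) + exp (-a (1 - u))), with integral at most 2 exp s / a.
  From s >= 2/5 follows exp (s/2) <= 10 (exp (s/2) - 1), hence a >= 2 exp s.\<close>

lemma mgf_supersolution_large:
  fixes \<theta> :: real
  assumes "2/5 \<le> \<bar>\<theta>\<bar>"
  shows "(\<integral>\<^sup>+u. indicator {0<..<1} u * ennreal (exp (\<theta> * qs_toll u
    - 100 * ((exp (u * \<bar>\<theta>\<bar>) - 1) * (exp ((1 - u) * \<bar>\<theta>\<bar>) - 1)))) \<partial>lborel) \<le> 1"
proof -
  define s where "s = \<bar>\<theta>\<bar>"
  define a where "a = 200 * (exp (s/2) - 1)\<^sup>2"
  have "6/5 \<le> exp (s/2)" using exp_ge_add_one_self[of "s/2"] assms unfolding s_def by linarith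
  then have "exp (s/2) \<le> 10 * (exp (s/2) - 1)" by simp
  then have "(exp (s/2))\<^sup>2 \<le> (10 * (exp (s/2) - 1))\<^sup>2" by (intro power_mono) auto
  also have "(exp (s/2))\<^sup>2 = exp s" by (simp add: exp_double[symmetric])
  finally have a: "2 * exp s \<le> a" unfolding a_def power_mult_distrib by simp
  then have "0 < a" using exp_gt_zero[of s] by linarith
  have lin: "x - 100 * Q \<le> s + - (200 * P) * v" if "2 * v * P \<le> Q" "x \<le> s" for x P Q v
    using that by (simp add: algebra_simps)
  have le: "exp (\<theta> * qs_toll u - 100 * ((exp (u * s) - 1) * (exp ((1 - u) * s) - 1))) \<le>
      exp s * (exp (- a * u) + exp (- a * (1 - u)))" if u: "0 < u" "u < 1" for u
  proof -
    have g: "\<bar>\<theta> * qs_toll u\<bar> \<le> s"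
      unfolding abs_mult s_def using abs_qs_toll_le_one[OF u] by (simp add: mult_left_le)
    show ?thesis
    proof (cases "u \<le> 1/2")
      case True
      have "\<theta> * qs_toll u - 100 * ((exp (u * s) - 1) * (exp ((1 - u) * s) - 1)) \<le> s + - a * u"
        unfolding a_def using exp_split_product_ge[of u s] True u abs_le_D1[OF g] by (intro lin) auto
      then have "exp (\<theta> * qs_toll u - 100 * ((exp (u * s) - 1) * (exp ((1 - u) * s) - 1))) \<le> exp (s + - a * u)"
        by (simp only: exp_le_cancel_iff)
      also have "\<dots> \<le> exp s * (exp (- a * u) + exp (- a * (1 - u)))"
        unfolding exp_add by (intro mult_left_mono) auto
      finally show ?thesis .
    next
      case False
      have "\<theta> * qs_toll u - 100 * ((exp (u * s) - 1) * (exp ((1 - u) * s) - 1)) \<le> s + - a * (1 - u)"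
        unfolding a_def using exp_split_product_ge[of "1 - u" s] False u abs_le_D1[OF g]
        by (intro lin) (auto simp: mult.commute[of "exp (u * s) - 1"])
      then have "exp (\<theta> * qs_toll u - 100 * ((exp (u * s) - 1) * (exp ((1 - u) * s) - 1))) \<le> exp (s + - a * (1 - u))"
        by (simp only: exp_le_cancel_iff)
      also have "\<dots> \<le> exp s * (exp (- a * u) + exp (- a * (1 - u)))"
        unfolding exp_add by (intro mult_left_mono) auto
      finally show ?thesis .
    qed
  qed
  have "(\<integral>\<^sup>+u. indicator {0<..<1} u * ennreal (exp (\<theta> * qs_toll u
    - 100 * ((exp (u * s) - 1) * (exp ((1 - u) * s) - 1)))) \<partial>lborel) \<le>
    (\<integral>\<^sup>+u. ennreal (exp s) * (indicator {0<..<1} u * ennreal (exp (- a * u)) +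
      indicator {0<..<1} u * ennreal (exp (- a * (1 - u)))) \<partial>lborel)"
    by (intro nn_integral_mono)
      (auto split: split_indicator simp: ennreal_mult'[symmetric] ennreal_plus[symmetric] simp del: ennreal_plus intro!: ennreal_leI le[simplified])
  also have "\<dots> = ennreal (exp s) * ((\<integral>\<^sup>+u. indicator {0<..<1} u * ennreal (exp (- a * u)) \<partial>lborel) +
     (\<integral>\<^sup>+u. indicator {0<..<1} u * ennreal (exp (- a * (1 - u))) \<partial>lborel))"
    by (subst nn_integral_cmult) (auto intro!: arg_cong2[where f="(*)"] nn_integral_add)
  also have "\<dots> \<le> ennreal (exp s) * (ennreal (1 / a) + ennreal (1 / a))"
    using nn_integral_exp_decay_le[OF \<open>0 < a\<close>] by (intro mult_left_mono add_mono) auto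
  also have "\<dots> = ennreal (2 * exp s / a)"
    using \<open>0 < a\<close> by (simp add: ennreal_mult'[symmetric] ennreal_plus[symmetric] del: ennreal_plus)
  also have "\<dots> \<le> 1" using a \<open>0 < a\<close> by (simp add: ennreal_le_1)
  finally show ?thesis unfolding s_def .
qed

text \<open>The exponent is chosen so that \<open>K(u s) + K((1 - u) s) - K(s)\<close>, with \<open>K\<close> the exponent, equals
  \<open>- 100 (exp (u s) - 1) (exp ((1 - u) s) - 1)\<close> for \<open>s \<ge> 0\<close>.\<close>

definition mgf_exponent :: "real \<Rightarrow> real" where
  "mgf_exponent s = 100 * (exp \<bar>s\<bar> - 1 - \<bar>s\<bar>)"

lemma mgf_supersolution:
  "(\<integral>\<^sup>+u. indicator {0<..<1} u * ennreal (exp (mgf_exponent (u * \<theta>) + mgf_exponent ((1 - u) * \<theta>)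
      - mgf_exponent \<theta> + \<theta> * qs_toll u)) \<partial>lborel) \<le> 1"
proof -
  have eq: "mgf_exponent (u * \<theta>) + mgf_exponent ((1 - u) * \<theta>) - mgf_exponent \<theta> =
      - 100 * ((exp (u * \<bar>\<theta>\<bar>) - 1) * (exp ((1 - u) * \<bar>\<theta>\<bar>) - 1))" if "0 < u" "u < 1" for u
  proof -
    have "exp (u * \<bar>\<theta>\<bar>) * exp ((1 - u) * \<bar>\<theta>\<bar>) = exp \<bar>\<theta>\<bar>" by (simp add: exp_add[symmetric] algebra_simps)
    moreover have "\<bar>u * \<theta>\<bar> = u * \<bar>\<theta>\<bar>" "\<bar>(1 - u) * \<theta>\<bar> = (1 - u) * \<bar>\<theta>\<bar>"
      using that by (auto simp: abs_mult)
    ultimately show ?thesis unfolding mgf_exponent_def by (simp only:) (simp add: algebra_simps)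
  qed
  have "(\<integral>\<^sup>+u. indicator {0<..<1} u * ennreal (exp (mgf_exponent (u * \<theta>) + mgf_exponent ((1 - u) * \<theta>)
      - mgf_exponent \<theta> + \<theta> * qs_toll u)) \<partial>lborel) =
    (\<integral>\<^sup>+u. indicator {0<..<1} u * ennreal (exp (\<theta> * qs_toll u
    - 100 * ((exp (u * \<bar>\<theta>\<bar>) - 1) * (exp ((1 - u) * \<bar>\<theta>\<bar>) - 1)))) \<partial>lborel)"
    by (intro nn_integral_cong) (auto split: split_indicator simp: eq)
  then show ?thesis
    using mgf_supersolution_small[of \<theta>] mgf_supersolution_large[of \<theta>] by (cases "\<bar>\<theta>\<bar> \<le> 2/5") auto
qed

section \<open>Moment generating functions under the fixed-point map\<close>

text \<open>Valued in \<open>ennreal\<close>, so that it makes sense before any exponential moment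
  is known to be finite.\<close>

definition mgf :: "real measure \<Rightarrow> real \<Rightarrow> ennreal" where
  "mgf \<nu> \<theta> = (\<integral>\<^sup>+x. ennreal (exp (\<theta> * x)) \<partial>\<nu>)"

lemma mgf_qs_map:
  assumes "prob_space \<nu>" and [measurable_cong]: "sets \<nu> = sets borel"
  shows "mgf (qs_map \<nu>) \<theta> = (\<integral>\<^sup>+u. indicator {0<..<1} u *
    (mgf \<nu> (u * \<theta>) * mgf \<nu> ((1 - u) * \<theta>) * ennreal (exp (\<theta> * qs_toll u))) \<partial>lborel)"
proof -
  have "(\<integral>\<^sup>+y. \<integral>\<^sup>+z. ennreal (exp (\<theta> * (u * y + (1 - u) * z + qs_toll u))) \<partial>\<nu> \<partial>\<nu>) =
    mgf \<nu> (u * \<theta>) * mgf \<nu> ((1 - u) * \<theta>) * ennreal (exp (\<theta> * qs_toll u))" for u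
  proof -
    have "(\<integral>\<^sup>+y. \<integral>\<^sup>+z. ennreal (exp (\<theta> * (u * y + (1 - u) * z + qs_toll u))) \<partial>\<nu> \<partial>\<nu>) =
      (\<integral>\<^sup>+y. \<integral>\<^sup>+z. ennreal (exp (u * \<theta> * y)) * (ennreal (exp (\<theta> * qs_toll u)) * ennreal (exp ((1 - u) * \<theta> * z))) \<partial>\<nu> \<partial>\<nu>)"
      by (intro nn_integral_cong) (simp add: ennreal_mult'[symmetric] exp_add[symmetric] algebra_simps)
    also have "\<dots> = (\<integral>\<^sup>+y. ennreal (exp (u * \<theta> * y)) * (ennreal (exp (\<theta> * qs_toll u)) * mgf \<nu> ((1 - u) * \<theta>)) \<partial>\<nu>)"
      by (simp add: nn_integral_cmult mgf_def)
    also have "\<dots> = mgf \<nu> (u * \<theta>) * (ennreal (exp (\<theta> * qs_toll u)) * mgf \<nu> ((1 - u) * \<theta>))"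
      by (simp add: nn_integral_multc mgf_def)
    finally show ?thesis by (simp add: mult_ac)
  qed
  then show ?thesis
    unfolding mgf_def[of "qs_map \<nu>"] by (subst nn_integral_qs_map[OF assms]) auto
qed

text \<open>Comparison principle: by independence the transform of the image is an integral of
  products at u \<theta> and (1 - u) \<theta>, so a supersolution \<open>k\<close> that bounds the
  input also bounds the output. The input bound is required only strictly between 0 and \<theta>,
  which allows a \<open>k\<close> adapted to one half-line.\<close>

lemma mgf_qs_map_le:
  assumes "prob_space \<nu>" "sets \<nu> = sets borel"
    and "\<And>u. 0 < u \<Longrightarrow> u < 1 \<Longrightarrow> mgf \<nu> (u * \<theta>) \<le> ennreal (exp (k (u * \<theta>)))"
    and "(\<integral>\<^sup>+u. indicator {0<..<1} u * ennreal (exp (k (u * \<theta>) + k ((1 - u) * \<theta>) - k \<theta> + \<theta> * qs_toll u)) \<partial>lborel) \<le> 1"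
    and [measurable]: "k \<in> borel_measurable borel"
  shows "mgf (qs_map \<nu>) \<theta> \<le> ennreal (exp (k \<theta>))"
proof -
  have "mgf (qs_map \<nu>) \<theta> \<le> (\<integral>\<^sup>+u. ennreal (exp (k \<theta>)) *
    (indicator {0<..<1} u * ennreal (exp (k (u * \<theta>) + k ((1 - u) * \<theta>) - k \<theta> + \<theta> * qs_toll u))) \<partial>lborel)"
    unfolding mgf_qs_map[OF assms(1,2)]
  proof (intro nn_integral_mono)
    fix u :: real
    have "mgf \<nu> (u * \<theta>) * mgf \<nu> ((1 - u) * \<theta>) * ennreal (exp (\<theta> * qs_toll u)) \<le>
      ennreal (exp (k \<theta>)) * ennreal (exp (k (u * \<theta>) + k ((1 - u) * \<theta>) - k \<theta> + \<theta> * qs_toll u))"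
      if "0 < u" "u < 1"
    proof -
      have "mgf \<nu> (u * \<theta>) * mgf \<nu> ((1 - u) * \<theta>) * ennreal (exp (\<theta> * qs_toll u)) \<le>
        ennreal (exp (k (u * \<theta>))) * ennreal (exp (k ((1 - u) * \<theta>))) * ennreal (exp (\<theta> * qs_toll u))"
        using assms(3)[of u] assms(3)[of "1 - u"] that by (intro mult_mono) auto
      also have "\<dots> = ennreal (exp (k \<theta>)) * ennreal (exp (k (u * \<theta>) + k ((1 - u) * \<theta>) - k \<theta> + \<theta> * qs_toll u))"
        by (simp add: ennreal_mult'[symmetric] exp_add[symmetric])
      finally show ?thesis .
    qed
    then show "indicator {0<..<1} u * (mgf \<nu> (u * \<theta>) * mgf \<nu> ((1 - u) * \<theta>) * ennreal (exp (\<theta> * qs_toll u))) \<le>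
      ennreal (exp (k \<theta>)) * (indicator {0<..<1} u * ennreal (exp (k (u * \<theta>) + k ((1 - u) * \<theta>) - k \<theta> + \<theta> * qs_toll u)))"
      by (auto split: split_indicator)
  qed
  also have "\<dots> = ennreal (exp (k \<theta>)) * (\<integral>\<^sup>+u. indicator {0<..<1} u *
      ennreal (exp (k (u * \<theta>) + k ((1 - u) * \<theta>) - k \<theta> + \<theta> * qs_toll u)) \<partial>lborel)"
    by (intro nn_integral_cmult) measurable
  also have "\<dots> \<le> ennreal (exp (k \<theta>)) * 1" by (intro mult_left_mono assms(4)) auto
  finally show ?thesis by simp
qed

text \<open>The Dirac measure at 0 has moment generating function and characteristic function
  constantly 1, which starts both inductions.\<close>

definition qs_iterate :: "nat \<Rightarrow> real measure" where
  "qs_iterate n = (qs_map ^^ n) (return borel 0)"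

lemma qs_iterate_Suc: "qs_iterate (Suc n) = qs_map (qs_iterate n)"
  by (simp add: qs_iterate_def)

lemma prob_space_qs_iterate: "prob_space (qs_iterate n)" and sets_qs_iterate: "sets (qs_iterate n) = sets borel"
proof -
  have "prob_space (qs_iterate n) \<and> sets (qs_iterate n) = sets borel"
    by (induction n) (auto simp: qs_iterate_def prob_space_return intro!: prob_space_qs_map)
  then show "prob_space (qs_iterate n)" "sets (qs_iterate n) = sets borel" by auto
qed

lemma mgf_qs_iterate_0: "mgf (qs_iterate 0) \<theta> = 1"
  by (simp add: mgf_def qs_iterate_def nn_integral_return)

lemma mgf_qs_iterate_le: "mgf (qs_iterate n) \<theta> \<le> ennreal (exp (mgf_exponent \<theta>))"
proof (induction n arbitrary: \<theta>)
  case 0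
  have "0 \<le> mgf_exponent \<theta>" 
    using exp_ge_add_one_self[of "\<bar>\<theta>\<bar>"] unfolding mgf_exponent_def
    by (intro mult_nonneg_nonneg) linarith+
  then show ?case by (simp add: mgf_qs_iterate_0)
next
  case (Suc n)
  have [measurable]: "mgf_exponent \<in> borel_measurable borel" unfolding mgf_exponent_def by measurable
  show ?case unfolding qs_iterate_Suc
    by (intro mgf_qs_map_le prob_space_qs_iterate sets_qs_iterate Suc mgf_supersolution) measurable
qed

section \<open>The exponent for negative arguments\<close>

text \<open>Dominated convergence: g exceeds its minimum 1 - 2 ln 2 except at the single point 1/2,
  and the integrand is at most 1 for t >= 0.\<close>

lemma entropy_defect_integral_tendsto_0:
  "((\<lambda>t. LBINT u:{0<..<1}. exp (- t * (qs_toll u - (1 - 2 * ln 2)))) \<longlongrightarrow> 0) at_top"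
proof -
  have "((\<lambda>t. LBINT u:{0<..<1}. exp (- t * (qs_toll u - (1 - 2 * ln 2)))) \<longlongrightarrow>
      (LINT u::real|lborel. (0::real))) at_top"
    unfolding set_lebesgue_integral_def
  proof (rule integral_dominated_convergence_at_top[where w="indicator {0<..<1}"])
    have "AE u in lborel. u \<noteq> (1/2::real)" by (rule AE_lborel_singleton)
    then show "AE u in lborel. ((\<lambda>t. indicator {0<..<1} u *\<^sub>R exp (- t * (qs_toll u - (1 - 2 * ln 2)))) \<longlongrightarrow> 0) at_top"
    proof eventually_elim
      case (elim u)
      show ?case
      proof (cases "u \<in> {0<..<1}")
        case True
        define k where "k = qs_toll u - (1 - 2 * ln 2)"
        have "0 < k" using qs_toll_gt_half[of u] True elim by (simp add: k_def)
        then have "((\<lambda>t. exp (- t * k)) \<longlongrightarrow> 0) at_top" by real_asymp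
        then show ?thesis using True by (simp add: k_def)
      qed simp
    qed
    show "\<forall>\<^sub>F t in at_top. AE u in lborel. norm (indicator {0<..<1} u *\<^sub>R exp (- t * (qs_toll u - (1 - 2 * ln 2))))
        \<le> (indicator {0<..<1::real} u :: real)"
      using eventually_ge_at_top[of 0]
    proof eventually_elim
      case (elim t)
      show ?case
        by (intro AE_I2) (auto split: split_indicator intro!: mult_nonneg_nonneg elim simp: qs_toll_ge_half)
    qed
  qed auto
  then show ?thesis by simp
qed

lemma entropy_defect_nn_integral_le:
  assumes "0 < \<epsilon>"
  obtains t0 where "0 < t0" "\<And>t. t0 \<le> t \<Longrightarrow>
    (\<integral>\<^sup>+u. indicator {0<..<1} u * ennreal (exp (- t * (qs_toll u - (1 - 2 * ln 2)))) \<partial>lborel) \<le> ennreal \<epsilon>"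
proof -
  have "\<forall>\<^sub>F t in at_top. (LBINT u:{0<..<1}. exp (- t * (qs_toll u - (1 - 2 * ln 2)))) < \<epsilon>"
    using order_tendstoD(2)[OF entropy_defect_integral_tendsto_0 assms] .
  then obtain t1 where t1: "\<And>t. t1 \<le> t \<Longrightarrow> (LBINT u:{0<..<1}. exp (- t * (qs_toll u - (1 - 2 * ln 2)))) < \<epsilon>"
    by (auto simp: eventually_at_top_linorder)
  show ?thesis
  proof (rule that[of "max 1 t1"])
    fix t assume t: "max 1 t1 \<le> t"
    have "(\<integral>\<^sup>+u. indicator {0<..<1} u * ennreal (exp (- t * (qs_toll u - (1 - 2 * ln 2)))) \<partial>lborel) =
        (\<integral>\<^sup>+u. ennreal (indicator {0<..<1} u * exp (- t * (qs_toll u - (1 - 2 * ln 2)))) \<partial>lborel)"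
      by (intro nn_integral_cong) (auto split: split_indicator)
    also have "\<dots> = ennreal (LBINT u:{0<..<1}. exp (- t * (qs_toll u - (1 - 2 * ln 2))))"
      unfolding set_lebesgue_integral_def real_scaleR_def
    proof (intro nn_integral_eq_integral)
      show "integrable lborel (\<lambda>u. indicator {0<..<1} u * exp (- t * (qs_toll u - (1 - 2 * ln 2))))"
      proof (rule Bochner_Integration.integrable_bound[where f="indicator {0<..<1::real} :: real \<Rightarrow> real"])
        show "AE u in lborel. norm (indicator {0<..<1} u * exp (- t * (qs_toll u - (1 - 2 * ln 2))))
          \<le> norm (indicator {0<..<1::real} u :: real)"
          using t by (intro AE_I2) (auto split: split_indicator intro!: mult_nonneg_nonneg simp: qs_toll_ge_half)
      qed auto
    qed auto
    also have "\<dots> \<le> ennreal \<epsilon>" using t1[of t] t by (intro ennreal_leI) auto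
    finally show "(\<integral>\<^sup>+u. indicator {0<..<1} u * ennreal (exp (- t * (qs_toll u - (1 - 2 * ln 2)))) \<partial>lborel) \<le> ennreal \<epsilon>" .
  qed auto
qed

text \<open>For \<open>K(t) = t ln t / \<gamma>\<close> one has
  \<open>K(u t) + K((1 - u) t) - K(t) - t g(u) = - t (g(u) - g(1/2)) / (2 ln 2)\<close>, which is where the value
  of \<open>\<gamma>\<close> comes from.  The strict gain away from \<open>u = 1/2\<close> pays for the constant \<open>d\<close>, which in
  turn keeps the bound above \<open>1\<close> for small \<open>t\<close>.\<close>

lemma mgf_qs_iterate_left:
  obtains c d where "\<And>n t. 0 < t \<Longrightarrow> mgf (qs_iterate n) (- t) \<le> ennreal (exp (t * ln t / qs_gamma + c * t + d))"
proof -
  define b where "b = 1 / qs_gamma"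
  have b: "b = 2 - 1 / ln 2" "0 < b" using qs_gamma_pos by (simp_all add: b_def qs_gamma_def divide_inverse)
  obtain t0 where t0: "0 < t0" "\<And>t. t0 \<le> t \<Longrightarrow>
    (\<integral>\<^sup>+u. indicator {0<..<1} u * ennreal (exp (- t * (qs_toll u - (1 - 2 * ln 2)))) \<partial>lborel) \<le> ennreal (exp (- b))"
    using entropy_defect_nn_integral_le[of "exp (- b)"] by auto
  define t1 where "t1 = 2 * ln 2 * t0"
  have "0 < t1" using t0 by (simp add: t1_def)
  \<comment> \<open>Chosen so that \<open>mgf_exponent (- t)\<close> <= c t up to \<open>t1\<close>.
    The summand b in \<open>k\<close> offsets t ln t >= -1, so that k(-t) >= c t and the range t <=
    t1 is covered by the general bound.\<close>
  define c where "c = 100 * exp t1"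
  define k where "k s = - s * ln (- s) * b + c * - s + b" for s
  have k_meas [measurable]: "k \<in> borel_measurable borel" unfolding k_def by measurable
  have k_ge: "c * t \<le> k (- t)" if "0 < t" for t
  proof -
    have "ln (1 / t) \<le> 1 / t - 1" using that by (intro ln_le_minus_one) auto
    then have "- (t * ln t) \<le> 1 - t" using that by (simp add: ln_div field_simps)
    then have "0 \<le> (t * ln t + 1) * b" using that b by (intro mult_nonneg_nonneg) auto
    then show ?thesis by (simp add: k_def algebra_simps)
  qed
  have "mgf (qs_iterate n) (- t) \<le> ennreal (exp (k (- t)))" if "0 < t" for n t
    using that
  proof (induction n arbitrary: t)
    case 0
    have "0 \<le> c * t" using 0 by (simp add: c_def)
    then show ?case using k_ge[OF 0] by (simp add: mgf_qs_iterate_0)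
  next
    case (Suc n)
    show ?case
    proof (cases "t \<le> t1")
      case True
      have "mgf (qs_iterate (Suc n)) (- t) \<le> ennreal (exp (mgf_exponent (- t)))"
        by (rule mgf_qs_iterate_le)
      also have "mgf_exponent (- t) \<le> c * t"
      proof -
        have "(1 - t) * exp t \<le> exp (- t) * exp t"
          using exp_ge_add_one_self[of "-t"] by (intro mult_right_mono) auto
        then have "exp t - 1 \<le> t * exp t" by (simp add: exp_add[symmetric] algebra_simps)
        also have "\<dots> \<le> t * exp t1" using Suc.prems True by (intro mult_left_mono) auto
        finally show ?thesis using Suc.prems by (simp add: mgf_exponent_def c_def algebra_simps)
      qed
      then have "ennreal (exp (mgf_exponent (- t))) \<le> ennreal (exp (k (- t)))"
        using k_ge[OF Suc.prems] by (intro ennreal_leI) auto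
      finally show ?thesis .
    next
      case False
      \<comment> \<open>The constant summand of \<open>k\<close> enters twice with plus and once
        with minus, so one b survives. Beyond \<open>t1\<close> the remaining factor integrates to
        at most exp (-b), which cancels it.\<close>
      have eq: "k (u * - t) + k ((1 - u) * - t) - k (- t) + - t * qs_toll u =
          b + - (t / (2 * ln 2)) * (qs_toll u - (1 - 2 * ln 2))" if u: "0 < u" "u < 1" for u
      proof -
        have "ln (u * t) = ln u + ln t" "ln ((1 - u) * t) = ln (1 - u) + ln t"
          using u Suc.prems by (simp_all add: ln_mult_pos)
        then have "k (u * - t) + k ((1 - u) * - t) - k (- t) = b * t * (u * ln u + (1 - u) * ln (1 - u)) + b"
          by (simp add: k_def algebra_simps)
        also have "u * ln u + (1 - u) * ln (1 - u) = (qs_toll u - 1) / 2"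
          by (simp add: qs_toll_def)
        finally have 1: "k (u * - t) + k ((1 - u) * - t) - k (- t) = b * t * ((qs_toll u - 1) / 2) + b" .
        show ?thesis unfolding 1 unfolding b(1) by (simp add: field_simps)
      qed
      show ?thesis
        unfolding qs_iterate_Suc
      proof (rule mgf_qs_map_le[OF prob_space_qs_iterate sets_qs_iterate])
        fix u :: real assume "0 < u" "u < 1"
        then show "mgf (qs_iterate n) (u * - t) \<le> ennreal (exp (k (u * - t)))"
          using Suc.IH[of "u * t"] Suc.prems by simp
      next
        have "(\<integral>\<^sup>+u. indicator {0<..<1} u * ennreal (exp (k (u * - t) + k ((1 - u) * - t) - k (- t) + - t * qs_toll u)) \<partial>lborel)
          = (\<integral>\<^sup>+u. ennreal (exp b) * (indicator {0<..<1} u *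
              ennreal (exp (- (t / (2 * ln 2)) * (qs_toll u - (1 - 2 * ln 2))))) \<partial>lborel)"
        proof (intro nn_integral_cong)
          fix u :: real
          have "ennreal (exp (k (u * - t) + k ((1 - u) * - t) - k (- t) + - t * qs_toll u)) =
              ennreal (exp b) * ennreal (exp (- (t / (2 * ln 2)) * (qs_toll u - (1 - 2 * ln 2))))"
            if "0 < u" "u < 1"
            unfolding eq[OF that] exp_add by (rule ennreal_mult') simp
          then show "indicator {0<..<1} u * ennreal (exp (k (u * - t) + k ((1 - u) * - t) - k (- t) + - t * qs_toll u)) =
              ennreal (exp b) * (indicator {0<..<1} u * ennreal (exp (- (t / (2 * ln 2)) * (qs_toll u - (1 - 2 * ln 2)))))"
            by (auto split: split_indicator)
        qed
        also have "\<dots> = ennreal (exp b) * (\<integral>\<^sup>+u. (indicator {0<..<1} u *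
              ennreal (exp (- (t / (2 * ln 2)) * (qs_toll u - (1 - 2 * ln 2))))) \<partial>lborel)"
          by (intro nn_integral_cmult) measurable
        also have "\<dots> \<le> ennreal (exp b) * ennreal (exp (- b))"
          using False by (intro mult_left_mono t0(2)) (auto simp: t1_def field_simps)
        also have "\<dots> = 1" by (simp add: ennreal_mult'[symmetric] exp_minus)
        finally show "(\<integral>\<^sup>+u. indicator {0<..<1} u * ennreal (exp (k (u * - t) + k ((1 - u) * - t) - k (- t) + - t * qs_toll u)) \<partial>lborel) \<le> 1" .
      qed measurable
    qed
  qed
  then show ?thesis by (intro that[of c b]) (simp add: k_def b_def)
qed

section \<open>Passage to the weak limit\<close>

text \<open>The truncations min (exp (t x)) m are bounded and continuous, so their integrals
  converge and inherit the bound; monotone convergence in m removes the truncation.\<close>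

lemma mgf_le_of_weak_limit:
  assumes M: "\<And>n. real_distribution (M n)" "real_distribution N" "weak_conv_m M N"
    and B: "\<And>n. mgf (M n) t \<le> ennreal B" "0 \<le> B"
  shows "mgf N t \<le> ennreal B"
proof -
  interpret Mn: real_distribution "M n" for n by (rule M)
  interpret N: real_distribution N by (rule M)
  have trunc: "(\<integral>\<^sup>+x. ennreal (min (exp (t * x)) (real m)) \<partial>N) \<le> ennreal B" for m
  proof -
    define h where "h x = min (exp (t * x)) (real m)" for x
    have h: "0 \<le> h x" "norm (h x) \<le> real m" "isCont h x" for x
      unfolding h_def by (auto intro!: continuous_intros)
    have [measurable]: "h \<in> borel_measurable borel" unfolding h_def by measurable
    have int: "integrable (M n) h" "integrable N h" for n
      using h by (auto intro!: Mn.integrable_const_bound[where B="real m"] N.integrable_const_bound[where B="real m"])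
    have "integral\<^sup>L (M n) h \<le> B" for n
    proof -
      have "ennreal (integral\<^sup>L (M n) h) = (\<integral>\<^sup>+x. ennreal (h x) \<partial>M n)"
        using int h by (intro nn_integral_eq_integral[symmetric]) auto
      also have "\<dots> \<le> mgf (M n) t" unfolding mgf_def h_def by (intro nn_integral_mono ennreal_leI) auto
      also have "\<dots> \<le> ennreal B" by (rule B)
      finally show ?thesis using B by (simp add: ennreal_le_iff)
    qed
    moreover have "(\<lambda>n. integral\<^sup>L (M n) h) \<longlonglongrightarrow> integral\<^sup>L N h"
      using M h by (intro weak_conv_imp_integral_bdd_continuous_conv[where B="real m"]) auto
    ultimately have "integral\<^sup>L N h \<le> B" by (intro LIMSEQ_le_const2) auto
    then have "ennreal (integral\<^sup>L N h) \<le> ennreal B" by (rule ennreal_leI)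
    also have "ennreal (integral\<^sup>L N h) = (\<integral>\<^sup>+x. ennreal (h x) \<partial>N)"
      using int h by (intro nn_integral_eq_integral[symmetric]) auto
    finally show ?thesis by (simp add: h_def)
  qed
  have "mgf N t = (\<integral>\<^sup>+x. (SUP m. ennreal (min (exp (t * x)) (real m))) \<partial>N)"
    unfolding mgf_def
  proof (intro nn_integral_cong)
    fix x
    obtain m where "exp (t * x) \<le> real m" using real_arch_simple by blast
    then have "ennreal (exp (t * x)) \<le> ennreal (min (exp (t * x)) (real m))" by simp
    also have "\<dots> \<le> (SUP m. ennreal (min (exp (t * x)) (real m)))" by (rule SUP_upper) simp
    finally show "ennreal (exp (t * x)) = (SUP m. ennreal (min (exp (t * x)) (real m)))"
      by (intro antisym SUP_least) (auto intro!: ennreal_leI)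
  qed
  also have "\<dots> = (SUP m. (\<integral>\<^sup>+x. ennreal (min (exp (t * x)) (real m)) \<partial>N))"
    by (intro nn_integral_monotone_convergence_SUP)
      (auto simp: incseq_def le_fun_def intro!: ennreal_leI)
  also have "\<dots> \<le> ennreal B" by (intro SUP_least trunc)
  finally show ?thesis .
qed

section \<open>Convergence of the iterates\<close>

lemma char_qs_map:
  assumes "prob_space \<nu>" "sets \<nu> = sets borel"
  shows "char (qs_map \<nu>) t = (\<integral>u. char \<nu> (u * t) * char \<nu> ((1 - u) * t) * iexp (t * qs_toll u)
    \<partial>uniform_measure lborel {0<..<1})"
proof -
  interpret N: real_distribution \<nu> by (rule real_distribution_of_prob[OF assms])
  interpret U: prob_space "uniform_measure lborel {0<..<1::real}" by (rule prob_space_uniform_01)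
  interpret NN: pair_prob_space \<nu> \<nu> ..
  interpret P: pair_prob_space "uniform_measure lborel {0<..<1::real}" "\<nu> \<Otimes>\<^sub>M \<nu>" ..
  have [measurable_cong]: "sets (uniform_measure lborel {0<..<1::real}) = sets borel" by simp
  have inner: "(\<integral>w. iexp (t * (case w of (z, z') \<Rightarrow> u * z + (1 - u) * z' + qs_toll u)) \<partial>(\<nu> \<Otimes>\<^sub>M \<nu>)) =
      char \<nu> (u * t) * char \<nu> ((1 - u) * t) * iexp (t * qs_toll u)" for u
  proof -
    have int: "integrable (\<nu> \<Otimes>\<^sub>M \<nu>) (\<lambda>w. iexp (t * (case w of (z, z') \<Rightarrow> u * z + (1 - u) * z' + qs_toll u)))"
      by (intro NN.P.integrable_const_bound[where B=1]) auto
    have "(\<integral>w. iexp (t * (case w of (z, z') \<Rightarrow> u * z + (1 - u) * z' + qs_toll u)) \<partial>(\<nu> \<Otimes>\<^sub>M \<nu>)) =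
      (\<integral>y. \<integral>z. iexp (t * (u * y + (1 - u) * z + qs_toll u)) \<partial>\<nu> \<partial>\<nu>)"
      using NN.integral_fst'[OF int] by simp
    also have "\<dots> = (\<integral>y. \<integral>z. (iexp (u * t * y) * iexp (t * qs_toll u)) * iexp ((1 - u) * t * z) \<partial>\<nu> \<partial>\<nu>)"
      by (intro Bochner_Integration.integral_cong refl) (simp add: exp_add[symmetric] algebra_simps)
    also have "\<dots> = char \<nu> (u * t) * char \<nu> ((1 - u) * t) * iexp (t * qs_toll u)"
      by (simp add: char_def mult_ac)
    finally show ?thesis .
  qed
  have int: "integrable (uniform_measure lborel {0<..<1::real} \<Otimes>\<^sub>M (\<nu> \<Otimes>\<^sub>M \<nu>))
      (\<lambda>w. iexp (t * (case w of (u, z, z') \<Rightarrow> u * z + (1 - u) * z' + qs_toll u)))"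
    by (intro P.P.integrable_const_bound[where B=1]) auto
  have "char (qs_map \<nu>) t = (\<integral>w. iexp (t * (case w of (u, z, z') \<Rightarrow> u * z + (1 - u) * z' + qs_toll u))
      \<partial>(uniform_measure lborel {0<..<1::real} \<Otimes>\<^sub>M (\<nu> \<Otimes>\<^sub>M \<nu>)))"
    unfolding char_def qs_map_def by (subst integral_distr) auto
  also have "\<dots> = (\<integral>u. \<integral>w. iexp (t * (case w of (z, z') \<Rightarrow> u * z + (1 - u) * z' + qs_toll u))
      \<partial>(\<nu> \<Otimes>\<^sub>M \<nu>) \<partial>uniform_measure lborel {0<..<1})"
    using P.integral_fst'[OF int] by simp
  finally show ?thesis unfolding inner .
qed

text \<open>The quadratic part of the distance contracts because \<open>E (U\<^sup>2 + (1 - U)\<^sup>2) = 2/3\<close>.\<close>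

lemma char_qs_map_contraction:
  assumes \<nu>: "prob_space \<nu>" "sets \<nu> = sets borel" "prob_space \<nu>'" "sets \<nu>' = sets borel"
    and "0 \<le> \<epsilon>" "0 \<le> M"
    and le: "\<And>t. norm (char \<nu> t - char \<nu>' t) \<le> \<epsilon> * \<bar>t\<bar> + M * t\<^sup>2"
  shows "norm (char (qs_map \<nu>) t - char (qs_map \<nu>') t) \<le> \<epsilon> * \<bar>t\<bar> + 2/3 * M * t\<^sup>2"
proof -
  interpret N: real_distribution \<nu> using \<nu> by (intro real_distribution_of_prob)
  interpret N': real_distribution \<nu>' using \<nu> by (intro real_distribution_of_prob)
  interpret U: prob_space "uniform_measure lborel {0<..<1::real}" by (rule prob_space_uniform_01)
  have [measurable_cong]: "sets (uniform_measure lborel {0<..<1::real}) = sets borel" by simp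
  let ?h = "\<lambda>\<nu> u. char \<nu> (u * t) * char \<nu> ((1 - u) * t) * iexp (t * qs_toll u)"
  define B where "B u = \<epsilon> * \<bar>t\<bar> + M * t\<^sup>2 * (u\<^sup>2 + (1 - u)\<^sup>2)" for u :: real
  have bd: "norm (?h \<nu> u - ?h \<nu>' u) \<le> B u" if u: "u \<in> {0<..<1}" for u
  proof -
    have "norm (?h \<nu> u - ?h \<nu>' u) = norm (char \<nu> (u * t) * char \<nu> ((1 - u) * t) - char \<nu>' (u * t) * char \<nu>' ((1 - u) * t))"
      by (simp add: left_diff_distrib[symmetric] norm_mult)
    also have "\<dots> \<le> norm (char \<nu> (u * t) - char \<nu>' (u * t)) + norm (char \<nu> ((1 - u) * t) - char \<nu>' ((1 - u) * t))"
    proof -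
      have "norm (a * b - c * d) \<le> norm (a - c) + norm (b - d)" if "norm b \<le> 1" "norm c \<le> 1" for a b c d :: complex
      proof -
        have "norm (a * b - c * d) = norm ((a - c) * b + c * (b - d))" by (simp add: algebra_simps)
        also have "\<dots> \<le> norm (a - c) * norm b + norm c * norm (b - d)"
          by (rule order_trans[OF norm_triangle_ineq]) (simp add: norm_mult)
        also have "\<dots> \<le> norm (a - c) * 1 + 1 * norm (b - d)"
          using that by (intro add_mono mult_mono) auto
        finally show ?thesis by simp
      qed
      then show ?thesis using N.cmod_char_le_1 N'.cmod_char_le_1 by blast
    qed
    also have "\<dots> \<le> (\<epsilon> * \<bar>u * t\<bar> + M * (u * t)\<^sup>2) + (\<epsilon> * \<bar>(1 - u) * t\<bar> + M * ((1 - u) * t)\<^sup>2)"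
      by (intro add_mono le)
    \<comment> \<open>The linear parts add up to \<epsilon> |t| without any gain, so convergence
      will rest on \<epsilon> being arbitrary; only the quadratic part contracts.\<close>
    also have "\<dots> = B u"
    proof -
      have "\<bar>u * t\<bar> = u * \<bar>t\<bar>" "\<bar>(1 - u) * t\<bar> = (1 - u) * \<bar>t\<bar>" using u by (auto simp: abs_mult)
      then show ?thesis unfolding B_def power_mult_distrib by (simp only:) (simp add: algebra_simps)
    qed
    finally show ?thesis .
  qed
  have int: "integrable (uniform_measure lborel {0<..<1}) (?h \<nu>)" "integrable (uniform_measure lborel {0<..<1}) (?h \<nu>')"
    using N.cmod_char_le_1 N'.cmod_char_le_1
    by (auto intro!: U.integrable_const_bound[where B=1] AE_I2 mult_le_one simp: norm_mult)
  have [measurable]: "B \<in> borel_measurable borel" unfolding B_def by measurable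
  have B0: "0 \<le> B u" for u using assms(5,6) by (simp add: B_def)
  have "(B has_integral (\<epsilon> * \<bar>t\<bar> + 2/3 * M * t\<^sup>2)) {0<..<1}"
  proof -
    define Q where "Q u = \<epsilon> * \<bar>t\<bar> * u + M * t\<^sup>2 * (2 * u^3 / 3 - u\<^sup>2 + u)" for u
    have "(B has_integral (Q 1 - Q 0)) {0..1}"
      unfolding Q_def B_def
      by (intro fundamental_theorem_of_calculus)
        (auto simp: has_real_derivative_iff_has_vector_derivative[symmetric] power2_eq_square algebra_simps
          intro!: derivative_eq_intros)
    then show ?thesis by (simp add: has_integral_Icc_iff_Ioo Q_def mult_ac)
  qed
  then have B_int: "(\<integral>\<^sup>+u. ennreal (B u) * indicator {0<..<1} u \<partial>lborel) = ennreal (\<epsilon> * \<bar>t\<bar> + 2/3 * M * t\<^sup>2)"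
    by (intro nn_integral_has_integral_lebesgue' B0)
  have "ennreal (norm (char (qs_map \<nu>) t - char (qs_map \<nu>') t)) =
      ennreal (norm (\<integral>u. ?h \<nu> u - ?h \<nu>' u \<partial>uniform_measure lborel {0<..<1}))"
    using int by (simp add: char_qs_map \<nu>)
  also have "\<dots> \<le> (\<integral>\<^sup>+u. ennreal (norm (?h \<nu> u - ?h \<nu>' u)) \<partial>uniform_measure lborel {0<..<1})"
    using int by (intro integral_norm_bound_ennreal Bochner_Integration.integrable_diff)
  also have "\<dots> = (\<integral>\<^sup>+u. ennreal (norm (?h \<nu> u - ?h \<nu>' u)) * indicator {0<..<1} u \<partial>lborel)"
    by (subst nn_integral_uniform_measure) (auto simp: divide_ennreal_def)
  also have "\<dots> \<le> (\<integral>\<^sup>+u. ennreal (B u) * indicator {0<..<1} u \<partial>lborel)"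
    by (intro nn_integral_mono) (auto split: split_indicator intro!: ennreal_leI bd[simplified])
  also have "\<dots> = ennreal (\<epsilon> * \<bar>t\<bar> + 2/3 * M * t\<^sup>2)" by (rule B_int)
  finally show ?thesis by (rule ennreal_le_iff[THEN iffD1, rotated]) (use assms(5,6) in auto)
qed

context quicksort_density
begin

lemma real_distribution_mu: "real_distribution \<mu>"
  by (intro real_distribution_of_prob prob_mu sets_mu)

text \<open>A quantitative form of 1 - char = o(t), which holds because the mean is 0. Splitting at
  |x| = R, the part outside contributes \<epsilon> |t| by integrability and the part inside a
  multiple of t^2, so no second moment of the law is required.\<close>

lemma char_mu_near_0:
  assumes "0 < \<epsilon>"
  obtains M where "0 \<le> M" "\<And>t. norm (1 - char \<mu> t) \<le> \<epsilon> * \<bar>t\<bar> + M * t\<^sup>2"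
proof -
  interpret real_distribution \<mu> by (rule real_distribution_mu)
  have "(\<lambda>R. \<integral>x. \<bar>x\<bar> * indicator {x. real R < \<bar>x\<bar>} x \<partial>\<mu>) \<longlonglongrightarrow> (\<integral>x. 0 \<partial>\<mu>)"
  proof (rule integral_dominated_convergence[where w="\<lambda>x. \<bar>x\<bar>"])
    show "AE x in \<mu>. (\<lambda>R. \<bar>x\<bar> * indicator {x. real R < \<bar>x\<bar>} x) \<longlonglongrightarrow> 0"
    proof (intro AE_I2 tendsto_eventually)
      fix x :: real
      show "\<forall>\<^sub>F R in sequentially. \<bar>x\<bar> * indicator {x. real R < \<bar>x\<bar>} x = 0"
        using eventually_ge_at_top[of "nat \<lceil>\<bar>x\<bar>\<rceil>"]
        by eventually_elim (auto split: split_indicator simp: nat_le_iff ceiling_le_iff)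
    qed
    show "AE x in \<mu>. norm (\<bar>x\<bar> * indicator {x. real R < \<bar>x\<bar>} x) \<le> \<bar>x\<bar>" for R :: nat
      by (intro AE_I2) (simp split: split_indicator)
    show "integrable \<mu> (\<lambda>x. \<bar>x\<bar>)" using integrable_mu by (rule integrable_abs)
  qed measurable
  then have "\<forall>\<^sub>F R in sequentially. (\<integral>x. \<bar>x\<bar> * indicator {x. real R < \<bar>x\<bar>} x \<partial>\<mu>) < \<epsilon> / 2"
    using assms by (intro order_tendstoD(2)) auto
  then obtain R :: nat where R: "(\<integral>x. \<bar>x\<bar> * indicator {x. real R < \<bar>x\<bar>} x \<partial>\<mu>) < \<epsilon> / 2"
    by (auto simp: eventually_sequentially)
  have intR: "integrable \<mu> (\<lambda>x. \<bar>x\<bar> * indicator {x. real R < \<bar>x\<bar>} x)"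
    by (rule Bochner_Integration.integrable_bound[OF integrable_abs[OF integrable_mu]]) (auto split: split_indicator)
  have "norm (1 - char \<mu> t) \<le> \<epsilon> * \<bar>t\<bar> + (real R)\<^sup>2 / 2 * t\<^sup>2" for t
  proof -
    \<comment> \<open>The first-order Taylor remainder carries a minimum of a linear and a quadratic
      term in x; the linear one will be used for |x| > R, the quadratic one for |x| <= R.\<close>
    have "norm (char \<mu> t - (\<Sum>k\<le>1. ((\<i> * t)^k / fact k) * expectation (\<lambda>x. x^k))) \<le>
      (\<bar>t\<bar>^1 / fact (Suc 1)) * expectation (\<lambda>x. min (2 * \<bar>x\<bar>^1 * Suc 1) (\<bar>t\<bar> * \<bar>x\<bar>^Suc 1))"
    proof (rule char_approx2)
      fix k :: nat assume "k \<le> 1"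
      then have "k = 0 \<or> k = 1" by auto
      then show "integrable \<mu> (\<lambda>x. x ^ k)" using integrable_mu by auto
    qed
    then have "norm (1 - char \<mu> t) \<le> \<bar>t\<bar> / 2 * expectation (\<lambda>x. min (4 * \<bar>x\<bar>) (\<bar>t\<bar> * x\<^sup>2))"
      using mean_mu prob_space by (simp add: norm_minus_commute numeral_2_eq_2[symmetric])
    also have "\<dots> \<le> \<bar>t\<bar> / 2 * expectation (\<lambda>x. 4 * (\<bar>x\<bar> * indicator {x. real R < \<bar>x\<bar>} x) + \<bar>t\<bar> * (real R)\<^sup>2)"
    proof (intro mult_left_mono integral_mono)
      show "integrable \<mu> (\<lambda>x. min (4 * \<bar>x\<bar>) (\<bar>t\<bar> * x\<^sup>2))"
        by (rule Bochner_Integration.integrable_bound[OF integrable_mult_right[OF integrable_abs[OF integrable_mu], of 4]]) auto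
      fix x :: real
      show "min (4 * \<bar>x\<bar>) (\<bar>t\<bar> * x\<^sup>2) \<le> 4 * (\<bar>x\<bar> * indicator {x. real R < \<bar>x\<bar>} x) + \<bar>t\<bar> * (real R)\<^sup>2"
      proof (cases "real R < \<bar>x\<bar>")
        case False
        then have "x\<^sup>2 \<le> (real R)\<^sup>2" by (simp add: abs_le_square_iff[symmetric])
        then have "\<bar>t\<bar> * x\<^sup>2 \<le> \<bar>t\<bar> * (real R)\<^sup>2" by (rule mult_left_mono) auto
        then show ?thesis using False by (simp add: min.coboundedI2)
      qed (simp add: min.coboundedI1)
    qed (use intR in auto)
    also have "\<dots> = \<bar>t\<bar> / 2 * (4 * (\<integral>x. \<bar>x\<bar> * indicator {x. real R < \<bar>x\<bar>} x \<partial>\<mu>) + \<bar>t\<bar> * (real R)\<^sup>2)"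
      using intR prob_space by simp
    also have "\<dots> \<le> \<bar>t\<bar> / 2 * (2 * \<epsilon> + \<bar>t\<bar> * (real R)\<^sup>2)"
      using R by (intro mult_left_mono) auto
    also have "\<dots> = \<epsilon> * \<bar>t\<bar> + (real R)\<^sup>2 / 2 * t\<^sup>2"
      by (simp add: power2_eq_square algebra_simps abs_mult[symmetric])
    finally show ?thesis .
  qed
  then show ?thesis by (intro that[of "(real R)\<^sup>2 / 2"]) auto
qed

text \<open>The estimate of 1 - \<open>char \<mu> t\<close> is the case n = 0 of an induction by
  contraction. The choice of \<epsilon> keeps the constant part below r/2, and the quadratic part
  decays like (2/3)^n.\<close>

lemma char_qs_iterate_tendsto: "(\<lambda>n. char (qs_iterate n) t) \<longlonglongrightarrow> char \<mu> t"
proof (rule LIMSEQ_I)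
  fix r :: real assume "0 < r"
  define \<epsilon> where "\<epsilon> = r / (2 * (\<bar>t\<bar> + 1))"
  have "0 < \<epsilon>" using \<open>0 < r\<close> by (simp add: \<epsilon>_def)
  then obtain M where M: "0 \<le> M" "\<And>t. norm (1 - char \<mu> t) \<le> \<epsilon> * \<bar>t\<bar> + M * t\<^sup>2"
    using char_mu_near_0 by blast
  have bd: "norm (char (qs_iterate n) t - char \<mu> t) \<le> \<epsilon> * \<bar>t\<bar> + (2/3)^n * M * t\<^sup>2" for n t
  proof (induction n arbitrary: t)
    case 0
    have "char (qs_iterate 0) t = 1"
      by (simp add: char_def qs_iterate_def integral_return)
    then show ?case using M(2) by simp
  next
    case (Suc n)
    have "norm (char (qs_map (qs_iterate n)) t - char (qs_map \<mu>) t) \<le> \<epsilon> * \<bar>t\<bar> + 2/3 * ((2/3)^n * M) * t\<^sup>2"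
      using \<open>0 < \<epsilon>\<close> M(1) Suc
      by (intro char_qs_map_contraction prob_space_qs_iterate sets_qs_iterate prob_mu sets_mu) auto
    then show ?case by (simp add: qs_iterate_Suc qs_map_mu)
  qed
  have "(\<lambda>n. (2/3)^n * (M * t\<^sup>2)) \<longlonglongrightarrow> 0 * (M * t\<^sup>2)"
    by (intro tendsto_mult tendsto_const LIMSEQ_power_zero) auto
  then have "\<forall>\<^sub>F n in sequentially. (2/3)^n * (M * t\<^sup>2) < r / 2"
    using \<open>0 < r\<close> by (intro order_tendstoD(2)) auto
  then obtain N where N: "\<And>n. N \<le> n \<Longrightarrow> (2/3)^n * (M * t\<^sup>2) < r / 2"
    by (auto simp: eventually_sequentially)
  have "\<epsilon> * \<bar>t\<bar> \<le> r / 2" using \<open>0 < r\<close> by (simp add: \<epsilon>_def field_simps)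
  then have "norm (char (qs_iterate n) t - char \<mu> t) < r" if "N \<le> n" for n
    using bd[of n t] N[OF that] by (simp add: mult.assoc)
  then show "\<exists>N. \<forall>n\<ge>N. norm (char (qs_iterate n) t - char \<mu> t) < r" by blast
qed

lemma weak_conv_qs_iterate: "weak_conv_m qs_iterate \<mu>"
  by (intro levy_continuity real_distribution_mu char_qs_iterate_tendsto
      real_distribution_of_prob prob_space_qs_iterate sets_qs_iterate)

lemma mgf_mu_le_of_iterates:
  assumes "\<And>n. mgf (qs_iterate n) t \<le> ennreal B" "0 \<le> B"
  shows "mgf \<mu> t \<le> ennreal B"
  by (rule mgf_le_of_weak_limit[OF _ real_distribution_mu weak_conv_qs_iterate assms])
    (intro real_distribution_of_prob prob_space_qs_iterate sets_qs_iterate)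

lemma mgf_mu_le: "mgf \<mu> t \<le> ennreal (exp (mgf_exponent t))"
  by (intro mgf_mu_le_of_iterates mgf_qs_iterate_le) auto

lemma mgf_mu_left:
  obtains c d where "\<And>t. 0 < t \<Longrightarrow> mgf \<mu> (- t) \<le> ennreal (exp (t * ln t / qs_gamma + c * t + d))"
proof -
  obtain c d where "\<And>n t. 0 < t \<Longrightarrow> mgf (qs_iterate n) (- t) \<le> ennreal (exp (t * ln t / qs_gamma + c * t + d))"
    using mgf_qs_iterate_left by blast
  then show ?thesis by (intro that[of c d] mgf_mu_le_of_iterates) auto
qed

end

section \<open>Boundedness of the density\<close>

lemma emeasure_le_of_diameter:
  fixes S :: "real set"
  assumes "\<And>u v. u \<in> S \<Longrightarrow> v \<in> S \<Longrightarrow> u < v \<Longrightarrow> v - u \<le> r" "0 \<le> r" "S \<in> sets lborel"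
  shows "emeasure lborel S \<le> ennreal (2 * r)"
proof (cases "S = {}")
  case False
  then obtain u where u: "u \<in> S" by blast
  have "S \<subseteq> {u - r..u + r}"
  proof
    fix v assume "v \<in> S"
    then show "v \<in> {u - r..u + r}"
      using assms(1)[OF u, of v] assms(1)[of v u] assms(2) u by (cases v u rule: linorder_cases) auto
  qed
  then have "emeasure lborel S \<le> emeasure lborel {u - r..u + r}" by (intro emeasure_mono) auto
  then show ?thesis using assms(2) by simp
qed simp

text \<open>\<open>G'\<close> is the increasing derivative of \<open>G\<close>. Between two points
  with slope at least \<kappa> (or at most -\<kappa>) the mean value theorem bounds their distance
  by h/\<kappa>; each sign contributes a set of measure at most 2 h/\<kappa>.\<close>

lemma steep_split_set_small:
  fixes y z :: real
  assumes "0 < \<kappa>" "0 \<le> h"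
  defines "G \<equiv> \<lambda>u. u * y + (1 - u) * z + qs_toll u"
    and "G' \<equiv> \<lambda>u. y - z + 2 * (ln u - ln (1 - u))"
  shows "emeasure lborel {u \<in> {0<..<1}. \<kappa> \<le> \<bar>G' u\<bar> \<and> G u \<in> {x..x + h}} \<le> ennreal (4 * h / \<kappa>)"
proof -
  have [measurable]: "G \<in> borel_measurable borel" "G' \<in> borel_measurable borel"
    unfolding G_def G'_def by measurable
  have mvt: "\<exists>w. u < w \<and> w < v \<and> G v - G u = (v - u) * G' w" if "0 < u" "u < v" "v < 1" for u v
  proof (rule MVT2[OF that(2)])
    fix w assume "u \<le> w" "w \<le> v"
    then have "(qs_toll has_real_derivative 2 * (ln w - ln (1 - w))) (at w)"
      using that by (intro qs_toll_has_derivative) auto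
    then show "(G has_real_derivative G' w) (at w)"
      unfolding G_def G'_def by (auto intro!: derivative_eq_intros)
  qed
  have mono: "G' u \<le> G' w" if "0 < u" "u \<le> w" "w < 1" for u w
    using that unfolding G'_def by (auto intro!: add_mono diff_mono)
  let ?P = "{u \<in> {0<..<1}. \<kappa> \<le> G' u \<and> G u \<in> {x..x + h}}"
  let ?N = "{u \<in> {0<..<1}. G' u \<le> - \<kappa> \<and> G u \<in> {x..x + h}}"
  have "emeasure lborel ?P \<le> ennreal (2 * (h / \<kappa>))"
  proof (rule emeasure_le_of_diameter)
    fix u v assume uv: "u \<in> ?P" "v \<in> ?P" "u < v"
    then obtain w where w: "u < w" "w < v" "G v - G u = (v - u) * G' w" using mvt[of u v] by auto
    have "\<kappa> \<le> G' w" using mono[of u w] w uv by auto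
    then have "(v - u) * \<kappa> \<le> (v - u) * G' w" using uv by (intro mult_left_mono) auto
    also have "\<dots> \<le> h" unfolding w(3)[symmetric] using uv by auto
    finally show "v - u \<le> h / \<kappa>" using assms(1) by (simp add: pos_le_divide_eq)
  qed (use assms(1,2) in auto)
  moreover have "emeasure lborel ?N \<le> ennreal (2 * (h / \<kappa>))"
  proof (rule emeasure_le_of_diameter)
    fix u v assume uv: "u \<in> ?N" "v \<in> ?N" "u < v"
    then obtain w where w: "u < w" "w < v" "G v - G u = (v - u) * G' w" using mvt[of u v] by auto
    have "\<kappa> \<le> - G' w" using mono[of w v] w uv by auto
    then have "(v - u) * \<kappa> \<le> (v - u) * - G' w" using uv by (intro mult_left_mono) auto
    also have "\<dots> = G u - G v" using w(3) by simp
    also have "\<dots> \<le> h" using uv by auto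
    finally show "v - u \<le> h / \<kappa>" using assms(1) by (simp add: pos_le_divide_eq)
  qed (use assms(1,2) in auto)
  ultimately have "emeasure lborel ?P + emeasure lborel ?N \<le> ennreal (2 * (h / \<kappa>)) + ennreal (2 * (h / \<kappa>))"
    by (rule add_mono)
  also have "\<dots> = ennreal (4 * h / \<kappa>)"
    using assms(1,2) by (simp add: ennreal_plus[symmetric] del: ennreal_plus)
  finally have "emeasure lborel ?P + emeasure lborel ?N \<le> ennreal (4 * h / \<kappa>)" .
  moreover have "emeasure lborel {u \<in> {0<..<1}. \<kappa> \<le> \<bar>G' u\<bar> \<and> G u \<in> {x..x + h}} \<le> emeasure lborel (?P \<union> ?N)"
    by (intro emeasure_mono) (auto simp: abs_real_def split: if_splits)
  moreover have "emeasure lborel (?P \<union> ?N) \<le> emeasure lborel ?P + emeasure lborel ?N"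
    by (intro emeasure_subadditive) auto
  ultimately show ?thesis by (meson order_trans)
qed

context quicksort_density
begin

text \<open>Levy's concentration function of the law.\<close>

definition concentration :: "real \<Rightarrow> ennreal" where
  "concentration h = (SUP x. emeasure \<mu> {x..x + h})"

lemma concentration_upper: "emeasure \<mu> {x..x + h} \<le> concentration h"
  unfolding concentration_def by (rule SUP_upper) simp

lemma concentration_double:
  assumes "0 \<le> h"
  shows "concentration (2 * h) \<le> 2 * concentration h"
  unfolding concentration_def[of "2 * h"]
proof (rule SUP_least)
  fix x
  have "{x..x + 2 * h} \<subseteq> {x..x + h} \<union> {x + h..x + h + h}" by auto
  then have "emeasure \<mu> {x..x + 2 * h} \<le> emeasure \<mu> ({x..x + h} \<union> {x + h..x + h + h})"
    by (intro emeasure_mono) (auto simp: sets_mu)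
  also have "\<dots> \<le> emeasure \<mu> {x..x + h} + emeasure \<mu> {x + h..x + h + h}"
    by (intro emeasure_subadditive) (auto simp: sets_mu)
  also have "\<dots> \<le> concentration h + concentration h"
    by (intro add_mono concentration_upper)
  finally show "emeasure \<mu> {x..x + 2 * h} \<le> 2 * concentration h" unfolding mult_2 .
qed

lemma emeasure_mu: "A \<in> sets borel \<Longrightarrow> emeasure \<mu> A = (\<integral>\<^sup>+x. ennreal (f x) * indicator A x \<partial>lborel)"
  unfolding mu_density by (intro emeasure_density) auto

text \<open>Absolute continuity, uniformly in the position of the interval: where f <= n the mass is
  at most n times the length, and the set where f > n carries mass below \<epsilon>/2 for a suitable
  n.\<close>

lemma concentration_small:
  assumes "0 < \<epsilon>"
  obtains \<kappa> where "0 < \<kappa>" "\<And>h. h \<le> \<kappa> \<Longrightarrow> concentration h \<le> ennreal \<epsilon>"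
proof -
  have "(\<integral>\<^sup>+x. ennreal (f x) \<partial>lborel) = 1"
    using emeasure_mu[of UNIV] emeasure_space_1 sets_eq_imp_space_eq[OF sets_mu] by simp
  then have int_f: "integrable lborel f"
    by (intro integrableI_nonneg) (auto simp: f_nonneg)
  have "(\<lambda>n. LINT x|lborel. f x * indicator {x. real n < f x} x) \<longlonglongrightarrow> (LINT x::real|lborel. 0)"
  proof (rule integral_dominated_convergence[where w=f])
    show "AE x in lborel. (\<lambda>n. f x * indicator {x. real n < f x} x) \<longlonglongrightarrow> 0"
    proof (intro AE_I2 tendsto_eventually)
      fix x :: real
      show "\<forall>\<^sub>F n in sequentially. f x * indicator {x. real n < f x} x = 0"
        using eventually_ge_at_top[of "nat \<lceil>f x\<rceil>"]
        by eventually_elim (auto split: split_indicator simp: nat_le_iff ceiling_le_iff)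
    qed
    show "AE x in lborel. norm (f x * indicator {x. real n < f x} x) \<le> f x" for n :: nat
      by (intro AE_I2) (simp add: f_nonneg split: split_indicator)
  qed (use int_f in auto)
  then have "\<forall>\<^sub>F n in sequentially. (LINT x|lborel. f x * indicator {x. real n < f x} x) < \<epsilon> / 2"
    using assms by (intro order_tendstoD(2)) auto
  then obtain n :: nat where n: "(LINT x|lborel. f x * indicator {x. real n < f x} x) < \<epsilon> / 2"
    by (auto simp: eventually_sequentially)
  have "integrable lborel (\<lambda>x. f x * indicator {x. real n < f x} x)"
    by (rule Bochner_Integration.integrable_bound[OF int_f]) (auto simp: f_nonneg split: split_indicator)
  then have n': "(\<integral>\<^sup>+x. ennreal (f x * indicator {x. real n < f x} x) \<partial>lborel) \<le> ennreal (\<epsilon> / 2)"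
    using n by (subst nn_integral_eq_integral) (auto simp: f_nonneg intro!: ennreal_leI split: split_indicator)
  define \<kappa> where "\<kappa> = \<epsilon> / (2 * (real n + 1))"
  have \<kappa>: "0 < \<kappa>" using assms by (simp add: \<kappa>_def)
  have "concentration h \<le> ennreal \<epsilon>" if "h \<le> \<kappa>" for h
    unfolding concentration_def
  proof (rule SUP_least)
    fix x
    have "emeasure \<mu> {x..x + h} \<le> emeasure \<mu> {x..x + \<kappa>}"
      using that by (intro emeasure_mono) (auto simp: sets_mu)
    also have "\<dots> = (\<integral>\<^sup>+y. ennreal (f y) * indicator {x..x + \<kappa>} y \<partial>lborel)"
      by (intro emeasure_mu) auto
    also have "\<dots> \<le> (\<integral>\<^sup>+y. ennreal (real n) * indicator {x..x + \<kappa>} y + ennreal (f y * indicator {x. real n < f x} y) \<partial>lborel)"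
      by (intro nn_integral_mono) (auto split: split_indicator intro!: ennreal_leI simp: add_increasing)
    also have "\<dots> = (\<integral>\<^sup>+y. ennreal (real n) * indicator {x..x + \<kappa>} y \<partial>lborel) + (\<integral>\<^sup>+y. ennreal (f y * indicator {x. real n < f x} y) \<partial>lborel)"
      by (intro nn_integral_add) auto
    also have "\<dots> \<le> ennreal (real n * \<kappa>) + ennreal (\<epsilon> / 2)"
      using n' \<kappa> by (intro add_mono) (auto simp: nn_integral_cmult_indicator ennreal_mult'[symmetric])
    also have "\<dots> = ennreal (real n * \<kappa> + \<epsilon> / 2)"
      using assms \<kappa> by (intro ennreal_plus[symmetric]) auto
    also have "\<dots> \<le> ennreal \<epsilon>"
      using assms by (intro ennreal_leI) (simp add: \<kappa>_def field_simps)
    finally show "emeasure \<mu> {x..x + h} \<le> ennreal \<epsilon>" .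
  qed
  with \<kappa> show ?thesis by (rule that)
qed

text \<open>If the slope \<open>y - z + l\<close> is small, then \<open>z\<close> alone determines the split point up to \<open>2\<kappa>\<close>,
  so both variables are confined to short intervals.\<close>

lemma flat_split_prob_le:
  assumes v: "1/2 \<le> v" "v < 1" and "0 \<le> h" "0 < \<kappa>"
  shows "(\<integral>\<^sup>+z. \<integral>\<^sup>+y. indicator {(y, z). v * y + (1 - v) * z + c \<in> {x..x + h} \<and> \<bar>y - z + l\<bar> < \<kappa>} (y, z) \<partial>\<mu> \<partial>\<mu>)
    \<le> concentration (2 * h) * concentration (h + 2 * \<kappa>)"
proof -
  define J where "J = {x - c + v * (l - \<kappa>)..x - c + v * (l - \<kappa>) + (h + 2 * \<kappa>)}"
  have inner: "(\<integral>\<^sup>+y. indicator {(y, z). v * y + (1 - v) * z + c \<in> {x..x + h} \<and> \<bar>y - z + l\<bar> < \<kappa>} (y, z) \<partial>\<mu>)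
      \<le> concentration (2 * h) * indicator J z" for z
  proof -
    define a where "a = (x - c - (1 - v) * z) / v"
    have sub: "y \<in> {a..a + 2 * h}" "z \<in> J"
      if "v * y + (1 - v) * z + c \<in> {x..x + h}" "\<bar>y - z + l\<bar> < \<kappa>" for y
    proof -
      have "h \<le> v * (2 * h)" using v \<open>0 \<le> h\<close> mult_right_mono[of "1/2" v "2 * h"] by simp
      moreover have "v * a = x - c - (1 - v) * z" using v by (simp add: a_def)
      ultimately have "v * a \<le> v * y" "v * y \<le> v * (a + 2 * h)"
        using that(1) by (auto simp: algebra_simps)
      then show "y \<in> {a..a + 2 * h}" using v by (simp add: mult_le_cancel_left_pos)
      have "v * (- \<kappa>) \<le> v * (y - z + l)" "v * (y - z + l) \<le> v * \<kappa>"
        using that(2) v by (intro mult_left_mono; auto)+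
      moreover have "v * (2 * \<kappa>) \<le> 1 * (2 * \<kappa>)" using v \<open>0 < \<kappa>\<close> by (intro mult_right_mono) auto
      ultimately show "z \<in> J" using that(1) by (auto simp: J_def algebra_simps)
    qed
    have "(\<integral>\<^sup>+y. indicator {(y, z). v * y + (1 - v) * z + c \<in> {x..x + h} \<and> \<bar>y - z + l\<bar> < \<kappa>} (y, z) \<partial>\<mu>)
      \<le> (\<integral>\<^sup>+y. indicator J z * indicator {a..a + 2 * h} y \<partial>\<mu>)"
      using sub by (intro nn_integral_mono) (auto split: split_indicator)
    also have "\<dots> = indicator J z * emeasure \<mu> {a..a + 2 * h}"
      by (subst nn_integral_cmult) (auto simp: sets_mu)
    also have "\<dots> \<le> indicator J z * concentration (2 * h)"
      by (intro mult_left_mono concentration_upper) auto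
    finally show ?thesis by (simp add: mult.commute)
  qed
  have "(\<integral>\<^sup>+z. \<integral>\<^sup>+y. indicator {(y, z). v * y + (1 - v) * z + c \<in> {x..x + h} \<and> \<bar>y - z + l\<bar> < \<kappa>} (y, z) \<partial>\<mu> \<partial>\<mu>)
    \<le> (\<integral>\<^sup>+z. concentration (2 * h) * indicator J z \<partial>\<mu>)"
    by (intro nn_integral_mono inner)
  also have "\<dots> = concentration (2 * h) * emeasure \<mu> J"
    by (subst nn_integral_cmult) (auto simp: sets_mu J_def)
  also have "\<dots> \<le> concentration (2 * h) * concentration (h + 2 * \<kappa>)"
    unfolding J_def by (intro mult_left_mono concentration_upper) auto
  finally show ?thesis .
qed

text \<open>\<open>S\<close> marks the triples where the slope in u is at least \<kappa>, and
  integrating over u first gives 4 h/\<kappa>. \<open>T\<close> marks the flat ones, where for each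
  u both y and z are confined, which gives a product of two concentrations.\<close>

lemma concentration_self_bound:
  assumes "0 < h" "0 < \<kappa>"
  shows "concentration h \<le> ennreal (4 * h / \<kappa>) + concentration (2 * h) * concentration (h + 2 * \<kappa>)"
  unfolding concentration_def[of h]
proof (rule SUP_least)
  fix x
  interpret P: pair_prob_space \<mu> \<mu> ..
  interpret LP: pair_sigma_finite lborel \<mu> ..
  define G where "G u y z = u * y + (1 - u) * z + qs_toll u" for u y z
  define G' where "G' u y z = y - z + 2 * (ln u - ln (1 - u))" for u y z :: real
  define S where "S u y z = (indicator {u \<in> {0<..<1}. \<kappa> \<le> \<bar>G' u y z\<bar> \<and> G u y z \<in> {x..x + h}} u :: ennreal)" for u y z
  define T where "T u y z = (indicator {(y, z). G u y z \<in> {x..x + h} \<and> \<bar>G' u y z\<bar> < \<kappa>} (y, z) :: ennreal)" for u y z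
  have S_meas [measurable (raw)]: "(\<lambda>w. S (a w) (b w) (c w)) \<in> borel_measurable N"
    if [measurable]: "a \<in> borel_measurable N" "b \<in> borel_measurable N" "c \<in> borel_measurable N"
    for a b c :: "'c \<Rightarrow> real" and N
    unfolding S_def G_def G'_def indicator_def mem_Collect_eq by measurable
  have T_meas [measurable (raw)]: "(\<lambda>w. T (a w) (b w) (c w)) \<in> borel_measurable N"
    if [measurable]: "a \<in> borel_measurable N" "b \<in> borel_measurable N" "c \<in> borel_measurable N"
    for a b c :: "'c \<Rightarrow> real" and N
    unfolding T_def G_def G'_def indicator_def mem_Collect_eq prod.case by measurable
  have "emeasure \<mu> {x..x + h} = (\<integral>\<^sup>+x'. indicator {x..x + h} x' \<partial>\<mu>)" by (simp add: sets_mu)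
  also have "\<dots> = (\<integral>\<^sup>+u. indicator {0<..<1} u * (\<integral>\<^sup>+z. \<integral>\<^sup>+y. indicator {x..x + h} (G u y z) \<partial>\<mu> \<partial>\<mu>) \<partial>lborel)"
    unfolding G_def by (intro nn_integral_mu_FPE) measurable
  also have "\<dots> \<le> (\<integral>\<^sup>+u. (\<integral>\<^sup>+z. \<integral>\<^sup>+y. S u y z \<partial>\<mu> \<partial>\<mu>) + indicator {0<..<1} u * (\<integral>\<^sup>+z. \<integral>\<^sup>+y. T u y z \<partial>\<mu> \<partial>\<mu>) \<partial>lborel)"
  proof (intro nn_integral_mono)
    fix u :: real
    show "indicator {0<..<1} u * (\<integral>\<^sup>+z. \<integral>\<^sup>+y. indicator {x..x + h} (G u y z) \<partial>\<mu> \<partial>\<mu>) \<le>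
      (\<integral>\<^sup>+z. \<integral>\<^sup>+y. S u y z \<partial>\<mu> \<partial>\<mu>) + indicator {0<..<1} u * (\<integral>\<^sup>+z. \<integral>\<^sup>+y. T u y z \<partial>\<mu> \<partial>\<mu>)"
    proof (cases "u \<in> {0<..<1}")
      case True
      have "(\<integral>\<^sup>+z. \<integral>\<^sup>+y. indicator {x..x + h} (G u y z) \<partial>\<mu> \<partial>\<mu>) \<le> (\<integral>\<^sup>+z. \<integral>\<^sup>+y. S u y z + T u y z \<partial>\<mu> \<partial>\<mu>)"
        using True by (intro nn_integral_mono) (auto simp: S_def T_def split: split_indicator)
      also have "\<dots> = (\<integral>\<^sup>+z. (\<integral>\<^sup>+y. S u y z \<partial>\<mu>) + (\<integral>\<^sup>+y. T u y z \<partial>\<mu>) \<partial>\<mu>)"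
        by (intro nn_integral_cong nn_integral_add) measurable
      also have "\<dots> = (\<integral>\<^sup>+z. \<integral>\<^sup>+y. S u y z \<partial>\<mu> \<partial>\<mu>) + (\<integral>\<^sup>+z. \<integral>\<^sup>+y. T u y z \<partial>\<mu> \<partial>\<mu>)"
        by (intro nn_integral_add) measurable
      finally show ?thesis using True by simp
    qed simp
  qed
  also have "\<dots> = (\<integral>\<^sup>+u. (\<integral>\<^sup>+z. \<integral>\<^sup>+y. S u y z \<partial>\<mu> \<partial>\<mu>) \<partial>lborel) +
      (\<integral>\<^sup>+u. indicator {0<..<1} u * (\<integral>\<^sup>+z. \<integral>\<^sup>+y. T u y z \<partial>\<mu> \<partial>\<mu>) \<partial>lborel)"
    by (intro nn_integral_add) measurable
  also have "\<dots> \<le> ennreal (4 * h / \<kappa>) + concentration (2 * h) * concentration (h + 2 * \<kappa>)"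
  proof (intro add_mono)
    have "(\<integral>\<^sup>+u. (\<integral>\<^sup>+z. \<integral>\<^sup>+y. S u y z \<partial>\<mu> \<partial>\<mu>) \<partial>lborel) = (\<integral>\<^sup>+z. \<integral>\<^sup>+u. \<integral>\<^sup>+y. S u y z \<partial>\<mu> \<partial>lborel \<partial>\<mu>)"
      by (intro LP.Fubini'[symmetric]) measurable
    also have "\<dots> = (\<integral>\<^sup>+z. \<integral>\<^sup>+y. \<integral>\<^sup>+u. S u y z \<partial>lborel \<partial>\<mu> \<partial>\<mu>)"
      by (intro nn_integral_cong LP.Fubini'[symmetric]) measurable
    also have "\<dots> \<le> (\<integral>\<^sup>+z. \<integral>\<^sup>+y. ennreal (4 * h / \<kappa>) \<partial>\<mu> \<partial>\<mu>)"
    proof (intro nn_integral_mono)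
      fix y z
      have "(\<integral>\<^sup>+u. S u y z \<partial>lborel) = emeasure lborel {u \<in> {0<..<1}. \<kappa> \<le> \<bar>G' u y z\<bar> \<and> G u y z \<in> {x..x + h}}"
      proof -
        have "{u \<in> {0<..<1}. \<kappa> \<le> \<bar>G' u y z\<bar> \<and> G u y z \<in> {x..x + h}} \<in> sets lborel"
          unfolding G_def G'_def by measurable
        then show ?thesis unfolding S_def by (rule nn_integral_indicator)
      qed
      also have "\<dots> \<le> ennreal (4 * h / \<kappa>)"
        unfolding G_def G'_def using assms by (intro steep_split_set_small) auto
      finally show "(\<integral>\<^sup>+u. S u y z \<partial>lborel) \<le> ennreal (4 * h / \<kappa>)" .
    qed
    also have "\<dots> = ennreal (4 * h / \<kappa>)" by (simp add: emeasure_space_1)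
    finally show "(\<integral>\<^sup>+u. (\<integral>\<^sup>+z. \<integral>\<^sup>+y. S u y z \<partial>\<mu> \<partial>\<mu>) \<partial>lborel) \<le> ennreal (4 * h / \<kappa>)" .
  next
    have T_le: "(\<integral>\<^sup>+z. \<integral>\<^sup>+y. T u y z \<partial>\<mu> \<partial>\<mu>) \<le> concentration (2 * h) * concentration (h + 2 * \<kappa>)" if u: "0 < u" "u < 1" for u
    proof (cases "1/2 \<le> u")
      case True
      then show ?thesis
        unfolding T_def G_def G'_def using assms u by (intro flat_split_prob_le) auto
    next
      \<comment> \<open>Exchanging y and z gives the inner variable the larger weight 1 - u, as
        \<open>flat_split_prob_le\<close> requires.\<close>
      case False
      have "(\<integral>\<^sup>+z. \<integral>\<^sup>+y. T u y z \<partial>\<mu> \<partial>\<mu>) = (\<integral>\<^sup>+y. \<integral>\<^sup>+z. T u y z \<partial>\<mu> \<partial>\<mu>)"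
        by (intro P.Fubini'[symmetric]) measurable
      also have "\<dots> = (\<integral>\<^sup>+y. \<integral>\<^sup>+z. indicator {(z, y). (1 - u) * z + (1 - (1 - u)) * y + qs_toll u \<in> {x..x + h} \<and>
          \<bar>z - y + - (2 * (ln u - ln (1 - u)))\<bar> < \<kappa>} (z, y) \<partial>\<mu> \<partial>\<mu>)"
      proof (intro nn_integral_cong)
        fix y z
        have "\<bar>z - y + - (2 * (ln u - ln (1 - u)))\<bar> = \<bar>G' u y z\<bar>" by (simp add: G'_def abs_minus_commute algebra_simps)
        moreover have "(1 - u) * z + (1 - (1 - u)) * y + qs_toll u = G u y z" by (simp add: G_def)
        ultimately show "T u y z = indicator {(z, y). (1 - u) * z + (1 - (1 - u)) * y + qs_toll u \<in> {x..x + h} \<and>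
          \<bar>z - y + - (2 * (ln u - ln (1 - u)))\<bar> < \<kappa>} (z, y)"
          by (auto simp: T_def indicator_def)
      qed
      also have "\<dots> \<le> concentration (2 * h) * concentration (h + 2 * \<kappa>)"
        using False u assms by (intro flat_split_prob_le) auto
      finally show ?thesis .
    qed
    have "(\<integral>\<^sup>+u. indicator {0<..<1} u * (\<integral>\<^sup>+z. \<integral>\<^sup>+y. T u y z \<partial>\<mu> \<partial>\<mu>) \<partial>lborel) \<le>
       (\<integral>\<^sup>+u. (concentration (2 * h) * concentration (h + 2 * \<kappa>)) * indicator {0<..<1} (u::real) \<partial>lborel)"
      using T_le by (intro nn_integral_mono) (auto split: split_indicator)
    also have "\<dots> = concentration (2 * h) * concentration (h + 2 * \<kappa>)"
      by (subst nn_integral_cmult_indicator) auto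
    finally show "(\<integral>\<^sup>+u. indicator {0<..<1} u * (\<integral>\<^sup>+z. \<integral>\<^sup>+y. T u y z \<partial>\<mu> \<partial>\<mu>) \<partial>lborel) \<le>
       concentration (2 * h) * concentration (h + 2 * \<kappa>)" .
  qed
  finally show "emeasure \<mu> {x..x + h} \<le> ennreal (4 * h / \<kappa>) + concentration (2 * h) * concentration (h + 2 * \<kappa>)" .
qed

text \<open>On a small scale the second concentration factor is at most 1/4 and the first at most
  twice \<open>concentration h\<close>, so the product is at most half of
  \<open>concentration h\<close> and can be absorbed. The resulting linear bound 8 h/\<kappa> on
  interval masses bounds the continuous \<open>f\<close> by 8/\<kappa>.\<close>

lemma density_bounded:
  obtains M where "0 < M" "\<And>x. f x \<le> M"
proof -
  obtain \<kappa>' where \<kappa>': "0 < \<kappa>'" "\<And>h. h \<le> \<kappa>' \<Longrightarrow> concentration h \<le> ennreal (1/4)"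
    using concentration_small[of "1/4"] by auto
  \<comment> \<open>The third ensures h + 2 \<kappa> <= \<kappa>' whenever h <= \<kappa>.\<close>
  define \<kappa> where "\<kappa> = \<kappa>' / 3"
  have \<kappa>: "0 < \<kappa>" using \<kappa>' by (simp add: \<kappa>_def)
  have bd: "emeasure \<mu> {x..x + h} \<le> ennreal (8 * h / \<kappa>)" if h: "0 < h" "h \<le> \<kappa>" for x h
  proof -
    have "concentration h \<le> ennreal (1/4)" using h \<kappa> by (intro \<kappa>'(2)) (simp add: \<kappa>_def)
    then obtain q where q: "concentration h = ennreal q" "0 \<le> q"
      by (cases "concentration h") (auto simp: top_unique)
    have "concentration h \<le> ennreal (4 * h / \<kappa>) + concentration (2 * h) * concentration (h + 2 * \<kappa>)"
      using h \<kappa> by (intro concentration_self_bound) auto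
    also have "\<dots> \<le> ennreal (4 * h / \<kappa>) + (2 * concentration h) * ennreal (1/4)"
      using h by (intro add_mono mult_mono concentration_double \<kappa>'(2)) (auto simp: \<kappa>_def)
    also have "\<dots> = ennreal (4 * h / \<kappa> + q / 2)"
    proof -
      have "(2::ennreal) * ennreal q = ennreal (2 * q)" by (simp add: ennreal_mult')
      then show ?thesis
        using q(2) h \<kappa> unfolding q(1) by (simp add: ennreal_mult'[symmetric] ennreal_plus[symmetric] del: ennreal_plus)
    qed
    finally have "q \<le> 4 * h / \<kappa> + q / 2" unfolding q(1)
      by (rule ennreal_le_iff[THEN iffD1, rotated]) (use q(2) h \<kappa> in auto)
    then have "ennreal q \<le> ennreal (8 * h / \<kappa>)" by (intro ennreal_leI) simp
    then show ?thesis using concentration_upper[of x h] unfolding q(1) by (rule order_trans[rotated])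
  qed
  have "f x \<le> 8 / \<kappa>" for x
  proof (rule ccontr)
    assume "\<not> f x \<le> 8 / \<kappa>"
    then have lt: "8 / \<kappa> < f x" by simp
    define C where "C = (8 / \<kappa> + f x) / 2"
    have C: "8 / \<kappa> < C" "C < f x" using lt by (auto simp: C_def)
    moreover have "0 < 8 / \<kappa>" using \<kappa> by simp
    ultimately have "0 < C" by linarith
    have "isCont f x" using continuous_f[of UNIV] by (simp add: continuous_on_eq_continuous_at)
    then obtain r where r: "0 < r" "\<And>y. \<bar>y - x\<bar> < r \<Longrightarrow> \<bar>f y - f x\<bar> < f x - C"
      using C(2) unfolding continuous_at_eps_delta dist_real_def by (metis diff_gt_0_iff_gt)
    define h where "h = min \<kappa> (r / 2)"
    have h: "0 < h" "h \<le> \<kappa>" "h < r" using \<kappa> r by (auto simp: h_def)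
    have "ennreal (C * h) = (\<integral>\<^sup>+y. ennreal C * indicator {x..x + h} y \<partial>lborel)"
      using h \<open>0 < C\<close> by (subst nn_integral_cmult_indicator) (auto simp: ennreal_mult')
    also have "\<dots> \<le> (\<integral>\<^sup>+y. ennreal (f y) * indicator {x..x + h} y \<partial>lborel)"
    proof (intro nn_integral_mono)
      fix y
      have "C \<le> f y" if "x \<le> y" "y \<le> x + h"
      proof -
        have "\<bar>y - x\<bar> < r" using that h by auto
        from r(2)[OF this] show ?thesis by linarith
      qed
      then show "ennreal C * indicator {x..x + h} y \<le> ennreal (f y) * indicator {x..x + h} y"
        by (auto split: split_indicator intro!: ennreal_leI)
    qed
    also have "\<dots> = emeasure \<mu> {x..x + h}" by (simp add: emeasure_mu)
    also have "\<dots> \<le> ennreal (8 * h / \<kappa>)" by (intro bd h)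
    finally have "C * h \<le> (8 / \<kappa>) * h" using h \<kappa> by (simp add: ennreal_le_iff)
    then have "C \<le> 8 / \<kappa>" using h(1) by (rule mult_right_le_imp_le)
    then show False using C(1) by simp
  qed
  then show ?thesis using \<kappa> by (intro that[of "8 / \<kappa>"]) auto
qed

end

section \<open>Exponential tilting and upper bounds\<close>

text \<open>An elementary majorant for the weight 1/sqrt (u (1 - u)) that Cauchy-Schwarz leaves;
  only its finite integral matters.\<close>

lemma inverse_sqrt_has_integral:
  "((\<lambda>u. 1 / sqrt u + 1 / sqrt (1 - u)) has_integral 4) {0<..<1::real}"
proof -
  define Q where "Q u = 2 * sqrt u - 2 * sqrt (1 - u)" for u :: real
  have "((\<lambda>u. 1 / sqrt u + 1 / sqrt (1 - u)) has_integral (Q 1 - Q 0)) {0..1}"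
  proof (rule fundamental_theorem_of_calculus_interior)
    show "continuous_on {0..1} Q" unfolding Q_def by (intro continuous_intros)
    fix u :: real assume "u \<in> {0<..<1}"
    then have "(Q has_real_derivative 1 / sqrt u + 1 / sqrt (1 - u)) (at u)"
      unfolding Q_def by (auto intro!: derivative_eq_intros simp: field_simps)
    then show "(Q has_vector_derivative 1 / sqrt u + 1 / sqrt (1 - u)) (at u)"
      by (simp add: has_real_derivative_iff_has_vector_derivative)
  qed simp
  then show ?thesis by (simp add: has_integral_Icc_iff_Ioo Q_def)
qed

lemma inverse_sqrt_prod_le:
  assumes "0 < u" "u < (1::real)"
  shows "1 / sqrt (u * (1 - u)) \<le> 1 / sqrt u + 1 / sqrt (1 - u)"
proof -
  have "(sqrt u + sqrt (1 - u))\<^sup>2 = 1 + 2 * (sqrt u * sqrt (1 - u))"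
    using assms by (simp add: power2_sum)
  moreover have "0 \<le> sqrt u * sqrt (1 - u)" using assms by simp
  ultimately have "1\<^sup>2 \<le> (sqrt u + sqrt (1 - u))\<^sup>2" by simp
  then have "1 \<le> sqrt u + sqrt (1 - u)" by (rule power2_le_imp_le) (use assms in simp)
  then have "1 / (sqrt u * sqrt (1 - u)) \<le> (sqrt u + sqrt (1 - u)) / (sqrt u * sqrt (1 - u))"
    using assms by (intro divide_right_mono) auto
  also have "\<dots> = 1 / sqrt u + 1 / sqrt (1 - u)"
    using assms by (simp add: field_simps)
  finally show ?thesis using assms by (simp add: real_sqrt_mult)
qed

context quicksort_density
begin

section \<open>Tilted densities\<close>

text \<open>Left unnormalised: the total mass is \<open>mgf \<mu> s\<close>, and a uniform bound on
  it is a Chernoff bound for \<open>f\<close> itself.\<close>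

definition tilt :: "real \<Rightarrow> real \<Rightarrow> real" where
  "tilt s y = f y * exp (s * y)"

lemma tilt_nonneg: "0 \<le> tilt s y"
  by (simp add: tilt_def f_nonneg)

lemma tilt_measurable [measurable]: "tilt s \<in> borel_measurable borel"
  unfolding tilt_def by measurable

lemma nn_integral_tilt: "(\<integral>\<^sup>+y. ennreal (tilt s y) \<partial>lborel) = mgf \<mu> s"
  unfolding mgf_def by (subst nn_integral_mu) (auto simp: tilt_def ennreal_mult' f_nonneg)

lemma nn_integral_tilt_square_le:
  assumes "\<And>x. f x \<le> M"
  shows "(\<integral>\<^sup>+y. (ennreal (tilt s y))\<^sup>2 \<partial>lborel) \<le> ennreal M * mgf \<mu> (2 * s)"
proof -
  have "(\<integral>\<^sup>+y. (ennreal (tilt s y))\<^sup>2 \<partial>lborel) \<le> (\<integral>\<^sup>+y. ennreal M * ennreal (tilt (2 * s) y) \<partial>lborel)"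
  proof (intro nn_integral_mono)
    fix y
    have "(tilt s y)\<^sup>2 = f y * tilt (2 * s) y"
      by (simp add: tilt_def power2_eq_square exp_add[symmetric] mult_ac)
    also have "\<dots> \<le> M * tilt (2 * s) y" by (intro mult_right_mono assms tilt_nonneg)
    finally show "(ennreal (tilt s y))\<^sup>2 \<le> ennreal M * ennreal (tilt (2 * s) y)"
      by (simp add: ennreal_power ennreal_mult''[symmetric] tilt_nonneg ennreal_leI)
  qed
  also have "\<dots> = ennreal M * mgf \<mu> (2 * s)"
    by (simp add: nn_integral_cmult nn_integral_tilt)
  finally show ?thesis .
qed

text \<open>Along x = u y + (1 - u) z + g(u) the factor exp (s x) splits into tilts with parameters
  s u for y and s (1 - u) for z, times exp (s g(u)).\<close>

definition tilt_conv :: "real \<Rightarrow> real \<Rightarrow> real \<Rightarrow> ennreal" where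
  "tilt_conv s u x = (\<integral>\<^sup>+z. ennreal (tilt (s * (1 - u)) z) *
     ennreal (tilt (s * u) ((x - qs_toll u - (1 - u) * z) / u)) \<partial>lborel)"

lemma tilted_split_density:
  assumes "0 < u" "u < 1"
  shows "ennreal (exp (s * x)) * split_density u x = ennreal (exp (s * qs_toll u) / u) * tilt_conv s u x"
proof -
  have "ennreal (exp (s * x)) * split_density u x = (\<integral>\<^sup>+z. ennreal (exp (s * x)) *
      (ennreal (f z) * ennreal (f ((x - qs_toll u - (1 - u) * z) / u) / u)) \<partial>lborel)"
    unfolding split_density_def by (intro nn_integral_cmult[symmetric]) measurable
  also have "\<dots> = (\<integral>\<^sup>+z. ennreal (exp (s * qs_toll u) / u) * (ennreal (tilt (s * (1 - u)) z) *
     ennreal (tilt (s * u) ((x - qs_toll u - (1 - u) * z) / u))) \<partial>lborel)"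
  proof (intro nn_integral_cong)
    fix z
    define y where "y = (x - qs_toll u - (1 - u) * z) / u"
    have "x = qs_toll u + (1 - u) * z + u * y" using assms by (simp add: y_def)
    then have "s * x = s * (qs_toll u + (1 - u) * z + u * y)" by (rule arg_cong)
    also have "\<dots> = s * qs_toll u + s * (1 - u) * z + s * u * y" by (simp add: algebra_simps)
    finally have "exp (s * x) = exp (s * qs_toll u) * exp (s * (1 - u) * z) * exp (s * u * y)"
      by (simp add: exp_add)
    then have "exp (s * x) * (f z * (f y / u)) = exp (s * qs_toll u) / u * (tilt (s * (1 - u)) z * tilt (s * u) y)"
      by (simp add: tilt_def)
    then show "ennreal (exp (s * x)) * (ennreal (f z) * ennreal (f ((x - qs_toll u - (1 - u) * z) / u) / u)) =
      ennreal (exp (s * qs_toll u) / u) * (ennreal (tilt (s * (1 - u)) z) *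
       ennreal (tilt (s * u) ((x - qs_toll u - (1 - u) * z) / u)))"
      unfolding y_def[symmetric] using assms
      by (simp add: ennreal_mult'[symmetric] f_nonneg tilt_nonneg)
  qed
  also have "\<dots> = ennreal (exp (s * qs_toll u) / u) * tilt_conv s u x"
    unfolding tilt_conv_def by (intro nn_integral_cmult) measurable
  finally show ?thesis .
qed

lemma nn_integral_split_substitution:
  assumes [measurable]: "F \<in> borel_measurable borel" and u: "0 < u" "u < 1"
  shows "(\<integral>\<^sup>+z. F ((x - qs_toll u - (1 - u) * z) / u) \<partial>lborel) = ennreal (u / (1 - u)) * (\<integral>\<^sup>+y. F y \<partial>lborel)"
proof -
  let ?c = "- ((1 - u) / u)" and ?t = "(x - qs_toll u) / u"
  have c: "?c \<noteq> 0" using u by simp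
  have "(\<integral>\<^sup>+y. F y \<partial>lborel) = ennreal \<bar>?c\<bar> * (\<integral>\<^sup>+z. F (?t + ?c * z) \<partial>lborel)"
    by (rule nn_integral_real_affine[OF assms(1) c])
  also have "(\<lambda>z. F (?t + ?c * z)) = (\<lambda>z. F ((x - qs_toll u - (1 - u) * z) / u))"
    using u by (intro ext arg_cong[where f=F]) (simp add: field_simps)
  finally have "ennreal (u / (1 - u)) * (\<integral>\<^sup>+y. F y \<partial>lborel) =
      (ennreal (u / (1 - u)) * ennreal \<bar>?c\<bar>) * (\<integral>\<^sup>+z. F ((x - qs_toll u - (1 - u) * z) / u) \<partial>lborel)"
    by (simp only: mult.assoc)
  also have "ennreal (u / (1 - u)) * ennreal \<bar>?c\<bar> = 1"
    using u by (simp add: ennreal_mult'[symmetric])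
  finally show ?thesis by simp
qed

lemma tilt_conv_le_left:
  assumes u: "0 < u" "u < 1" and S: "\<And>y. tilt (s * u) y \<le> S"
  shows "tilt_conv s u x \<le> ennreal S * mgf \<mu> (s * (1 - u))"
proof -
  have "tilt_conv s u x \<le> (\<integral>\<^sup>+z. ennreal S * ennreal (tilt (s * (1 - u)) z) \<partial>lborel)"
    unfolding tilt_conv_def
    by (intro nn_integral_mono) (subst mult.commute, intro mult_right_mono ennreal_leI S, simp)
  also have "\<dots> = ennreal S * mgf \<mu> (s * (1 - u))"
    by (simp add: nn_integral_cmult nn_integral_tilt)
  finally show ?thesis .
qed

text \<open>Compared with the preceding bound, supremum and total mass change roles. The Jacobian
  u/(1 - u) cancels the weight 1/u of the integral equation, so this form is the one for u near
  0.\<close>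

lemma tilt_conv_le_right:
  assumes u: "0 < u" "u < 1" and S: "\<And>z. tilt (s * (1 - u)) z \<le> S"
  shows "tilt_conv s u x \<le> ennreal S * (ennreal (u / (1 - u)) * mgf \<mu> (s * u))"
proof -
  have "tilt_conv s u x \<le> (\<integral>\<^sup>+z. ennreal S * ennreal (tilt (s * u) ((x - qs_toll u - (1 - u) * z) / u)) \<partial>lborel)"
    unfolding tilt_conv_def
    by (intro nn_integral_mono mult_right_mono ennreal_leI S) simp
  also have "\<dots> = ennreal S * (\<integral>\<^sup>+z. ennreal (tilt (s * u) ((x - qs_toll u - (1 - u) * z) / u)) \<partial>lborel)"
    by (intro nn_integral_cmult) measurable
  also have "(\<integral>\<^sup>+z. ennreal (tilt (s * u) ((x - qs_toll u - (1 - u) * z) / u)) \<partial>lborel) =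
      ennreal (u / (1 - u)) * mgf \<mu> (s * u)"
    by (subst nn_integral_split_substitution[where F="\<lambda>y. ennreal (tilt (s * u) y)"]) (use u in \<open>auto simp: nn_integral_tilt\<close>)
  finally show ?thesis .
qed

text \<open>The bound f <= M makes a tilt square integrable, at the price of doubling its parameter
  in the moment generating function.\<close>

lemma tilt_conv_le_Cauchy_Schwarz:
  assumes u: "0 < u" "u < 1" and M: "\<And>x. f x \<le> M" "0 \<le> M"
    and B: "mgf \<mu> (2 * (s * u)) * mgf \<mu> (2 * (s * (1 - u))) \<le> ennreal (B\<^sup>2)" "0 \<le> B"
  shows "tilt_conv s u x \<le> ennreal (M * B * sqrt (u / (1 - u)))"
proof -
  let ?y = "\<lambda>z. (x - qs_toll u - (1 - u) * z) / u"
  have "(tilt_conv s u x)\<^sup>2 \<le> (\<integral>\<^sup>+z. (ennreal (tilt (s * (1 - u)) z))\<^sup>2 \<partial>lborel) *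
      (\<integral>\<^sup>+z. (ennreal (tilt (s * u) (?y z)))\<^sup>2 \<partial>lborel)"
    unfolding tilt_conv_def by (intro Cauchy_Schwarz_nn_integral) measurable
  also have "(\<integral>\<^sup>+z. (ennreal (tilt (s * u) (?y z)))\<^sup>2 \<partial>lborel) =
      ennreal (u / (1 - u)) * (\<integral>\<^sup>+y. (ennreal (tilt (s * u) y))\<^sup>2 \<partial>lborel)"
    by (rule nn_integral_split_substitution[where F="\<lambda>y. (ennreal (tilt (s * u) y))\<^sup>2"]) (use u in auto)
  also have "(\<integral>\<^sup>+z. (ennreal (tilt (s * (1 - u)) z))\<^sup>2 \<partial>lborel) *
      (ennreal (u / (1 - u)) * (\<integral>\<^sup>+y. (ennreal (tilt (s * u) y))\<^sup>2 \<partial>lborel)) \<le>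
      (ennreal M * mgf \<mu> (2 * (s * (1 - u)))) * (ennreal (u / (1 - u)) * (ennreal M * mgf \<mu> (2 * (s * u))))"
    by (intro mult_mono nn_integral_tilt_square_le M) auto
  also have "\<dots> = ennreal (M\<^sup>2 * (u / (1 - u))) * (mgf \<mu> (2 * (s * u)) * mgf \<mu> (2 * (s * (1 - u))))"
  proof -
    have "ennreal (M\<^sup>2 * (u / (1 - u))) = ennreal M * ennreal (u / (1 - u)) * ennreal M"
      using M u by (simp add: ennreal_mult'[symmetric] power2_eq_square mult_ac)
    then show ?thesis by (simp add: mult_ac)
  qed
  also have "\<dots> \<le> ennreal (M\<^sup>2 * (u / (1 - u))) * ennreal (B\<^sup>2)" by (intro mult_left_mono B) auto
  also have "\<dots> = (ennreal (M * B * sqrt (u / (1 - u))))\<^sup>2"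
    using M u B by (simp add: ennreal_power ennreal_mult'[symmetric] power_mult_distrib mult_ac)
  finally have le: "(tilt_conv s u x)\<^sup>2 \<le> (ennreal (M * B * sqrt (u / (1 - u))))\<^sup>2" .
  have nonneg: "0 \<le> M * B * sqrt (u / (1 - u))" using M B u by simp
  show ?thesis
  proof (cases "tilt_conv s u x")
    case (real r)
    have "ennreal (r\<^sup>2) \<le> ennreal ((M * B * sqrt (u / (1 - u)))\<^sup>2)"
      using le nonneg unfolding real(2) ennreal_power[OF nonneg] ennreal_power[OF real(1)] by simp
    then have "r\<^sup>2 \<le> (M * B * sqrt (u / (1 - u)))\<^sup>2"
      by (rule ennreal_le_iff[THEN iffD1, rotated]) simp
    then show ?thesis unfolding real(2) using nonneg by (rule ennreal_leI[OF power2_le_imp_le])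
  next
    case top
    then show ?thesis using le unfolding ennreal_power[OF nonneg] by (simp add: power2_eq_square top_unique)
  qed
qed

text \<open>Multiplies the integral equation by exp (s x); the majorant K exp (-s x) is continuous,
  so the almost everywhere bound holds at every x.\<close>

lemma tilt_le_of_integral:
  assumes "\<And>x. (\<integral>\<^sup>+u. indicator {0<..<1} u * (ennreal (exp (s * qs_toll u) / u) * tilt_conv s u x) \<partial>lborel) \<le> ennreal K" "0 \<le> K"
  shows "tilt s x \<le> K"
proof -
  have "f x \<le> K * exp (- (s * x))"
  proof (rule density_le)
    show "continuous_on UNIV (\<lambda>x. K * exp (- (s * x)))" by (intro continuous_intros)
    fix x
    show "0 \<le> K * exp (- (s * x))" using assms(2) by simp
    have "ennreal (exp (s * x)) * (\<integral>\<^sup>+u. indicator {0<..<1} u * split_density u x \<partial>lborel) =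
      (\<integral>\<^sup>+u. ennreal (exp (s * x)) * (indicator {0<..<1} u * split_density u x) \<partial>lborel)"
      by (intro nn_integral_cmult[symmetric]) measurable
    also have "\<dots> = (\<integral>\<^sup>+u. indicator {0<..<1} u * (ennreal (exp (s * qs_toll u) / u) * tilt_conv s u x) \<partial>lborel)"
      by (intro nn_integral_cong) (auto split: split_indicator simp: tilted_split_density)
    also have "\<dots> \<le> ennreal K" by (rule assms(1))
    finally have "ennreal (exp (- (s * x))) * (ennreal (exp (s * x)) * (\<integral>\<^sup>+u. indicator {0<..<1} u * split_density u x \<partial>lborel))
      \<le> ennreal (exp (- (s * x))) * ennreal K"
      by (rule mult_left_mono) simp
    then show "(\<integral>\<^sup>+u. indicator {0<..<1} u * split_density u x \<partial>lborel) \<le> ennreal (K * exp (- (s * x)))"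
      using assms(2) by (simp add: mult.assoc[symmetric] ennreal_mult'[symmetric] exp_minus mult.commute)
  qed
  then have "f x * exp (s * x) \<le> K * exp (- (s * x)) * exp (s * x)" by (rule mult_right_mono) simp
  also have "K * exp (- (s * x)) * exp (s * x) = K" by (simp add: mult.assoc exp_add[symmetric])
  finally show ?thesis by (simp add: tilt_def)
qed

text \<open>The factor exp |s| comes from |g| <= 1, and 4 from the integral of the majorant of (1/u)
  sqrt (u/(1 - u)) = 1/sqrt (u (1 - u)).\<close>

lemma tilt_le_Cauchy_Schwarz:
  assumes M: "\<And>x. f x \<le> M" "0 \<le> M" and "0 \<le> B"
    and B: "\<And>u. 0 < u \<Longrightarrow> u < 1 \<Longrightarrow> mgf \<mu> (2 * (s * u)) * mgf \<mu> (2 * (s * (1 - u))) \<le> ennreal (B\<^sup>2)"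
  shows "tilt s x \<le> 4 * (exp \<bar>s\<bar> * M * B)"
proof (rule tilt_le_of_integral)
  fix x
  have "(\<integral>\<^sup>+u. indicator {0<..<1} u * (ennreal (exp (s * qs_toll u) / u) * tilt_conv s u x) \<partial>lborel) \<le>
    (\<integral>\<^sup>+u. ennreal (exp \<bar>s\<bar> * M * B) * (ennreal (1 / sqrt u + 1 / sqrt (1 - u)) * indicator {0<..<1} u) \<partial>lborel)"
  proof (intro nn_integral_mono)
    fix u :: real
    have "ennreal (exp (s * qs_toll u) / u) * tilt_conv s u x \<le>
        ennreal (exp \<bar>s\<bar> * M * B) * ennreal (1 / sqrt u + 1 / sqrt (1 - u))" if u: "0 < u" "u < 1"
    proof -
      have "ennreal (exp (s * qs_toll u) / u) * tilt_conv s u x \<le>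
          ennreal (exp \<bar>s\<bar> / u) * ennreal (M * B * sqrt (u / (1 - u)))"
      proof (intro mult_mono ennreal_leI divide_right_mono tilt_conv_le_Cauchy_Schwarz)
        have "\<bar>s * qs_toll u\<bar> \<le> \<bar>s\<bar>"
          unfolding abs_mult using abs_qs_toll_le_one[OF u] by (simp add: mult_left_le)
        then show "exp (s * qs_toll u) \<le> exp \<bar>s\<bar>" by simp
      qed (use u M \<open>0 \<le> B\<close> B in auto)
      also have "\<dots> = ennreal (exp \<bar>s\<bar> * M * B * (1 / sqrt (u * (1 - u))))"
      proof -
        have "sqrt (u / (1 - u)) / u = 1 / sqrt (u * (1 - u))"
        proof -
          have "a / b / (a * a) = 1 / (a * b)" if "0 < a" "0 < b" for a b :: real
            using that by (simp add: field_simps)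
          from this[of "sqrt u" "sqrt (1 - u)"] show ?thesis
            using u by (simp add: real_sqrt_divide real_sqrt_mult)
        qed
        then have "exp \<bar>s\<bar> / u * (M * B * sqrt (u / (1 - u))) = exp \<bar>s\<bar> * M * B * (1 / sqrt (u * (1 - u)))"
          by (metis mult.assoc times_divide_eq_left times_divide_eq_right mult.commute)
        then show ?thesis using u by (simp add: ennreal_mult'[symmetric])
      qed
      also have "\<dots> \<le> ennreal (exp \<bar>s\<bar> * M * B * (1 / sqrt u + 1 / sqrt (1 - u)))"
        using u M \<open>0 \<le> B\<close> inverse_sqrt_prod_le[of u] by (intro ennreal_leI mult_left_mono) auto
      also have "\<dots> = ennreal (exp \<bar>s\<bar> * M * B) * ennreal (1 / sqrt u + 1 / sqrt (1 - u))"
        using M \<open>0 \<le> B\<close> by (intro ennreal_mult') auto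
      finally show ?thesis .
    qed
    then show "indicator {0<..<1} u * (ennreal (exp (s * qs_toll u) / u) * tilt_conv s u x) \<le>
      ennreal (exp \<bar>s\<bar> * M * B) * (ennreal (1 / sqrt u + 1 / sqrt (1 - u)) * indicator {0<..<1} u)"
      by (auto split: split_indicator)
  qed
  also have "\<dots> = ennreal (exp \<bar>s\<bar> * M * B) * (\<integral>\<^sup>+u. ennreal (1 / sqrt u + 1 / sqrt (1 - u)) * indicator {0<..<1} u \<partial>lborel)"
    by (intro nn_integral_cmult) measurable
  also have "(\<integral>\<^sup>+u. ennreal (1 / sqrt u + 1 / sqrt (1 - u)) * indicator {0<..<1::real} u \<partial>lborel) = ennreal 4"
    by (intro nn_integral_has_integral_lebesgue' inverse_sqrt_has_integral) auto
  also have "ennreal (exp \<bar>s\<bar> * M * B) * ennreal 4 = ennreal (4 * (exp \<bar>s\<bar> * M * B))"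
    using M \<open>0 \<le> B\<close> by (subst ennreal_mult'[symmetric]) (auto simp: mult.commute)
  finally show "(\<integral>\<^sup>+u. indicator {0<..<1} u * (ennreal (exp (s * qs_toll u) / u) * tilt_conv s u x) \<partial>lborel)
    \<le> ennreal (4 * (exp \<bar>s\<bar> * M * B))" .
qed (use assms in auto)

section \<open>Left-tail upper bound\<close>

lemma left_tail_upper_bound:
  obtains h where "\<forall>\<^sub>F x in at_top. f (- x) \<le> exp (- exp (qs_gamma * x + h))"
proof -
  obtain M where M: "0 < M" "\<And>x. f x \<le> M" using density_bounded by blast
  obtain c d where cd: "\<And>t. 0 < t \<Longrightarrow> mgf \<mu> (- t) \<le> ennreal (exp (t * ln t / qs_gamma + c * t + d))"
    using mgf_mu_left by blast
  note \<gamma> = qs_gamma_pos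
  \<comment> \<open>The doubled parameters 2tu and 2t(1 - u) sum to 2t, and ln is at most ln (2t) on
    both; the square root halves the total, so the net loss is t ln 2 / \<gamma>.\<close>
  have tilt_bound: "tilt (- t) x \<le> 4 * (exp t * M * exp (t * ln (2 * t) / qs_gamma + c * t + d))" if t: "0 < t" for t x
  proof -
    have "mgf \<mu> (2 * (- t * u)) * mgf \<mu> (2 * (- t * (1 - u))) \<le>
        ennreal ((exp (t * ln (2 * t) / qs_gamma + c * t + d))\<^sup>2)" if u: "0 < u" "u < 1" for u
    proof -
      have part: "v * t * ln (2 * (t * v)) \<le> v * t * ln (2 * t)" if "0 < v" "v < 1" for v
        using that t by (intro mult_left_mono) (auto simp: mult_left_le)
      have "2 * (t * u) * ln (2 * (t * u)) + 2 * (t * (1 - u)) * ln (2 * (t * (1 - u))) \<le>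
          2 * (u * t * ln (2 * t)) + 2 * ((1 - u) * t * ln (2 * t))"
      proof -
        have "2 * (t * u) * ln (2 * (t * u)) = 2 * (u * t * ln (2 * (t * u)))"
          "2 * (t * (1 - u)) * ln (2 * (t * (1 - u))) = 2 * ((1 - u) * t * ln (2 * (t * (1 - u))))"
          by (simp_all only: mult_ac)
        then show ?thesis using part[OF u] part[of "1 - u"] u by linarith
      qed
      also have "\<dots> = 2 * (t * ln (2 * t))" by (simp add: algebra_simps)
      finally have "(2 * (t * u) * ln (2 * (t * u)) + 2 * (t * (1 - u)) * ln (2 * (t * (1 - u)))) / qs_gamma \<le>
          2 * (t * ln (2 * t)) / qs_gamma"
        using \<gamma> by (intro divide_right_mono) auto
      note le = this
      have exponent: "(2 * (t * u) * ln (2 * (t * u)) / qs_gamma + c * (2 * (t * u)) + d) +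
          (2 * (t * (1 - u)) * ln (2 * (t * (1 - u))) / qs_gamma + c * (2 * (t * (1 - u))) + d) \<le>
          2 * (t * ln (2 * t) / qs_gamma + c * t + d)"
      proof -
        have lin: "(a1 + b1 + d) + (a2 + b2 + d) \<le> 2 * (T + K + d)"
          if "a1 + a2 \<le> 2 * T" "b1 + b2 = 2 * K" for a1 a2 b1 b2 T K :: real
          using that by simp
        show ?thesis
        proof (rule lin)
          show "2 * (t * u) * ln (2 * (t * u)) / qs_gamma + 2 * (t * (1 - u)) * ln (2 * (t * (1 - u))) / qs_gamma
              \<le> 2 * (t * ln (2 * t) / qs_gamma)"
            using le by (simp only: add_divide_distrib times_divide_eq_right)
          show "c * (2 * (t * u)) + c * (2 * (t * (1 - u))) = 2 * (c * t)" by (simp add: algebra_simps)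
        qed
      qed
      have "mgf \<mu> (- (2 * (t * u))) * mgf \<mu> (- (2 * (t * (1 - u)))) \<le>
        ennreal (exp (2 * (t * u) * ln (2 * (t * u)) / qs_gamma + c * (2 * (t * u)) + d)) *
        ennreal (exp (2 * (t * (1 - u)) * ln (2 * (t * (1 - u))) / qs_gamma + c * (2 * (t * (1 - u))) + d))"
        using t u by (intro mult_mono cd) auto
      also have "\<dots> \<le> ennreal (exp (2 * (t * ln (2 * t) / qs_gamma + c * t + d)))"
        using exponent by (subst ennreal_mult'[symmetric], simp) (simp only: exp_add[symmetric] exp_le_cancel_iff ennreal_leI)
      also have "exp (2 * (t * ln (2 * t) / qs_gamma + c * t + d)) = (exp (t * ln (2 * t) / qs_gamma + c * t + d))\<^sup>2"
        by (rule exp_double)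
      finally show ?thesis by simp
    qed
    from tilt_le_Cauchy_Schwarz[OF M(2) _ _ this, of x] show ?thesis using M t by simp
  qed
  define k where "k = - (qs_gamma * (c + 1)) - 1 - ln (2 * qs_gamma)"
  have bound: "f (- x) \<le> exp (ln (4 * M) + d - exp (qs_gamma * x + k))" for x
  proof -
    \<comment> \<open>The minimiser of t + t ln (2t)/\<gamma> + c t - t x; its minimum is
      -t/\<gamma>.\<close>
    define t where "t = exp (qs_gamma * (x - c - 1) - 1) / 2"
    have t: "0 < t" "ln (2 * t) = qs_gamma * (x - c - 1) - 1" by (auto simp: t_def)
    have "t / qs_gamma = exp (qs_gamma * (x - c - 1) - 1 - ln (2 * qs_gamma))"
      using \<gamma> by (simp add: t_def exp_diff)
    also have "qs_gamma * (x - c - 1) - 1 - ln (2 * qs_gamma) = qs_gamma * x + k"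
      by (simp add: k_def algebra_simps)
    finally have tk: "t / qs_gamma = exp (qs_gamma * x + k)" .
    have "f (- x) * exp (t * x) \<le> 4 * (exp t * M * exp (t * ln (2 * t) / qs_gamma + c * t + d))"
      using tilt_bound[OF t(1), of "- x"] by (simp add: tilt_def)
    also have "\<dots> = exp (ln (4 * M) + t + (t * ln (2 * t) / qs_gamma + c * t + d))"
      using M by (simp add: exp_add)
    finally have "f (- x) * exp (t * x) * exp (- (t * x)) \<le>
        exp (ln (4 * M) + t + (t * ln (2 * t) / qs_gamma + c * t + d)) * exp (- (t * x))"
      by (rule mult_right_mono) simp
    also have "f (- x) * exp (t * x) * exp (- (t * x)) = f (- x)"
      by (simp add: mult.assoc exp_add[symmetric])
    also have "exp (ln (4 * M) + t + (t * ln (2 * t) / qs_gamma + c * t + d)) * exp (- (t * x)) =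
        exp (ln (4 * M) + t + (t * ln (2 * t) / qs_gamma + c * t + d) - t * x)"
      by (simp add: exp_add[symmetric])
    finally have "f (- x) \<le> exp (ln (4 * M) + t + (t * ln (2 * t) / qs_gamma + c * t + d) - t * x)" .
    also have "ln (4 * M) + t + (t * ln (2 * t) / qs_gamma + c * t + d) - t * x = ln (4 * M) + d - t / qs_gamma"
      unfolding t(2) using \<gamma> by (simp add: field_simps)
    finally show ?thesis unfolding tk .
  qed
  \<comment> \<open>The additive constant is absorbed by half of the double exponential, which only
    shifts the inner constant by ln 2.\<close>
  have "\<forall>\<^sub>F x in at_top. ln (4 * M) + d \<le> exp (qs_gamma * x + k) / 2"
    using \<gamma> by real_asymp
  then have "\<forall>\<^sub>F x in at_top. f (- x) \<le> exp (- exp (qs_gamma * x + (k - ln 2)))"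
  proof eventually_elim
    case (elim x)
    have "exp (qs_gamma * x + (k - ln 2)) = exp (qs_gamma * x + k) / 2"
      by (simp add: exp_add exp_diff)
    then show ?case using bound[of x] elim by (elim order_trans) simp
  qed
  then show ?thesis by (rule that)
qed

section \<open>Right-tail upper bound\<close>

lemma mgf_exponent_mono: "0 \<le> s \<Longrightarrow> s \<le> t \<Longrightarrow> mgf_exponent s \<le> mgf_exponent t"
proof -
  assume st: "0 \<le> s" "s \<le> t"
  have "exp s * (1 + (t - s)) \<le> exp s * exp (t - s)"
    by (intro mult_left_mono exp_ge_add_one_self) auto
  also have "\<dots> = exp t" by (simp add: exp_add[symmetric])
  finally have "exp s + exp s * (t - s) \<le> exp t" by (simp add: algebra_simps)
  moreover have "1 * (t - s) \<le> exp s * (t - s)" using st by (intro mult_right_mono) auto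
  ultimately show ?thesis using st by (simp add: mgf_exponent_def)
qed

lemma mgf_mu_le_mono:
  assumes "0 \<le> s" "s \<le> t"
  shows "mgf \<mu> s \<le> ennreal (exp (mgf_exponent t))"
  using mgf_mu_le[of s] mgf_exponent_mono[OF assms] by (elim order_trans) (simp add: ennreal_leI)

text \<open>Its exponent is of order exp (2t), too large for the final bound. It serves twice: it
  makes the supremum of the tilt finite, so that it can be absorbed, and at tilts up to t/2 it
  already has the right order.\<close>

lemma tilt_right_crude:
  assumes M: "\<And>x. f x \<le> M" "0 \<le> M" and t: "0 \<le> t"
  shows "tilt t x \<le> 4 * (exp t * M * exp (mgf_exponent (2 * t)))"
proof -
  have "mgf \<mu> (2 * (t * u)) * mgf \<mu> (2 * (t * (1 - u))) \<le> ennreal ((exp (mgf_exponent (2 * t)))\<^sup>2)"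
    if u: "0 < u" "u < 1" for u
  proof -
    have "mgf \<mu> (2 * (t * u)) * mgf \<mu> (2 * (t * (1 - u))) \<le>
        ennreal (exp (mgf_exponent (2 * t))) * ennreal (exp (mgf_exponent (2 * t)))"
      using t u by (intro mult_mono mgf_mu_le_mono) (auto simp: mult_left_le)
    then show ?thesis by (simp add: power2_eq_square ennreal_mult')
  qed
  from tilt_le_Cauchy_Schwarz[OF M _ this, of x] show ?thesis using t by simp
qed

text \<open>Cauchy--Schwarz alone loses a factor of two in \<open>t\<close> near \<open>u = 0\<close> and \<open>u = 1\<close>.  There the
  supremum of the tilted density itself is used; it enters with a small factor because the
  range of \<open>u\<close> is short, and can be absorbed since it is already known to be finite.\<close>

lemma tilt_right_bound:
  assumes M: "\<And>x. f x \<le> M" "0 \<le> M" and t: "0 \<le> t"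
  shows "tilt t x \<le> M + 64 * exp (mgf_exponent 1) * M * exp (3 * t) * (exp (mgf_exponent t))\<^sup>2"
proof -
  define H where "H = exp (mgf_exponent t)"
  define C where "C = exp (mgf_exponent 1)"
  define S where "S = 4 * (exp t * M * H)"
  \<comment> \<open>Makes the end pieces contribute P (2 \<epsilon>) = (M + A)/2, half of the
    unknown supremum. Moreover t \<epsilon> <= 1, so moment generating functions at tilts up to t
    \<epsilon> are bounded by the constant \<open>C\<close>.\<close>
  define \<epsilon> where "\<epsilon> = exp (- t) / (8 * C)"
  define A where "A = (SUP y. tilt t y)"
  have C1: "1 \<le> C" using exp_ge_add_one_self[of 1] by (simp add: C_def mgf_exponent_def)
  have H: "0 < H" "0 < C" by (simp_all add: H_def C_def)
  have S0: "0 \<le> S" using M(2) H by (simp add: S_def)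
  have \<epsilon>: "0 < \<epsilon>" "\<epsilon> \<le> 1/8"
  proof -
    show "0 < \<epsilon>" using H by (simp add: \<epsilon>_def)
    have "\<epsilon> \<le> 1 / (8 * 1)" unfolding \<epsilon>_def using C1 t by (intro frac_le) auto
    then show "\<epsilon> \<le> 1/8" by simp
  qed
  have t\<epsilon>: "t * \<epsilon> \<le> 1"
  proof -
    have "t \<le> exp t" using exp_ge_add_one_self[of t] by linarith
    then have "t * exp (- t) \<le> 1" by (simp add: exp_minus field_simps)
    also have "1 \<le> 8 * C" using C1 by simp
    finally show ?thesis using H by (simp add: \<epsilon>_def)
  qed
  have bdd: "bdd_above (range (tilt t))"
    using tilt_right_crude[OF M t] by (auto intro!: bdd_aboveI2)
  have tilt_A: "tilt t y \<le> A" for y unfolding A_def by (intro cSUP_upper bdd) auto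
  have A0: "0 \<le> A" using tilt_A[of 0] tilt_nonneg[of t 0] by linarith
  \<comment> \<open>A fractional tilt is below the full one for y >= 0 and below \<open>f\<close>
    for y < 0.\<close>
  have tilt_frac: "tilt (t * v) y \<le> M + A" if "0 \<le> v" "v \<le> 1" for v y
  proof (cases "0 \<le> y")
    case True
    have "tilt (t * v) y \<le> tilt t y"
      unfolding tilt_def using True that t by (intro mult_left_mono f_nonneg) (auto simp: mult_left_le mult_right_mono)
    then show ?thesis using tilt_A[of y] M(2) by linarith
  next
    case False
    then have "t * v * y \<le> 0" using that t by (intro mult_nonneg_nonpos mult_nonneg_nonneg) auto
    then have "tilt (t * v) y \<le> f y" unfolding tilt_def by (intro mult_left_le f_nonneg) auto
    then show ?thesis using M(1)[of y] A0 by linarith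
  qed
  have tilt_S: "tilt (t * v) y \<le> S" if v: "0 \<le> v" "v \<le> 1/2" for v y
  proof -
    have "t * v \<le> t / 2" using mult_left_mono[OF v(2) t] by simp
    then have "mgf_exponent (2 * (t * v)) \<le> mgf_exponent t" using t v by (intro mgf_exponent_mono) auto
    moreover have "exp (t * v) \<le> exp t" using t v \<open>t * v \<le> t / 2\<close> by simp
    ultimately have "4 * (exp (t * v) * M * exp (mgf_exponent (2 * (t * v)))) \<le> S"
      unfolding S_def H_def using M(2) by (intro mult_left_mono mult_mono) auto
    then show ?thesis using tilt_right_crude[OF M, of "t * v" y] t v by simp
  qed
  have mgf_C: "mgf \<mu> (t * v) \<le> ennreal C" if "0 \<le> v" "v \<le> \<epsilon>" for v
    unfolding C_def using that t t\<epsilon> mult_left_mono[OF that(2) t] by (intro mgf_mu_le_mono) auto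
  have mgf_H: "mgf \<mu> (t * v) \<le> ennreal H" if "0 \<le> v" "v \<le> 1" for v
    unfolding H_def using that t by (intro mgf_mu_le_mono) (auto simp: mult_left_le)
  define P where "P = exp t * (2 * (M + A) * C)"
  define R where "R = exp t * (S * H / \<epsilon>)"
  have P0: "0 \<le> P" "0 \<le> R" using M(2) A0 H S0 \<epsilon> by (auto simp: P_def R_def)
  have pointwise: "ennreal (exp (t * qs_toll u) / u) * tilt_conv t u x \<le>
      ennreal P * indicator ({0<..<\<epsilon>} \<union> {1 - \<epsilon><..<1}) u + ennreal R" if u: "0 < u" "u < 1" for u x
  proof -
    have left: "ennreal (exp (t * qs_toll u) / u) * tilt_conv t u x \<le> ennreal (exp t * (a * b / l))"
      if "\<And>y. tilt (t * u) y \<le> a" "mgf \<mu> (t * (1 - u)) \<le> ennreal b" "l \<le> u" "0 < l" "0 \<le> a" "0 \<le> b" for a b l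
    proof -
      have "ennreal (exp (t * qs_toll u) / u) * tilt_conv t u x \<le> ennreal (exp t / l) * (ennreal a * ennreal b)"
      proof (intro mult_mono ennreal_leI frac_le)
        show "tilt_conv t u x \<le> ennreal a * ennreal b"
          by (rule order_trans[OF tilt_conv_le_left[OF u that(1)]]) (intro mult_left_mono that(2), simp)
        show "exp (t * qs_toll u) \<le> exp t" using qs_toll_le_one[OF u] t by (simp add: mult_left_le)
      qed (use that in auto)
      also have "\<dots> = ennreal (exp t * (a * b / l))"
        using that by (simp add: ennreal_mult'[symmetric])
      finally show ?thesis .
    qed
    have right: "ennreal (exp (t * qs_toll u) / u) * tilt_conv t u x \<le> ennreal (exp t * (a * b / l))"
      if "\<And>y. tilt (t * (1 - u)) y \<le> a" "mgf \<mu> (t * u) \<le> ennreal b" "l \<le> 1 - u" "0 < l" "0 \<le> a" "0 \<le> b" for a b l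
    proof -
      have "ennreal (exp (t * qs_toll u) / u) * tilt_conv t u x \<le>
          ennreal (exp t / u) * (ennreal a * (ennreal (u / (1 - u)) * ennreal b))"
      proof (intro mult_mono ennreal_leI divide_right_mono)
        show "tilt_conv t u x \<le> ennreal a * (ennreal (u / (1 - u)) * ennreal b)"
          by (rule order_trans[OF tilt_conv_le_right[OF u that(1)]]) (intro mult_left_mono that(2); simp)
        show "exp (t * qs_toll u) \<le> exp t" using qs_toll_le_one[OF u] t by (simp add: mult_left_le)
      qed (use u in auto)
      also have "\<dots> = ennreal (exp t * (a * b / (1 - u)))"
        using that u by (simp add: ennreal_mult'[symmetric] field_simps)
      also have "\<dots> \<le> ennreal (exp t * (a * b / l))"
        using that u by (intro ennreal_leI mult_left_mono divide_left_mono) auto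
      finally show ?thesis .
    qed
    \<comment> \<open>Near the ends the supremum is taken of the factor with almost the full tilt
      and the mass of the one with tilt below t \<epsilon>. In the middle the supremum is taken of
      the factor with tilt at most t/2, where the crude bound \<open>S\<close> applies.\<close>
    consider "u < \<epsilon>" | "\<epsilon> \<le> u" "u \<le> 1/2" | "1/2 < u" "u \<le> 1 - \<epsilon>" | "1 - \<epsilon> < u" by linarith
    then show ?thesis
    proof cases
      case 1
      then have "ennreal (exp (t * qs_toll u) / u) * tilt_conv t u x \<le> ennreal (exp t * ((M + A) * C / (1/2)))"
        using u \<epsilon> M(2) A0 H by (intro right tilt_frac mgf_C) auto
      then show ?thesis using 1 u by (auto simp: P_def mult_ac intro!: add_increasing2)
    next
      case 2
      then have "ennreal (exp (t * qs_toll u) / u) * tilt_conv t u x \<le> ennreal (exp t * (S * H / \<epsilon>))"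
        using u \<epsilon> S0 H by (intro left tilt_S mgf_H) auto
      then show ?thesis unfolding R_def[symmetric] by (rule add_increasing[rotated]) simp
    next
      case 3
      then have "ennreal (exp (t * qs_toll u) / u) * tilt_conv t u x \<le> ennreal (exp t * (S * H / \<epsilon>))"
        using u \<epsilon> S0 H by (intro right tilt_S mgf_H) auto
      then show ?thesis unfolding R_def[symmetric] by (rule add_increasing[rotated]) simp
    next
      case 4
      then have "ennreal (exp (t * qs_toll u) / u) * tilt_conv t u x \<le> ennreal (exp t * ((M + A) * C / (1/2)))"
        using u \<epsilon> M(2) A0 H by (intro left tilt_frac mgf_C) auto
      then show ?thesis using 4 u by (auto simp: P_def mult_ac intro!: add_increasing2)
    qed
  qed
  have "tilt t x \<le> P * (2 * \<epsilon>) + R" for x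
  proof (rule tilt_le_of_integral)
    fix x
    have "(\<integral>\<^sup>+u. indicator {0<..<1} u * (ennreal (exp (t * qs_toll u) / u) * tilt_conv t u x) \<partial>lborel) \<le>
      (\<integral>\<^sup>+u. ennreal P * indicator ({0<..<\<epsilon>} \<union> {1 - \<epsilon><..<1}) u + ennreal R * indicator {0<..<1} u \<partial>lborel)"
      using pointwise by (intro nn_integral_mono) (auto split: split_indicator_asm simp: indicator_def[of "{0<..<1}"])
    also have "\<dots> = ennreal P * emeasure lborel ({0<..<\<epsilon>} \<union> {1 - \<epsilon><..<1}) + ennreal R * emeasure lborel {0<..<1::real}"
      by (subst nn_integral_add) (auto simp: nn_integral_cmult_indicator)
    also have "emeasure lborel ({0<..<\<epsilon>} \<union> {1 - \<epsilon><..<1}) \<le> emeasure lborel {0<..<\<epsilon>} + emeasure lborel {1 - \<epsilon><..<1}"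
      by (intro emeasure_subadditive) auto
    also have "\<dots> = ennreal (2 * \<epsilon>)"
      using \<epsilon> by (simp add: ennreal_plus[symmetric] del: ennreal_plus)
    finally have "(\<integral>\<^sup>+u. indicator {0<..<1} u * (ennreal (exp (t * qs_toll u) / u) * tilt_conv t u x) \<partial>lborel) \<le>
      ennreal P * ennreal (2 * \<epsilon>) + ennreal R * emeasure lborel {0<..<1::real}"
      by (simp add: add_mono mult_left_mono)
    then show "(\<integral>\<^sup>+u. indicator {0<..<1} u * (ennreal (exp (t * qs_toll u) / u) * tilt_conv t u x) \<partial>lborel) \<le>
      ennreal (P * (2 * \<epsilon>) + R)"
      using P0 \<epsilon> by (simp add: ennreal_mult'[symmetric] ennreal_plus[symmetric] del: ennreal_plus)
  qed (use P0 \<epsilon> in auto)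
  moreover have "P * (2 * \<epsilon>) = (M + A) / 2"
    using H by (simp add: P_def \<epsilon>_def exp_minus field_simps)
  ultimately have "tilt t x \<le> (M + A) / 2 + R" for x by simp
  then have "A \<le> (M + A) / 2 + R" unfolding A_def by (intro cSUP_least) auto
  then have "A * 2 \<le> M + A + 2 * R" by (simp add: field_simps)
  then have "A \<le> M + 2 * R" by (simp add: algebra_simps)
  also have "R = 32 * C * M * exp (3 * t) * H\<^sup>2"
  proof -
    have "exp (3 * t) = exp t * exp t * exp t" by (simp add: exp_add[symmetric])
    moreover have "1 / \<epsilon> = 8 * C * exp t" using H by (simp add: \<epsilon>_def exp_minus field_simps)
    then have "S * H / \<epsilon> = S * H * (8 * C * exp t)" by (metis divide_inverse inverse_eq_divide)
    ultimately show ?thesis by (simp add: R_def S_def power2_eq_square mult_ac)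
  qed
  finally show ?thesis using tilt_A[of x] by (simp add: C_def H_def)
qed

text \<open>At t = ln x the tilting factor is exp (x ln x), while the squared moment bound is at
  most exp (200 exp t) = exp (200 x) and exp (3 t) is only a power of x.\<close>

lemma right_tail_upper_bound:
  obtains h where "h \<in> O[at_top](\<lambda>x. x)" "\<forall>\<^sub>F x in at_top. f x \<le> exp (- x * ln x + h x)"
proof -
  obtain M where M: "0 < M" "\<And>x. f x \<le> M" using density_bounded by blast
  define D where "D = M + 64 * exp (mgf_exponent 1) * M"
  have D: "0 < D" unfolding D_def using M by (intro add_pos_pos mult_pos_pos) auto
  define h where "h x = ln D + 3 * ln x + 200 * x" for x :: real
  have "h \<in> O[at_top](\<lambda>x. x)" unfolding h_def by real_asymp
  moreover have "\<forall>\<^sub>F x in at_top. f x \<le> exp (- x * ln x + h x)"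
    using eventually_ge_at_top[of 1]
  proof eventually_elim
    case (elim x)
    define t where "t = ln x"
    have t: "0 \<le> t" "exp t = x" using elim by (auto simp: t_def)
    have le: "(exp (mgf_exponent t))\<^sup>2 \<le> exp (200 * x)"
      using t by (simp add: exp_double[symmetric] mgf_exponent_def)
    have "tilt t x \<le> M + 64 * exp (mgf_exponent 1) * M * exp (3 * t) * (exp (mgf_exponent t))\<^sup>2"
      using M t by (intro tilt_right_bound) auto
    also have "\<dots> \<le> M * (exp (3 * t) * exp (200 * x)) + 64 * exp (mgf_exponent 1) * M * exp (3 * t) * exp (200 * x)"
    proof (intro add_mono mult_left_mono le)
      have "1 * 1 \<le> exp (3 * t) * exp (200 * x)" using t elim by (intro mult_mono) auto
      then show "M \<le> M * (exp (3 * t) * exp (200 * x))" using M mult_left_mono[of 1 _ M] by simp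
    qed (use M in auto)
    also have "\<dots> = D * exp (3 * t) * exp (200 * x)" by (simp add: D_def algebra_simps)
    also have "\<dots> = exp (h x)" using D by (simp add: h_def exp_add t_def)
    finally have "f x * exp (x * ln x) \<le> exp (h x)" by (simp add: tilt_def t_def mult.commute)
    then have "f x * exp (x * ln x) * exp (- x * ln x) \<le> exp (h x) * exp (- x * ln x)"
      by (rule mult_right_mono) simp
    also have "f x * exp (x * ln x) * exp (- x * ln x) = f x" by (simp add: mult.assoc exp_add[symmetric])
    also have "exp (h x) * exp (- x * ln x) = exp (- x * ln x + h x)" by (simp add: exp_add[symmetric])
    finally show ?case .
  qed
  ultimately show ?thesis by (rule that)
qed

end

theorem theorem1p1:
  fixes \<mu> :: "real measure" and f :: "real \<Rightarrow> real"
  assumes "limiting_quicksort_law \<mu>"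
    and "continuous_density \<mu> f"
  shows
    "(\<exists>h :: real \<Rightarrow> real. h \<in> O[at_top](\<lambda>_. 1) \<and>
        (\<forall>\<^sub>F x in at_top. exp (- exp (qs_gamma * x + ln (ln x) + h x)) \<le> f (- x))) \<and>
     (\<exists>h :: real \<Rightarrow> real. h \<in> O[at_top](\<lambda>_. 1) \<and>
        (\<forall>\<^sub>F x in at_top. f (- x) \<le> exp (- exp (qs_gamma * x + h x)))) \<and>
     (\<exists>h :: real \<Rightarrow> real. h \<in> O[at_top](\<lambda>x. x) \<and>
        (\<forall>\<^sub>F x in at_top. exp (- x * ln x - x * ln (ln x) + h x) \<le> f x)) \<and>
     (\<exists>h :: real \<Rightarrow> real. h \<in> O[at_top](\<lambda>x. x) \<and>
        (\<forall>\<^sub>F x in at_top. f x \<le> exp (- x * ln x + h x)))"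
proof -
  interpret quicksort_density \<mu> f using assms by unfold_locales
  obtain K where K: "\<And>x. 0 \<le> x \<Longrightarrow> exp (- exp (qs_gamma * x + K)) \<le> f (- x)"
    using left_tail_lower_bound by blast
  \<comment> \<open>For x >= exp 1 one has ln (ln x) >= 0, so inserting this term only lowers the
    left-hand side.\<close>
  have "\<forall>\<^sub>F x in at_top. exp (- exp (qs_gamma * x + ln (ln x) + K)) \<le> f (- x)"
    using eventually_ge_at_top[of "exp 1"]
  proof eventually_elim
    case (elim x)
    have "0 < x" using elim exp_gt_zero[of 1] by linarith
    then have "1 \<le> ln x" using elim by (simp add: ln_ge_iff)
    then have "exp (- exp (qs_gamma * x + ln (ln x) + K)) \<le> exp (- exp (qs_gamma * x + K))" by simp
    also have "\<dots> \<le> f (- x)" using \<open>0 < x\<close> by (intro K) auto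
    finally show ?case .
  qed
  then have 1: "\<exists>h :: real \<Rightarrow> real. h \<in> O[at_top](\<lambda>_. 1) \<and>
      (\<forall>\<^sub>F x in at_top. exp (- exp (qs_gamma * x + ln (ln x) + h x)) \<le> f (- x))"
    by (intro exI[of _ "\<lambda>_. K"]) auto
  obtain k where "\<forall>\<^sub>F x in at_top. f (- x) \<le> exp (- exp (qs_gamma * x + k))"
    using left_tail_upper_bound by blast
  then have 2: "\<exists>h :: real \<Rightarrow> real. h \<in> O[at_top](\<lambda>_. 1) \<and>
      (\<forall>\<^sub>F x in at_top. f (- x) \<le> exp (- exp (qs_gamma * x + h x)))"
    by (intro exI[of _ "\<lambda>_. k"]) auto
  have 3: "\<exists>h :: real \<Rightarrow> real. h \<in> O[at_top](\<lambda>x. x) \<and>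
      (\<forall>\<^sub>F x in at_top. exp (- x * ln x - x * ln (ln x) + h x) \<le> f x)"
    using right_tail_lower_bound by blast
  have 4: "\<exists>h :: real \<Rightarrow> real. h \<in> O[at_top](\<lambda>x. x) \<and>
      (\<forall>\<^sub>F x in at_top. f x \<le> exp (- x * ln x + h x))"
    using right_tail_upper_bound by blast
  show ?thesis
    by (intro conjI 1 2 3 4)
qed

end
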